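(* Let $M$ be a connected smooth manifold with base point $x_0$, let $\mathfrak g=V_1\oplus\cdots\oplus V_n$ be a finite-dimensional graded $n$-step nilpotent Lie algebra generated by $V_1$, and let $G=\exp\mathfrak g$ be its connected, simply connected Lie group. Let $\rho:\pi_1(M,x_0)\to G$ be a representation, and let $\mathcal A\in\Omega^1(M;\mathfrak g)$ be a flat form whose holonomy representation is $\rho$. Let $c:[0,\infty)\to M$ be a path with $c(0)=x_0$, absolutely continuous on compact intervals, and write $c_T=c|_{[0,T]}$. Suppose there is a continuous path $\ell:[0,\infty)\to V_1$ of bounded variation on compact intervals such that, for every $T>0$, $$H[T]:=H[\ell|_{[0,T]}]=L\!\int_{c_T}\mathcal A .$$ For each $T>0$ choose an absolutely continuous closing path $b_T$ from $c(T)$ to $x_0$, set $\gamma_T=b_T*c_T$ (first $c_T$, then $b_T$), and assume that $Q(T):=L\!\int_{b_T}\mathcal A$ remains bounded in $\mathfrak g$. Define $$\ell_T(u)=\frac{\ell(Tu)-\ell(0)}{T},\qquad 0\le u\le 1 .$$ Let $T_j\to\infty$ be a sequence, and assume that $\ell_{T_j}\to\ell^\infty$ uniformly on $[0,1]$, where $\ell^\infty:[0,1]\to V_1$ is a continuous path of bounded variation, and that $\sup_j\operatorname{Var}(\ell_{T_j};[0,1])<\infty$. Then $$\delta_{1/T_j}\log\rho([\gamma_{T_j}])\longrightarrow H[\ell^\infty]\quad\text{in }\mathfrak g,$$ and, equivalently, $$\delta_{1/T_j}\rho([\gamma_{T_j}])\longrightarrow\exp H[\ell^\infty]\quad\text{in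 }G .$$ These sequential limits are independent of the family of closing paths $(b_T)$ among all families for which $Q(T)$ remains bounded. If the uniform convergence $\ell_T\to\ell^\infty$ and the uniform variation bound hold for the full family $\ell_T$ as $T\to\infty$, then the same conclusions hold as full limits as $T\to\infty$.
   Context: Graded setting. $\mathfrak g=V_1\oplus\cdots\oplus V_n$ is a finite-dimensional real Lie algebra with $[V_i,V_j]\subseteq V_{i+j}$, $V_k=\{0\}$ for $k>n$, generated as a Lie algebra by $V_1$, with a fixed norm $\|\cdot\|$. $G$ is the connected, simply connected Lie group with Lie algebra $\mathfrak g$; $\exp:\mathfrak g\to G$ is a global diffeomorphism with inverse $\log$. For $r>0$ the Carnot dilation is $\delta_r(v_1+\cdots+v_n)=rv_1+r^2v_2+\cdots+r^nv_n$ ($v_k\in V_k$); it is a Lie algebra automorphism and integrates to the automorphism of $G$, also denoted $\delta_r$, with $\delta_r(\exp X)=\exp(\delta_rX)$. Bounded variation. $\operatorname{Var}(\gamma;[a,b])=\sup\sum_i\|\gamma(t_i)-\gamma(t_{i-1})\|$ over partitions of $[a,b]$; $\gamma$ has bounded variation (BV) if this is finite. Chacon–Fomenko Lie integral $H[\gamma]$ of a continuous BV path $\gamma:[a,b]\to V_1$. Define iterated Riemann–Stieltjes integrals $I_1(\gamma)_{s,t}=\gamma(t)-\gamma(s)$, $I_q(\gamma)_{s,t}=\int_s^t d\gamma(u)\otimes I_{q-1}(\gamma)_{s,u}\in V_1^{\otimes q}$ for $q\ge2$ (latest increment leftmost). Let $B_q:V_1^{\otimes q}\to V_q$ be the linear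 map with $B_1(v)=v$, $B_q(v_1\otimes\cdots\otimes v_q)=[\cdots[[v_1,v_2],v_3],\ldots,v_q]$, and put $T_j[\gamma]=B_{j+1}(I_{j+1}(\gamma)_{a,b})$, $j\ge 0$. Let $k_{2p}=b_{2p}/(2p)!$ with $b_{2p}$ the Bernoulli numbers. Then $H[\gamma]=H_1[\gamma]+\cdots+H_n[\gamma]$, $H_k[\gamma]\in V_k$, is defined by $H_1[\gamma]=T_0[\gamma]=\gamma(b)-\gamma(a)$ and, for $k\ge1$, $$(k+1)H_{k+1}[\gamma]=T_k[\gamma]+\sum_{r=1}^k\Big\{\tfrac12[H_r[\gamma],T_{k-r}[\gamma]]+\sum_{p\ge1,\,2p\le r}k_{2p}\sum_{m_i>0,\;m_1+\cdots+m_{2p}=r}[H_{m_1}[\gamma],[\cdots[H_{m_{2p}}[\gamma],T_{k-r}[\gamma]]\cdots]]\Big\}.$$ When $\gamma(t)=\int_a^tK(s)\,ds$ is absolutely continuous, this agrees with $\log U(b)$, where $U'(t)=K(t)U(t)$, $U(a)=e$. Flat forms and their Lie integrals. For $\mathcal A\in\Omega^1(M;\mathfrak g)$, flatness means $-d\mathcal A+\mathcal A\wedge\mathcal A=0$, where $(\mathcal A\wedge\mathcal A)(X,Y)=[\mathcal A(X),\mathcal A(Y)]$. For an absolutely continuous path $c:[a,b]\to M$, $L\!\int_c\mathcal A:=\log U(b)\in\mathfrak g$, where $U:[a,b]\to G$ is the absolutely continuous solution of $U'(t)=\mathcal A_{c(t)}(\dot c(t))\,U(t)$ a.e., $U(a)=e$.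 The path $b*a$ traverses $a$ first and then $b$, and $\pi_1(M,x_0)$ carries the product $[b][a]=[b*a]$. The holonomy representation of a flat $\mathcal A$ is $\rho([c])=\exp(L\!\int_c\mathcal A)$ for loops $c$ based at $x_0$. (In the paper's words, $\mathcal A$ is "a flat development form in the based gauge class corresponding to $\rho$".) *)

theory Defs
  imports "HOL-Analysis.Analysis" "HOL-Algebra.Group"
begin

section \<open>Bounded variation, absolute continuity, Riemann--Stieltjes integrals\<close>

definition variation :: "(real \<Rightarrow> 'a::real_normed_vector) \<Rightarrow> real \<Rightarrow> real \<Rightarrow> ennreal" where
  "variation f a b =
     (SUP D \<in> {D. D division_of {a..b}}. ennreal (\<Sum>I\<in>D. norm (f (Sup I) - f (Inf I))))"

definition bounded_variation :: "(real \<Rightarrow> 'a::real_normed_vector) \<Rightarrow> real \<Rightarrow> real \<Rightarrow> bool" where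
  "bounded_variation f a b \<longleftrightarrow> variation f a b < \<infinity>"

definition abs_continuous :: "(real \<Rightarrow> 'a::real_normed_vector) \<Rightarrow> real \<Rightarrow> real \<Rightarrow> bool" where
  "abs_continuous f a b \<longleftrightarrow>
     (\<forall>e>0. \<exists>d>0. \<forall>D. D division_of \<Union>D \<and> \<Union>D \<subseteq> {a..b} \<and> (\<Sum>I\<in>D. Sup I - Inf I) < d \<longrightarrow>
        (\<Sum>I\<in>D. norm (f (Sup I) - f (Inf I))) < e)"

definition has_RS_integral ::
    "(real \<Rightarrow> real) \<Rightarrow> (real \<Rightarrow> real) \<Rightarrow> real \<Rightarrow> real \<Rightarrow> real \<Rightarrow> bool" where
  "has_RS_integral f g a b y \<longleftrightarrow>
     (\<forall>e>0. \<exists>d>0. \<forall>P. P tagged_division_of {a..b} \<and> (\<lambda>x. ball x d) fine P \<longrightarrow>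
        \<bar>(\<Sum>(x, I)\<in>P. f x * (g (Sup I) - g (Inf I))) - y\<bar> < e)"

definition RS_integral :: "(real \<Rightarrow> real) \<Rightarrow> (real \<Rightarrow> real) \<Rightarrow> real \<Rightarrow> real \<Rightarrow> real" where
  "RS_integral f g a b = (THE y. has_RS_integral f g a b y)"


section \<open>Smooth maps and smooth manifolds\<close>

primrec Ck_on :: "nat \<Rightarrow> 'a set \<Rightarrow> ('a::real_normed_vector \<Rightarrow> 'b::real_normed_vector) \<Rightarrow> bool" where
  "Ck_on 0 S f \<longleftrightarrow> continuous_on S f"
| "Ck_on (Suc k) S f \<longleftrightarrow>
     (\<forall>x\<in>S. f differentiable (at x)) \<and> (\<forall>v. Ck_on k S (\<lambda>x. frechet_derivative f (at x) v))"

text \<open>Used only for open \<open>S\<close> in finite-dimensional spaces, where continuity of all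
  iterated directional derivatives is the usual notion of smoothness.\<close>

definition smooth_on :: "'a set \<Rightarrow> ('a::real_normed_vector \<Rightarrow> 'b::real_normed_vector) \<Rightarrow> bool" where
  "smooth_on S f \<longleftrightarrow> (\<forall>k. Ck_on k S f)"

type_synonym ('m, 'e) chart = "'m set \<times> ('m \<Rightarrow> 'e)"

definition transition :: "('m, 'e) chart \<Rightarrow> ('m, 'e) chart \<Rightarrow> 'e \<Rightarrow> 'e" where
  "transition ch ch' = snd ch' \<circ> inv_into (fst ch) (snd ch)"

text \<open>A manifold is a whole (Hausdorff, second countable) type with a smooth atlas. The model
  space is any finite-dimensional normed space, so that dimension zero is not excluded.\<close>

locale smooth_manifold =
  fixes atlas :: "('m::{t2_space, second_countable_topology}, 'e::real_normed_vector) chart set"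
  assumes model_finite_dim: "\<exists>B::'e set. finite B \<and> span B = UNIV"
    and chart_domain: "(U, \<phi>) \<in> atlas \<Longrightarrow> open U"
    and chart_image: "(U, \<phi>) \<in> atlas \<Longrightarrow> open (\<phi> ` U)"
    and chart_homeomorphism: "(U, \<phi>) \<in> atlas \<Longrightarrow> homeomorphism U (\<phi> ` U) \<phi> (inv_into U \<phi>)"
    and charts_cover: "(\<Union>(U, \<phi>)\<in>atlas. U) = UNIV"
    and charts_compatible: "\<lbrakk>(U, \<phi>) \<in> atlas; (W, \<psi>) \<in> atlas\<rbrakk> \<Longrightarrow>
      smooth_on (\<phi> ` (U \<inter> W)) (transition (U, \<phi>) (W, \<psi>))"

definition ac_path ::
    "('m::topological_space, 'e::real_normed_vector) chart set \<Rightarrow> (real \<Rightarrow> 'm) \<Rightarrow> real \<Rightarrow> real \<Rightarrow> bool"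
  where
  "ac_path atlas c a b \<longleftrightarrow>
     continuous_on {a..b} c \<and>
     (\<forall>(U, \<phi>)\<in>atlas. \<forall>s t. a \<le> s \<and> s \<le> t \<and> t \<le> b \<and> c ` {s..t} \<subseteq> U \<longrightarrow>
        abs_continuous (\<phi> \<circ> c) s t)"


section \<open>The fundamental group\<close>

definition based_loop :: "'m::topological_space \<Rightarrow> (real \<Rightarrow> 'm) \<Rightarrow> bool" where
  "based_loop x0 p \<longleftrightarrow> path p \<and> pathstart p = x0 \<and> pathfinish p = x0"

definition loop_class :: "(real \<Rightarrow> 'm::topological_space) \<Rightarrow> (real \<Rightarrow> 'm) set" where
  "loop_class p = {q. homotopic_paths UNIV p q}"

text \<open>The product \<open>\<beta> \<otimes> \<alpha>\<close> is the class of the loop that traverses \<open>\<alpha>\<close> first and then \<open>\<beta>\<close>,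
  whereas \<open>p +++ q\<close> traverses \<open>p\<close> first.\<close>

definition fundamental_group :: "'m::topological_space \<Rightarrow> (real \<Rightarrow> 'm) set monoid" where
  "fundamental_group x0 =
     \<lparr>carrier = loop_class ` {p. based_loop x0 p},
      mult = (\<lambda>\<beta> \<alpha>. {r. \<exists>p\<in>\<alpha>. \<exists>q\<in>\<beta>. homotopic_paths UNIV (p +++ q) r}),
      one = loop_class (\<lambda>_. x0)\<rparr>"


section \<open>Graded nilpotent Lie algebras\<close>

locale lie_algebra =
  fixes bracket :: "'g::real_vector \<Rightarrow> 'g \<Rightarrow> 'g"
  assumes bracket_bilinear: "bilinear bracket"
    and bracket_self: "bracket x x = 0"
    and jacobi: "bracket x (bracket y z) + bracket y (bracket z x) + bracket z (bracket x y) = 0"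

locale graded_lie_algebra = lie_algebra bracket
  for bracket :: "'g::real_normed_vector \<Rightarrow> 'g \<Rightarrow> 'g" +
  fixes V :: "nat \<Rightarrow> 'g set" and n :: nat
  assumes finite_dim: "\<exists>B::'g set. finite B \<and> span B = UNIV"
    and step_pos: "1 \<le> n"
    and layer_subspace: "1 \<le> k \<Longrightarrow> subspace (V k)"
    and layer_trivial: "n < k \<Longrightarrow> V k = {0}"
    and layers_span: "\<exists>v. (\<forall>k\<in>{1..n}. v k \<in> V k) \<and> (\<Sum>k=1..n. v k) = x"
    and layers_independent:
      "\<lbrakk>\<forall>k\<in>{1..n}. v k \<in> V k; (\<Sum>k=1..n. v k) = 0\<rbrakk> \<Longrightarrow> \<forall>k\<in>{1..n}. v k = 0"
    and bracket_layers: "\<lbrakk>1 \<le> i; 1 \<le> j; x \<in> V i; y \<in> V j\<rbrakk> \<Longrightarrow> bracket x y \<in> V (i + j)"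
    and generated_by_first_layer:
      "\<lbrakk>subspace S; V 1 \<subseteq> S; \<forall>x\<in>S. \<forall>y\<in>S. bracket x y \<in> S\<rbrakk> \<Longrightarrow> S = UNIV"

definition layer_part :: "(nat \<Rightarrow> 'g::real_vector set) \<Rightarrow> nat \<Rightarrow> 'g \<Rightarrow> nat \<Rightarrow> 'g" where
  "layer_part V n x = (SOME v. (\<forall>k\<in>{1..n}. v k \<in> V k) \<and> (\<Sum>k=1..n. v k) = x)"

definition dilation :: "(nat \<Rightarrow> 'g::real_vector set) \<Rightarrow> nat \<Rightarrow> real \<Rightarrow> 'g \<Rightarrow> 'g" where
  "dilation V n r x = (\<Sum>k=1..n. r ^ k *\<^sub>R layer_part V n x k)"


section \<open>The Lie group of a nilpotent Lie algebra\<close>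

definition Log :: "('g \<Rightarrow> 'h) \<Rightarrow> 'h \<Rightarrow> 'g" where
  "Log Exp = inv_into UNIV Exp"

definition Ad :: "('h, 'b) monoid_scheme \<Rightarrow> ('g::real_normed_vector \<Rightarrow> 'h) \<Rightarrow> 'h \<Rightarrow> 'g \<Rightarrow> 'g" where
  "Ad G Exp x Y =
     vector_derivative (\<lambda>t. Log Exp (x \<otimes>\<^bsub>G\<^esub> Exp (t *\<^sub>R Y) \<otimes>\<^bsub>G\<^esub> inv\<^bsub>G\<^esub> x)) (at 0)"

text \<open>A Lie group \<open>G\<close> with Lie algebra \<open>(\<gg>, bracket)\<close> whose exponential map is a global
  diffeomorphism: the smooth structure of \<open>G\<close> is carried by the single global chart \<open>Log\<close>
  (so \<open>G\<close> is connected and simply connected). In this chart the tangent space at the identity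
  is \<open>'g\<close>, inversion is \<open>X \<mapsto> - X\<close> and hence smooth, and the
  Lie bracket of \<open>G\<close> is the derivative of \<open>Ad\<close> along \<open>s \<mapsto> Exp (s X)\<close>.\<close>

locale exponential_lie_group = lie_algebra bracket + group G
  for bracket :: "'g::real_normed_vector \<Rightarrow> 'g \<Rightarrow> 'g"
    and G :: "('h::topological_space, 'b) monoid_scheme" (structure) +
  fixes Exp :: "'g \<Rightarrow> 'h"
  assumes Exp_homeomorphism: "homeomorphism UNIV (carrier G) Exp (Log Exp)"
    and mult_smooth: "smooth_on UNIV (\<lambda>(X, Y). Log Exp (Exp X \<otimes> Exp Y))"
    and Exp_one_parameter: "Exp ((s + t) *\<^sub>R X) = Exp (s *\<^sub>R X) \<otimes> Exp (t *\<^sub>R X)"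
    and bracket_is_ad:
      "((\<lambda>s. Ad G Exp (Exp (s *\<^sub>R X)) Y) has_vector_derivative bracket X Y) (at 0)"

definition group_dilation ::
    "('g \<Rightarrow> 'h) \<Rightarrow> (nat \<Rightarrow> 'g::real_vector set) \<Rightarrow> nat \<Rightarrow> real \<Rightarrow> 'h \<Rightarrow> 'h" where
  "group_dilation Exp V n r x = Exp (dilation V n r (Log Exp x))"

text \<open>The equation \<open>U'(t) = K U(t)\<close>: the velocity of \<open>U\<close> at time \<open>t\<close>, right-translated to the
  identity, is \<open>K\<close>.\<close>

definition has_right_velocity ::
    "('h, 'b) monoid_scheme \<Rightarrow> ('g::real_normed_vector \<Rightarrow> 'h) \<Rightarrow> (real \<Rightarrow> 'h) \<Rightarrow> real \<Rightarrow> 'g \<Rightarrow> bool"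
  where
  "has_right_velocity G Exp U t K \<longleftrightarrow>
     ((\<lambda>s. Log Exp (U s \<otimes>\<^bsub>G\<^esub> inv\<^bsub>G\<^esub> (U t))) has_vector_derivative K) (at t)"


section \<open>Lie-algebra-valued forms, flatness, Lie integrals, holonomy\<close>

text \<open>A one-form is given by its coordinate representatives: \<open>A (U, \<phi>) x v\<close> is the value, at the
  point with coordinates \<open>x \<in> \<phi> ` U\<close>, on the tangent vector with coordinates \<open>v\<close>.\<close>

type_synonym ('m, 'e, 'g) form = "('m, 'e) chart \<Rightarrow> 'e \<Rightarrow> 'e \<Rightarrow> 'g"

definition one_form ::
    "('m, 'e::real_normed_vector) chart set \<Rightarrow> ('m, 'e, 'g::real_normed_vector) form \<Rightarrow> bool" where
  "one_form atlas A \<longleftrightarrow>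
     (\<forall>(U, \<phi>)\<in>atlas.
        (\<forall>x\<in>\<phi> ` U. linear (A (U, \<phi>) x)) \<and>
        (\<forall>v. smooth_on (\<phi> ` U) (\<lambda>x. A (U, \<phi>) x v)) \<and>
        (\<forall>(W, \<psi>)\<in>atlas. \<forall>x\<in>\<phi> ` (U \<inter> W). \<forall>v.
           A (U, \<phi>) x v =
           A (W, \<psi>) (transition (U, \<phi>) (W, \<psi>) x)
             (frechet_derivative (transition (U, \<phi>) (W, \<psi>)) (at x) v)))"

definition ext_deriv ::
    "('e::real_normed_vector \<Rightarrow> 'e \<Rightarrow> 'g::real_normed_vector) \<Rightarrow> 'e \<Rightarrow> 'e \<Rightarrow> 'e \<Rightarrow> 'g" where
  "ext_deriv \<alpha> x v w =
     frechet_derivative (\<lambda>y. \<alpha> y w) (at x) v - frechet_derivative (\<lambda>y. \<alpha> y v) (at x) w"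

definition flat_form ::
    "('g \<Rightarrow> 'g \<Rightarrow> 'g) \<Rightarrow> ('m, 'e::real_normed_vector) chart set \<Rightarrow>
      ('m, 'e, 'g::real_normed_vector) form \<Rightarrow> bool" where
  "flat_form bracket atlas A \<longleftrightarrow>
     (\<forall>(U, \<phi>)\<in>atlas. \<forall>x\<in>\<phi> ` U. \<forall>v w.
        - ext_deriv (A (U, \<phi>)) x v w + bracket (A (U, \<phi>) x v) (A (U, \<phi>) x w) = 0)"

text \<open>\<open>A\<close> evaluated on the velocity of \<open>c\<close> at time \<open>t\<close> equals \<open>K\<close>; for a one-form on a manifold
  this does not depend on the chart around \<open>c t\<close>.\<close>

definition form_on_velocity ::
    "('m, 'e::real_normed_vector) chart set \<Rightarrow> ('m, 'e, 'g) form \<Rightarrow> (real \<Rightarrow> 'm) \<Rightarrow> real \<Rightarrow> 'g \<Rightarrow> bool"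
  where
  "form_on_velocity atlas A c t K \<longleftrightarrow>
     (\<exists>(U, \<phi>)\<in>atlas. c t \<in> U \<and>
        (\<exists>v. ((\<phi> \<circ> c) has_vector_derivative v) (at t) \<and> K = A (U, \<phi>) (\<phi> (c t)) v))"

text \<open>A relation in the style of \<^const>\<open>has_integral\<close>: the solution \<open>U\<close>, and with it \<open>X\<close>, is unique.\<close>

definition has_lie_integral ::
    "('h, 'b) monoid_scheme \<Rightarrow> ('g \<Rightarrow> 'h) \<Rightarrow> ('m, 'e::real_normed_vector) chart set \<Rightarrow>
      ('m, 'e, 'g::real_normed_vector) form \<Rightarrow> (real \<Rightarrow> 'm) \<Rightarrow> real \<Rightarrow> real \<Rightarrow> 'g \<Rightarrow> bool" where
  "has_lie_integral G Exp atlas A c a b X \<longleftrightarrow>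
     (\<exists>U. (\<forall>t\<in>{a..b}. U t \<in> carrier G) \<and> abs_continuous (Log Exp \<circ> U) a b \<and> U a = \<one>\<^bsub>G\<^esub> \<and>
        (\<exists>N. negligible N \<and>
           (\<forall>t\<in>{a<..<b} - N. \<exists>K. form_on_velocity atlas A c t K \<and> has_right_velocity G Exp U t K)) \<and>
        X = Log Exp (U b))"

definition holonomy_rep ::
    "('h, 'b) monoid_scheme \<Rightarrow> ('g \<Rightarrow> 'h) \<Rightarrow> ('m::topological_space, 'e::real_normed_vector) chart set \<Rightarrow>
      ('m, 'e, 'g::real_normed_vector) form \<Rightarrow> 'm \<Rightarrow> ((real \<Rightarrow> 'm) set \<Rightarrow> 'h) \<Rightarrow> bool" where
  "holonomy_rep G Exp atlas A x0 \<rho> \<longleftrightarrow>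
     (\<forall>p X. based_loop x0 p \<and> ac_path atlas p 0 1 \<and> has_lie_integral G Exp atlas A p 0 1 X \<longrightarrow>
        \<rho> (loop_class p) = Exp X)"


section \<open>The Chacon--Fomenko Lie integral\<close>

text \<open>Tensors in \<open>V\<^sub>1\<close> of degree \<open>q\<close> are represented by their coefficients with respect to a basis
  \<open>E\<close> of \<open>V\<^sub>1\<close>, that is, by real functions of words of length \<open>q\<close> over \<open>E\<close>. The recursion integrates
  against the first letter, so the latest increment is leftmost; \<open>I\<^sub>0 = 1\<close> gives
  \<open>I\<^sub>1 = \<gamma> t - \<gamma> s\<close>.\<close>

primrec iterated_integral ::
    "'g::real_vector set \<Rightarrow> (real \<Rightarrow> 'g) \<Rightarrow> real \<Rightarrow> 'g list \<Rightarrow> real \<Rightarrow> real" where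
  "iterated_integral E \<gamma> s [] t = 1"
| "iterated_integral E \<gamma> s (e # w) t =
     RS_integral (iterated_integral E \<gamma> s w) (\<lambda>u. representation E (\<gamma> u) e) s t"

fun left_bracket :: "('g::zero \<Rightarrow> 'g \<Rightarrow> 'g) \<Rightarrow> 'g list \<Rightarrow> 'g" where
  "left_bracket bracket [] = 0"
| "left_bracket bracket (v # vs) = foldl bracket v vs"

definition tensor_bracket ::
    "('g::real_vector \<Rightarrow> 'g \<Rightarrow> 'g) \<Rightarrow> 'g set \<Rightarrow> nat \<Rightarrow> ('g list \<Rightarrow> real) \<Rightarrow> 'g" where
  "tensor_bracket bracket E q I =
     (\<Sum>w\<in>{w. set w \<subseteq> E \<and> length w = q}. I w *\<^sub>R left_bracket bracket w)"

text \<open>Any basis of \<open>V\<^sub>1\<close> gives the same value, by multilinearity.\<close>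

definition first_layer_basis :: "(nat \<Rightarrow> 'g::real_vector set) \<Rightarrow> 'g set" where
  "first_layer_basis V = (SOME E. independent E \<and> span E = V 1)"

definition lie_moment ::
    "('g::real_vector \<Rightarrow> 'g \<Rightarrow> 'g) \<Rightarrow> (nat \<Rightarrow> 'g set) \<Rightarrow> (real \<Rightarrow> 'g) \<Rightarrow> real \<Rightarrow> real \<Rightarrow> nat \<Rightarrow> 'g" where
  "lie_moment bracket V \<gamma> a b j =
     tensor_bracket bracket (first_layer_basis V) (Suc j)
       (\<lambda>w. iterated_integral (first_layer_basis V) \<gamma> a w b)"

function bernoulli_number :: "nat \<Rightarrow> real" where
  "bernoulli_number m =
     (if m = 0 then 1
      else - (\<Sum>j\<in>{..<m}. real (Suc m choose j) * bernoulli_number j) / real (Suc m))"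
  by auto
termination
  by (relation "Wellfounded.measure id") auto

declare bernoulli_number.simps [simp del]

text \<open>\<open>lie_component bracket T k\<close> is \<open>H\<^sub>k\<close>; for \<open>k = 1\<close> the recursion reduces to \<open>H\<^sub>1 = T\<^sub>0\<close>.
  The inner sum ranges over the compositions \<open>[m\<^sub>1, \<dots>, m\<^bsub>2p\<^esub>]\<close> of \<open>r\<close>.\<close>

function lie_component :: "('g::real_vector \<Rightarrow> 'g \<Rightarrow> 'g) \<Rightarrow> (nat \<Rightarrow> 'g) \<Rightarrow> nat \<Rightarrow> 'g" where
  "lie_component bracket T 0 = 0"
| "lie_component bracket T (Suc k) =
     (1 / real (Suc k)) *\<^sub>R
       (T k +
        (\<Sum>r\<in>{1..k}.
           (1 / 2) *\<^sub>R bracket (lie_component bracket T r) (T (k - r)) +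
           (\<Sum>p\<in>{p. 1 \<le> p \<and> 2 * p \<le> r}.
              (bernoulli_number (2 * p) / fact (2 * p)) *\<^sub>R
                (\<Sum>ms\<in>{ms. length ms = 2 * p \<and> (\<forall>m\<in>set ms. 0 < m) \<and> sum_list ms = r}.
                   foldr (\<lambda>m Y. bracket (lie_component bracket T m) Y) ms (T (k - r))))))"
  by pat_completeness auto
termination
  by (relation "Wellfounded.measure (\<lambda>(_, _, k). k)") (auto dest!: member_le_sum_list)

declare lie_component.simps(2) [simp del]

definition chacon_fomenko ::
    "('g::real_vector \<Rightarrow> 'g \<Rightarrow> 'g) \<Rightarrow> (nat \<Rightarrow> 'g set) \<Rightarrow> nat \<Rightarrow> (real \<Rightarrow> 'g) \<Rightarrow> real \<Rightarrow> real \<Rightarrow> 'g" where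
  "chacon_fomenko bracket V n \<gamma> a b =
     (\<Sum>k=1..n. lie_component bracket (lie_moment bracket V \<gamma> a b) k)"


section \<open>Closing paths and rescaled paths\<close>

text \<open>Closing paths are parametrized by \<open>[0, 1]\<close>, and \<open>closed_up c b T\<close> runs through \<open>c\<close> on
  \<open>[0, T]\<close> first and then through \<open>b T\<close>.\<close>

definition closing_family ::
    "('h, 'b) monoid_scheme \<Rightarrow> ('g \<Rightarrow> 'h) \<Rightarrow> ('m::topological_space, 'e::real_normed_vector) chart set \<Rightarrow>
      ('m, 'e, 'g::real_normed_vector) form \<Rightarrow> 'm \<Rightarrow> (real \<Rightarrow> 'm) \<Rightarrow>
      (real \<Rightarrow> real \<Rightarrow> 'm) \<Rightarrow> (real \<Rightarrow> 'g) \<Rightarrow> bool" where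
  "closing_family G Exp atlas A x0 c b Q \<longleftrightarrow>
     (\<forall>T>0. ac_path atlas (b T) 0 1 \<and> pathstart (b T) = c T \<and> pathfinish (b T) = x0 \<and>
        has_lie_integral G Exp atlas A (b T) 0 1 (Q T)) \<and>
     bounded (Q ` {0<..})"

definition closed_up :: "(real \<Rightarrow> 'm::topological_space) \<Rightarrow> (real \<Rightarrow> real \<Rightarrow> 'm) \<Rightarrow> real \<Rightarrow> real \<Rightarrow> 'm" where
  "closed_up c b T = (\<lambda>u. c (T * u)) +++ b T"

definition rescaled :: "(real \<Rightarrow> 'g::real_vector) \<Rightarrow> real \<Rightarrow> real \<Rightarrow> 'g" where
  "rescaled l T u = (1 / T) *\<^sub>R (l (T * u) - l 0)"

end

theory Submission
  imports Defs
begin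

text \<open>
  The holonomy of the closed path \<open>b T * c T\<close> is a product of two group elements: concatenating
  the solutions of \<open>U' = A(c') U\<close> along the two pieces gives
  \<open>\<rho> [\<gamma> T] = Exp (Q T) \<otimes> Exp (H T)\<close>, where \<open>H T\<close> is the Chacon--Fomenko integral of \<open>l\<close> on \<open>[0, T]\<close>
  (\<open>holonomy_of_closed_path\<close>). The limit is obtained by applying the dilation \<open>\<delta>\<close> with ratio
  \<open>1 / T\<close> to this product, and three facts are used.

  First, \<open>\<delta>\<close> passes through the product. It is an endomorphism of the graded Lie algebra, and a Lie
  algebra endomorphism \<open>\<phi>\<close> is multiplicative for the group law in exponential coordinates
  (\<open>lie_endomorphism_integrates\<close>). The reason is that the group law is determined by the bracket:
  \<open>s \<mapsto> Ad (Exp (s X)) Y\<close> solves the linear equation \<open>Z' = [X, Z]\<close>, the differential of \<open>Exp\<close> is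
  obtained by integrating \<open>Ad (Exp (s X))\<close> over \<open>s\<close>, and \<open>Exp (t X) \<otimes> Exp Y\<close> is the curve of constant
  right velocity \<open>X\<close>. Each of these descriptions is respected by \<open>\<phi>\<close>.

  Second, \<open>\<delta> (Q T) \<longrightarrow> 0\<close>, because \<open>Q T\<close> stays bounded and every layer is multiplied by a positive
  power of \<open>1 / T\<close>. So the closing path leaves no trace in the limit.

  Third, \<open>\<delta> (H T)\<close> is the Chacon--Fomenko integral of the rescaled path
  \<open>u \<mapsto> (l (T u) - l 0) / T\<close> on \<open>[0, 1]\<close> (\<open>chacon_fomenko_rescaled\<close>): the moments of degree \<open>q\<close> scale
  by \<open>T\<close> to the power \<open>- q\<close>, which is how \<open>\<delta>\<close> acts on the layer \<open>V q\<close>, and the recursion for \<open>H\<close> is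
  built from brackets only. The Chacon--Fomenko integral is continuous along uniformly convergent
  paths with bounded total variation (\<open>tendsto_chacon_fomenko\<close>): the recursion is a
  continuous expression in the moments, and the iterated integrals converge by induction on their
  length, where the variation bound controls the integrator and uniform convergence controls
  integrand and integrator (\<open>uniform_limit_RS_integral\<close>).

  Since the group law is continuous, \<open>\<delta> (log \<rho> [\<gamma> T])\<close> tends to the product of \<open>0\<close> and the integral of
  the limit path. The argument is carried out along an arbitrary filter, which covers sequences and
  the full limit \<open>T \<longrightarrow> \<infinity>\<close> at once.
\<close>

section \<open>Finite-dimensional normed spaces\<close>

text \<open>Both sides are homogeneous in \<open>a\<close>, so it suffices to bound the norm below on the unit sphere of the
  coefficient space. That sphere is compact as a closed subset of a product of intervals, and
  independence keeps the norm positive on it.\<close>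

lemma independent_coordinates_lower_bound:
  fixes E :: "'g::real_normed_vector set"
  assumes "finite E" "independent E"
  shows "\<exists>m>0. \<forall>a. m * (\<Sum>e\<in>E. \<bar>a e\<bar>) \<le> norm (\<Sum>e\<in>E. a e *\<^sub>R e)"
proof -
  \<comment> \<open>coefficient families with entries in \<open>[-1, 1]\<close>, vanishing outside of \<open>E\<close>\<close>
  define K where "K = (PiE UNIV (\<lambda>e. if e \<in> E then {-1..1} else {0::real}) :: ('g \<Rightarrow> real) set)"
  have "compactin (product_topology (\<lambda>_. euclidean) UNIV) K"
    unfolding K_def compactin_PiE by (auto simp: compactin_euclidean_iff)
  then have K: "compact K"
    by (simp add: euclidean_product_topology compactin_euclidean_iff)
  define S where "S = K \<inter> {a. (\<Sum>e\<in>E. \<bar>a e\<bar>) = 1}"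
  have "closed {a :: 'g \<Rightarrow> real. (\<Sum>e\<in>E. \<bar>a e\<bar>) = 1}"
    by (intro closed_Collect_eq continuous_intros) (auto intro: continuous_on_product_coordinates)
  then have S: "compact S" unfolding S_def by (intro compact_Int_closed K)
  define N where "N a = norm (\<Sum>e\<in>E. a e *\<^sub>R e)" for a :: "'g \<Rightarrow> real"
  have cN: "continuous_on S N" unfolding N_def
    by (intro continuous_intros) (auto intro: continuous_on_product_coordinates continuous_on_subset)
  have pos: "N a > 0" if "a \<in> S" for a
  proof -
    have "(\<Sum>e\<in>E. a e *\<^sub>R e) \<noteq> 0"
    proof
      assume "(\<Sum>e\<in>E. a e *\<^sub>R e) = 0"
      then have "\<forall>e\<in>E. a e = 0" using assms independentD by blast
      then show False using that by (simp add: S_def)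
    qed
    then show ?thesis by (simp add: N_def)
  qed
  obtain m where m: "m > 0" "\<And>a. a \<in> S \<Longrightarrow> m \<le> N a"
  proof (cases "S = {}")
    case True then show ?thesis using that[of 1] by simp
  next
    case False
    from continuous_attains_inf[OF S False cN] obtain a where "a \<in> S" "\<forall>y\<in>S. N a \<le> N y" by blast
    then show ?thesis using that[of "N a"] pos by blast
  qed
  have "m * (\<Sum>e\<in>E. \<bar>a e\<bar>) \<le> norm (\<Sum>e\<in>E. a e *\<^sub>R e)" for a
  proof (cases "(\<Sum>e\<in>E. \<bar>a e\<bar>) = 0")
    case True then show ?thesis by simp
  next
    case False
    define s where "s = (\<Sum>e\<in>E. \<bar>a e\<bar>)"
    have s: "s > 0" using False unfolding s_def by (simp add: order_less_le sum_nonneg)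
    define a' where "a' e = (if e \<in> E then a e / s else 0)" for e
    have "\<bar>a e\<bar> \<le> s" if "e \<in> E" for e
      unfolding s_def using member_le_sum[of e E "\<lambda>e. \<bar>a e\<bar>"] that assms by simp
    then have "\<bar>a' e\<bar> \<le> 1" for e using s by (simp add: a'_def)
    then have "a' \<in> K" unfolding K_def by (auto simp: a'_def abs_le_iff) (smt (verit))+
    moreover have "(\<Sum>e\<in>E. \<bar>a' e\<bar>) = 1"
      using s by (simp add: a'_def sum_divide_distrib[symmetric] flip: s_def)
    ultimately have "m \<le> N a'" by (intro m) (simp add: S_def)
    also have "N a' = norm ((1/s) *\<^sub>R (\<Sum>e\<in>E. a e *\<^sub>R e))"
      unfolding N_def by (simp add: a'_def scaleR_right.sum divide_inverse mult.commute)
    also have "\<dots> = norm (\<Sum>e\<in>E. a e *\<^sub>R e) / s" using s by simp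
    finally show ?thesis using s by (simp add: s_def[symmetric] field_simps)
  qed
  then show ?thesis using m(1) by blast
qed

text \<open>This is the entry point for all continuity statements on a normed space that is known to be
  finite-dimensional only through a finite spanning set: coordinate functionals are continuous.\<close>

lemma bounded_coordinates:
  fixes E :: "'g::real_normed_vector set"
  assumes "finite E" "independent E"
  obtains C where "C > 0" "\<And>x e. x \<in> span E \<Longrightarrow> \<bar>representation E x e\<bar> \<le> C * norm x"
proof -
  obtain m where m: "m > 0" "\<And>a. m * (\<Sum>e\<in>E. \<bar>a e\<bar>) \<le> norm (\<Sum>e\<in>E. a e *\<^sub>R e)"
    using independent_coordinates_lower_bound[OF assms] by blast
  have "\<bar>representation E x e\<bar> \<le> (1/m) * norm x" if "x \<in> span E" for x e
  proof -
    have "\<bar>representation E x e\<bar> \<le> (\<Sum>e\<in>E. \<bar>representation E x e\<bar>)"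
    proof (cases "e \<in> E")
      case True then show ?thesis using member_le_sum[of e E "\<lambda>e. \<bar>representation E x e\<bar>"] assms by simp
    next
      case False
      then have "representation E x e = 0" using representation_ne_zero by blast
      then show ?thesis by (simp add: sum_nonneg)
    qed
    also have "\<dots> \<le> (1/m) * norm (\<Sum>e\<in>E. representation E x e *\<^sub>R e)"
      using m by (simp add: field_simps)
    also have "(\<Sum>e\<in>E. representation E x e *\<^sub>R e) = x"
      using sum_representation_eq[of E x E] assms that by simp
    finally show ?thesis .
  qed
  then show ?thesis using m(1) that[of "1/m"] by simp
qed

abbreviation finite_dimensional :: "'g::real_vector itself \<Rightarrow> bool" where
  "finite_dimensional _ \<equiv> \<exists>B::'g set. finite B \<and> span B = UNIV"

lemma finite_dimensional_basis:
  assumes "finite_dimensional TYPE('g::real_vector)"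
  obtains E :: "'g::real_vector set" where "finite E" "independent E" "span E = UNIV"
proof -
  from assms obtain B :: "'g set" where B: "finite B" "span B = UNIV" by blast
  obtain E where "E \<subseteq> B" "independent E" "B \<subseteq> span E" using maximal_independent_subset[of B] by blast
  then show ?thesis using that[of E] B by (metis finite_subset span_mono span_span top.extremum_uniqueI)
qed

lemma finite_dimensional_linear_bounded:
  fixes f :: "'g::real_normed_vector \<Rightarrow> 'k::real_normed_vector"
  assumes fd: "finite_dimensional TYPE('g)" and "linear f"
  shows "bounded_linear f"
proof -
  interpret f: linear f by fact
  obtain E :: "'g set" where E: "finite E" "independent E" "span E = UNIV"
    using finite_dimensional_basis[OF fd] by blast
  obtain C where C: "C > 0" "\<And>x e. \<bar>representation E x e\<bar> \<le> C * norm x"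
    using bounded_coordinates[OF E(1,2)] E(3) by auto
  have "norm (f x) \<le> norm x * (\<Sum>e\<in>E. C * norm (f e))" for x
  proof -
    have "f x = f (\<Sum>e\<in>E. representation E x e *\<^sub>R e)"
      using sum_representation_eq[of E x E] E by simp
    also have "\<dots> = (\<Sum>e\<in>E. representation E x e *\<^sub>R f e)" by (simp add: f.sum f.scaleR)
    also have "norm \<dots> \<le> (\<Sum>e\<in>E. norm (representation E x e *\<^sub>R f e))" by (rule norm_sum)
    also have "\<dots> \<le> (\<Sum>e\<in>E. (C * norm x) * norm (f e))"
      by (intro sum_mono) (simp add: C(2) mult_right_mono)
    finally show ?thesis by (simp add: sum_distrib_left mult_ac)
  qed
  then show ?thesis by (intro bounded_linear_intro[where K="\<Sum>e\<in>E. C * norm (f e)"]) (auto simp: f.add f.scaleR)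
qed

lemma finite_dimensional_bilinear_bounded:
  fixes f :: "'g::real_normed_vector \<Rightarrow> 'g \<Rightarrow> 'k::real_normed_vector"
  assumes fd: "finite_dimensional TYPE('g)" and "bilinear f"
  shows "bounded_bilinear f"
proof -
  obtain E :: "'g set" where E: "finite E" "independent E" "span E = UNIV"
    using finite_dimensional_basis[OF fd] by blast
  obtain C where C: "C > 0" "\<And>x e. \<bar>representation E x e\<bar> \<le> C * norm x"
    using bounded_coordinates[OF E(1,2)] E(3) by auto
  have lin1: "linear (\<lambda>x. f x y)" and lin2: "linear (f x)" for x y
    using \<open>bilinear f\<close> by (auto simp: bilinear_def)
  have bl: "bounded_linear (f x)" for x
    by (rule finite_dimensional_linear_bounded[OF fd lin2])
  have "norm (f x y) \<le> norm x * norm y * (\<Sum>e\<in>E. C * onorm (f e))" for x y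
  proof -
    have "f x y = f (\<Sum>e\<in>E. representation E x e *\<^sub>R e) y"
      using sum_representation_eq[of E x E] E by simp
    also have "\<dots> = (\<Sum>e\<in>E. representation E x e *\<^sub>R f e y)"
      by (simp add: linear_sum[OF lin1] linear_scale[OF lin1])
    also have "norm \<dots> \<le> (\<Sum>e\<in>E. norm (representation E x e *\<^sub>R f e y))" by (rule norm_sum)
    also have "\<dots> \<le> (\<Sum>e\<in>E. (C * norm x) * (onorm (f e) * norm y))"
      by (intro sum_mono) (auto intro!: mult_mono C onorm[OF bl] simp: C(1) less_imp_le)
    finally show ?thesis by (simp add: sum_distrib_left mult_ac)
  qed
  then have bound: "\<exists>K. \<forall>x y. norm (f x y) \<le> norm x * norm y * K"
    by (intro exI[of _ "\<Sum>e\<in>E. C * onorm (f e)"]) simp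
  show ?thesis
  proof
    show "f (x + x') y = f x y + f x' y" for x x' y using linear_add[OF lin1[of y]] .
    show "f x (y + y') = f x y + f x y'" for x y y' using linear_add[OF lin2[of x]] .
    show "f (r *\<^sub>R x) y = r *\<^sub>R f x y" for r x y using linear_scale[OF lin1[of y]] .
    show "f x (r *\<^sub>R y) = r *\<^sub>R f x y" for r x y using linear_scale[OF lin2[of x]] .
  qed (rule bound)
qed

text \<open>Continuity of the derivative is assumed one direction at a time. Expanding a vector in a basis bounds
  the operator norm of \<open>D x\<close> by finitely many continuous functions of \<open>x\<close>, hence locally
  uniformly, and compactness passes from local to global Lipschitz constants.\<close>

lemma continuous_derivative_imp_lipschitz_on_compact:
  fixes f :: "'g::real_normed_vector \<Rightarrow> 'k::real_normed_vector"
  assumes fd: "finite_dimensional TYPE('g)"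
    and der: "\<And>x. (f has_derivative D x) (at x)"
    and cont: "\<And>v. continuous_on UNIV (\<lambda>x. D x v)"
    and "compact S"
  obtains L where "L-lipschitz_on S f"
proof -
  obtain E :: "'g set" where E: "finite E" "independent E" "span E = UNIV"
    using finite_dimensional_basis[OF fd] by blast
  obtain C where C: "C > 0" "\<And>x e. \<bar>representation E x e\<bar> \<le> C * norm x"
    using bounded_coordinates[OF E(1,2)] E(3) by auto
  have loc: "\<exists>u>0. \<exists>L. L-lipschitz_on (cball x u) f" for x
  proof -
    define h where "h y = (\<Sum>e\<in>E. C * norm (D y e))" for y
    have "continuous_on UNIV h" unfolding h_def by (intro continuous_intros cont)
    then have "isCont h x" by (simp add: continuous_on_eq_continuous_at)
    then obtain d where d: "d > 0" "\<And>y. dist y x < d \<Longrightarrow> dist (h y) (h x) < 1"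
      unfolding continuous_at_eps_delta by (metis zero_less_one)
    have ls: "norm (D y v) \<le> h y * norm v" for y v
    proof -
      interpret D: bounded_linear "D y" using der has_derivative_bounded_linear by blast
      have "D y v = D y (\<Sum>e\<in>E. representation E v e *\<^sub>R e)"
        using sum_representation_eq[of E v E] E by simp
      also have "\<dots> = (\<Sum>e\<in>E. representation E v e *\<^sub>R D y e)" by (simp add: D.sum D.scaleR)
      also have "norm \<dots> \<le> (\<Sum>e\<in>E. norm (representation E v e *\<^sub>R D y e))" by (rule norm_sum)
      also have "\<dots> \<le> (\<Sum>e\<in>E. (C * norm v) * norm (D y e))"
        by (intro sum_mono) (simp add: C(2) mult_right_mono)
      finally show ?thesis unfolding h_def sum_distrib_right by (simp only: mult_ac)
    qed
    have hx: "h x \<ge> 0" unfolding h_def using C by (intro sum_nonneg) auto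
    have "(h x + 1)-lipschitz_on (cball x (d/2)) f"
    proof (rule lipschitz_onI)
      fix y z assume yz: "y \<in> cball x (d/2)" "z \<in> cball x (d/2)"
      have "norm (f y - f z) \<le> (h x + 1) * norm (y - z)"
      proof (rule differentiable_bound[OF convex_cball _ _ yz])
        show "(f has_derivative D p) (at p within cball x (d / 2))" if "p \<in> cball x (d / 2)" for p
          using der has_derivative_at_withinI by blast
        show "onorm (D p) \<le> h x + 1" if "p \<in> cball x (d / 2)" for p
        proof (rule onorm_bound)
          show "0 \<le> h x + 1" using hx by simp
          have "h p \<le> h x + 1" using d(2)[of p] that d(1) by (simp add: dist_commute dist_real_def)
          then show "norm (D p v) \<le> (h x + 1) * norm v" for v
            using ls[of p v] by (meson mult_right_mono norm_ge_zero order_trans)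
        qed
      qed
      then show "dist (f y) (f z) \<le> (h x + 1) * dist y z" by (simp add: dist_norm)
    qed (use hx in simp)
    then show ?thesis using d(1) by (metis half_gt_zero)
  qed
  have "local_lipschitz {0::real} S (\<lambda>_. f)"
  proof (rule local_lipschitzI)
    fix t :: real and x assume "x \<in> S"
    from loc[of x] obtain u L where "u > 0" "L-lipschitz_on (cball x u) f" by blast
    then show "\<exists>u>0. \<exists>L. \<forall>t\<in>cball t u \<inter> {0}. L-lipschitz_on (cball x u \<inter> S) f"
      using lipschitz_on_subset by (metis inf_le1)
  qed
  from local_lipschitz_compact_implies_lipschitz[OF this \<open>compact S\<close>] show ?thesis
    using that by (metis compact_sing continuous_on_const singletonI)
qed

section \<open>Riemann--Stieltjes integrals against functions of bounded variation\<close>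

definition RS_sum :: "(real \<Rightarrow> real) \<Rightarrow> (real \<Rightarrow> real) \<Rightarrow> (real \<times> real set) set \<Rightarrow> real" where
  "RS_sum f g P = (\<Sum>(x, I)\<in>P. f x * (g (Sup I) - g (Inf I)))"

text \<open>The increments of \<open>g\<close> are bounded by those of \<open>w\<close>, which is then monotone. For a function of
  bounded variation, \<open>w t\<close> can be the variation on \<open>[a, t]\<close>. Estimates for Riemann--Stieltjes sums
  only need such a \<open>w\<close>, because sums of its increments telescope.\<close>

definition controls :: "(real \<Rightarrow> real) \<Rightarrow> (real \<Rightarrow> 'a::real_normed_vector) \<Rightarrow> real \<Rightarrow> real \<Rightarrow> bool" where
  "controls w g a b \<longleftrightarrow> (\<forall>s t. a \<le> s \<and> s \<le> t \<and> t \<le> b \<longrightarrow> norm (g t - g s) \<le> w t - w s)"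

text \<open>The point of the interval \<open>K\<close> nearest to \<open>t\<close>. Clamping the end points of an interval \<open>I\<close> to \<open>K\<close>
  gives the end points of \<open>I \<inter> K\<close>, or two equal points if \<open>I\<close> and \<open>K\<close> are disjoint.\<close>

definition clamp_to :: "real set \<Rightarrow> real \<Rightarrow> real" where
  "clamp_to K t = max (Inf K) (min t (Sup K))"

lemma tagged_division_real_interval:
  fixes K :: "real set"
  assumes "P tagged_division_of {a..b}" "(x, K) \<in> P"
  shows "K = {Inf K..Sup K}" "a \<le> Inf K" "Inf K \<le> x" "x \<le> Sup K" "Sup K \<le> b"
proof -
  from tagged_division_ofD(2-4)[OF assms] obtain u v where uv: "x \<in> K" "K \<subseteq> {a..b}" "K = cbox u v" by blast
  then have "u \<le> v" by auto
  with uv have "Inf K = u" "Sup K = v" by auto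
  with uv show "K = {Inf K..Sup K}" "a \<le> Inf K" "Inf K \<le> x" "x \<le> Sup K" "Sup K \<le> b"
    by (auto simp: subset_eq)
qed

text \<open>Clamping one interval to another produces the same increment as clamping the other to the first:
  it is the increment over the intersection, and it vanishes when the intervals are disjoint.\<close>

lemma clamp_increment_symmetric:
  fixes p q u v :: real
  assumes "p \<le> q" "u \<le> v"
  shows "g (max p (min v q)) - g (max p (min u q)) = (g (max u (min q v)) - g (max u (min p v)) :: real)"
  using assms by (auto simp: max_def min_def)

text \<open>Both Riemann--Stieltjes sums are expanded into a double sum over pairs \<open>(I, J)\<close> of intervals of the
  two divisions, with the increment of \<open>g\<close> over \<open>I \<inter> J\<close>. A pair contributes only if \<open>I\<close> and \<open>J\<close>
  meet, and then their tags are closer than \<open>2 * d\<close>; the increments of \<open>w\<close> add up to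
  \<open>w t - w a\<close>. Stopping \<open>g\<close> at time \<open>t\<close> lets a single
  division of \<open>[a, b]\<close> serve all end points \<open>t\<close>, which gives estimates uniform in \<open>t\<close>. Two integrands
  are allowed in order to compare the integrals of a convergent sequence with those of its limit.\<close>

lemma RS_sum_compare:
  fixes f f' g w :: "real \<Rightarrow> real"
  assumes ctrl: "controls w g a b" and at: "a \<le> t" "t \<le> b"
    and P: "P tagged_division_of {a..t}" "(\<lambda>x. ball x d) fine P"
    and P': "P' tagged_division_of {a..b}" "(\<lambda>x. ball x d) fine P'"
    and near: "\<And>x y. \<lbrakk>x \<in> {a..t}; y \<in> {a..b}; \<bar>x - y\<bar> < 2 * d\<rbrakk> \<Longrightarrow> \<bar>f x - f' y\<bar> \<le> e"
    and e: "0 \<le> e"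
  shows "\<bar>RS_sum f g P - RS_sum f' (\<lambda>s. g (min t s)) P'\<bar> \<le> e * (w t - w a)"
proof -
  have ab: "a \<le> b" using at by simp
  \<comment> \<open>increment of \<open>h\<close> over \<open>I \<inter> J\<close>\<close>
  define \<Delta> where "\<Delta> h I J = h (clamp_to I (Sup J)) - h (clamp_to I (Inf J))" for h :: "real \<Rightarrow> real" and I J
  let ?h = "\<lambda>s. g (min t s)"
  let ?v = "\<lambda>s. w (min t s)"
  have fin: "finite P" "finite P'" using P P' by auto
  have sym: "\<Delta> h I J = \<Delta> h J I" if "(x, I) \<in> P" "(y, J) \<in> P'" for h x I y J
  proof -
    note I = tagged_division_real_interval[OF P(1) that(1)]
    note J = tagged_division_real_interval[OF P'(1) that(2)]
    have "Inf I \<le> Sup I" "Inf J \<le> Sup J" using I J by linarith+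
    then show ?thesis unfolding \<Delta>_def clamp_to_def by (rule clamp_increment_symmetric)
  qed
  have row: "(\<Sum>(y, J)\<in>P'. \<Delta> h J I) = h (Sup I) - h (Inf I)" if "(x, I) \<in> P" for h x I
  proof -
    have "(\<Sum>(y, J)\<in>P'. \<Delta> h J I) = (\<Sum>(y, J)\<in>P'. \<Delta> h I J)"
      using sym that by (intro sum.cong) auto
    also have "\<dots> = h (clamp_to I b) - h (clamp_to I a)"
      unfolding \<Delta>_def using additive_tagged_division_1[OF ab P'(1), of "\<lambda>s. h (clamp_to I s)"] .
    also have "\<dots> = h (Sup I) - h (Inf I)"
    proof -
      note I = tagged_division_real_interval[OF P(1) that]
      have "clamp_to I b = Sup I" "clamp_to I a = Inf I"
        using I(2-5) at unfolding clamp_to_def by linarith+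
      then show ?thesis by simp
    qed
    finally show ?thesis .
  qed
  have col: "(\<Sum>(x, I)\<in>P. \<Delta> (\<lambda>s. h (min t s)) J I) = h (min t (Sup J)) - h (min t (Inf J))"
    if "(y, J) \<in> P'" for h y J
  proof -
    have "(\<Sum>(x, I)\<in>P. \<Delta> (\<lambda>s. h (min t s)) J I) = h (min t (clamp_to J t)) - h (min t (clamp_to J a))"
      unfolding \<Delta>_def using additive_tagged_division_1[OF at(1) P(1), of "\<lambda>s. h (min t (clamp_to J s))"] .
    also have "\<dots> = h (min t (Sup J)) - h (min t (Inf J))"
    proof -
      note J = tagged_division_real_interval[OF P'(1) that]
      have "min t (clamp_to J t) = min t (Sup J)" "min t (clamp_to J a) = min t (Inf J)"
        using J(2-5) at unfolding clamp_to_def by linarith+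
      then show ?thesis by simp
    qed
    finally show ?thesis .
  qed
  have "RS_sum f g P = (\<Sum>(x, I)\<in>P. f x * (?h (Sup I) - ?h (Inf I)))"
    unfolding RS_sum_def
  proof (intro sum.cong refl, clarify)
    fix x I assume "(x, I) \<in> P"
    note I = tagged_division_real_interval[OF P(1) this]
    have "min t (Sup I) = Sup I" "min t (Inf I) = Inf I" using I(2-5) by linarith+
    then show "f x * (g (Sup I) - g (Inf I)) = f x * (?h (Sup I) - ?h (Inf I))" by simp
  qed
  also have "\<dots> = (\<Sum>(x, I)\<in>P. \<Sum>(y, J)\<in>P'. f x * \<Delta> ?h J I)"
  proof (intro sum.cong refl, clarify)
    fix x I assume xI: "(x, I) \<in> P"
    show "f x * (?h (Sup I) - ?h (Inf I)) = (\<Sum>(y, J)\<in>P'. f x * \<Delta> ?h J I)"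
      unfolding row[OF xI, of ?h, symmetric] by (simp add: sum_distrib_left case_prod_unfold)
  qed
  finally have 1: "RS_sum f g P = (\<Sum>(x, I)\<in>P. \<Sum>(y, J)\<in>P'. f x * \<Delta> ?h J I)" .
  have "RS_sum f' ?h P' = (\<Sum>(y, J)\<in>P'. \<Sum>(x, I)\<in>P. f' y * \<Delta> ?h J I)"
    unfolding RS_sum_def
  proof (intro sum.cong refl, clarify)
    fix y J assume yJ: "(y, J) \<in> P'"
    show "f' y * (?h (Sup J) - ?h (Inf J)) = (\<Sum>(x, I)\<in>P. f' y * \<Delta> ?h J I)"
      unfolding col[OF yJ, of g, symmetric] by (simp add: sum_distrib_left case_prod_unfold)
  qed
  also have "\<dots> = (\<Sum>(x, I)\<in>P. \<Sum>(y, J)\<in>P'. f' y * \<Delta> ?h J I)"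
    unfolding case_prod_unfold by (rule sum.swap)
  finally have 2: "RS_sum f' ?h P' = (\<Sum>(x, I)\<in>P. \<Sum>(y, J)\<in>P'. f' y * \<Delta> ?h J I)" .
  have "RS_sum f g P - RS_sum f' ?h P' = (\<Sum>(x, I)\<in>P. \<Sum>(y, J)\<in>P'. (f x - f' y) * \<Delta> ?h J I)"
    unfolding 1 2 by (simp add: case_prod_unfold sum_subtractf[symmetric] left_diff_distrib)
  also have "\<bar>\<dots>\<bar> \<le> (\<Sum>(x, I)\<in>P. \<Sum>(y, J)\<in>P'. e * \<Delta> w J I)"
    unfolding case_prod_unfold
  proof (rule order_trans[OF sum_abs], rule sum_mono, rule order_trans[OF sum_abs], rule sum_mono)
    fix p q assume pq: "p \<in> P" "q \<in> P'"
    obtain x I y J where xy: "p = (x, I)" "q = (y, J)" by (metis surj_pair)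
    have I: "I = {Inf I..Sup I}" "a \<le> Inf I" "Inf I \<le> x" "x \<le> Sup I" "Sup I \<le> t"
      using tagged_division_real_interval[OF P(1)] pq xy by metis+
    have J: "J = {Inf J..Sup J}" "a \<le> Inf J" "Inf J \<le> y" "y \<le> Sup J" "Sup J \<le> b"
      using tagged_division_real_interval[OF P'(1)] pq xy by metis+
    have "\<bar>(f x - f' y) * \<Delta> ?h J I\<bar> \<le> e * \<Delta> w J I"
    proof (cases "Sup I < Inf J \<or> Sup J < Inf I")
      case True
      then have "clamp_to J (Sup I) = clamp_to J (Inf I)"
        using I(2-5) J(2-5) unfolding clamp_to_def by linarith
      then show ?thesis by (simp add: \<Delta>_def)
    next
      case False
      define z where "z = max (Inf I) (Inf J)"
      have "z \<in> {Inf I..Sup I}" "z \<in> {Inf J..Sup J}"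
        using False I(2-5) J(2-5) unfolding z_def by auto
      then have "z \<in> I" "z \<in> J" using I(1) J(1) by metis+
      moreover have "I \<subseteq> ball x d" "J \<subseteq> ball y d" using P(2) P'(2) pq xy by (auto dest!: fineD)
      ultimately have "\<bar>x - z\<bar> < d" "\<bar>y - z\<bar> < d" by (auto simp: dist_real_def subset_eq)
      then have "\<bar>f x - f' y\<bar> \<le> e" using I J at by (intro near; simp; linarith)
      moreover have "\<bar>\<Delta> ?h J I\<bar> \<le> \<Delta> w J I"
      proof -
        have *: "a \<le> clamp_to J (Inf I)" "clamp_to J (Inf I) \<le> clamp_to J (Sup I)" "clamp_to J (Sup I) \<le> t"
          using I(2-5) J(2-5) at False unfolding clamp_to_def by linarith+
        then have "norm (g (clamp_to J (Sup I)) - g (clamp_to J (Inf I))) \<le> \<Delta> w J I"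
          using ctrl at unfolding controls_def \<Delta>_def by (meson order_trans)
        moreover have "min t (clamp_to J (Sup I)) = clamp_to J (Sup I)"
            "min t (clamp_to J (Inf I)) = clamp_to J (Inf I)" using * by auto
        ultimately show ?thesis by (simp add: \<Delta>_def)
      qed
      ultimately show ?thesis by (simp add: abs_mult mult_mono e)
    qed
    then show "\<bar>(f (fst p) - f' (fst q)) * \<Delta> ?h (snd q) (snd p)\<bar> \<le> e * \<Delta> w (snd q) (snd p)"
      by (simp add: xy)
  qed
  also have "\<dots> = (\<Sum>(x, I)\<in>P. e * (w (Sup I) - w (Inf I)))"
  proof (intro sum.cong refl, clarify)
    fix x I assume xI: "(x, I) \<in> P"
    show "(\<Sum>(y, J)\<in>P'. e * \<Delta> w J I) = e * (w (Sup I) - w (Inf I))"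
      unfolding row[OF xI, of w, symmetric] by (simp add: sum_distrib_left case_prod_unfold)
  qed
  also have "\<dots> = e * (\<Sum>(x, I)\<in>P. w (Sup I) - w (Inf I))"
    by (simp add: sum_distrib_left case_prod_unfold)
  also have "\<dots> = e * (w t - w a)"
    using additive_tagged_division_1[OF at(1) P(1), of w] by simp
  finally show ?thesis .
qed

lemma has_RS_integral_iff_RS_sum:
  "has_RS_integral f g a b y \<longleftrightarrow>
     (\<forall>e>0. \<exists>d>0. \<forall>P. P tagged_division_of {a..b} \<and> (\<lambda>x. ball x d) fine P \<longrightarrow> \<bar>RS_sum f g P - y\<bar> < e)"
  unfolding has_RS_integral_def RS_sum_def by simp

lemma RS_sum_cong:
  assumes P: "P tagged_division_of {a..b}"
    and "\<And>x. x \<in> {a..b} \<Longrightarrow> f x = f' x" "\<And>x. x \<in> {a..b} \<Longrightarrow> g x = g' x"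
  shows "RS_sum f g P = RS_sum f' g' P"
  unfolding RS_sum_def
proof (intro sum.cong refl, clarify)
  fix x I assume "(x, I) \<in> P"
  note I = tagged_division_real_interval[OF P(1) this]
  have "x \<in> {a..b}" "Sup I \<in> {a..b}" "Inf I \<in> {a..b}" using I(2-5) by auto
  then show "f x * (g (Sup I) - g (Inf I)) = f' x * (g' (Sup I) - g' (Inf I))"
    using assms by simp
qed

lemma has_RS_integral_cong:
  assumes "\<And>x. x \<in> {a..b} \<Longrightarrow> f x = f' x" "\<And>x. x \<in> {a..b} \<Longrightarrow> g x = g' x"
  shows "has_RS_integral f g a b y \<longleftrightarrow> has_RS_integral f' g' a b y"
  unfolding has_RS_integral_iff_RS_sum using RS_sum_cong[of _ a b f f' g g'] assms by metis

lemma fine_tagged_division_exists: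
  assumes "(d::real) > 0"
  obtains P where "P tagged_division_of {a..b::real}" "(\<lambda>x. ball x d) fine P"
  using fine_division_exists_real[of "\<lambda>x. ball x d" a b] assms by auto

lemma has_RS_integral_unique:
  assumes "has_RS_integral f g a b y" "has_RS_integral f g a b z"
  shows "y = z"
proof (rule ccontr)
  assume "y \<noteq> z"
  define e where "e = \<bar>y - z\<bar> / 2"
  have e: "e > 0" using \<open>y \<noteq> z\<close> by (simp add: e_def)
  from assms(1) e obtain d1 where d1: "d1 > 0"
    "\<And>P. P tagged_division_of {a..b} \<Longrightarrow> (\<lambda>x. ball x d1) fine P \<Longrightarrow> \<bar>RS_sum f g P - y\<bar> < e"
    unfolding has_RS_integral_iff_RS_sum by meson
  from assms(2) e obtain d2 where d2: "d2 > 0"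
    "\<And>P. P tagged_division_of {a..b} \<Longrightarrow> (\<lambda>x. ball x d2) fine P \<Longrightarrow> \<bar>RS_sum f g P - z\<bar> < e"
    unfolding has_RS_integral_iff_RS_sum by meson
  obtain P where P: "P tagged_division_of {a..b}" "(\<lambda>x. ball x (min d1 d2)) fine P"
    using fine_tagged_division_exists[of "min d1 d2"] d1(1) d2(1) by auto
  have "(\<lambda>x. ball x d1) fine P" "(\<lambda>x. ball x d2) fine P"
    using P(2) unfolding fine_def by fastforce+
  from d1(2)[OF P(1) this(1)] d2(2)[OF P(1) this(2)] show False unfolding e_def by (smt (verit) field_sum_of_halves)
qed

lemma RS_integral_eqI: "has_RS_integral f g a b y \<Longrightarrow> RS_integral f g a b = y"
  unfolding RS_integral_def using has_RS_integral_unique by blast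

lemma controls_mono:
  assumes "controls w g a b" "a \<le> s" "s \<le> t" "t \<le> b" shows "w s \<le> w t"
  using assms unfolding controls_def by (smt (verit) norm_ge_zero)

lemma fine_ball_mono: "(\<lambda>x. ball x d) fine P \<Longrightarrow> d \<le> d' \<Longrightarrow> (\<lambda>x. ball x d') fine P"
  unfolding fine_def by fastforce

text \<open>The factor 2 matches the distance of the tags of two intersecting intervals, each of them
  inside the ball of radius \<open>d\<close> around its tag.\<close>

lemma uniform_modulus:
  fixes f :: "real \<Rightarrow> real"
  assumes "continuous_on {a..b} f" "e > 0"
  obtains d where "d > 0" "\<And>x y. \<lbrakk>x \<in> {a..b}; y \<in> {a..b}; \<bar>x - y\<bar> < 2 * d\<rbrakk> \<Longrightarrow> \<bar>f x - f y\<bar> \<le> e"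
proof -
  have "uniformly_continuous_on {a..b} f" using compact_uniformly_continuous[OF assms(1)] by simp
  then obtain \<delta> where "\<delta> > 0" "\<And>x y. x \<in> {a..b} \<Longrightarrow> y \<in> {a..b} \<Longrightarrow> dist y x < \<delta> \<Longrightarrow> dist (f y) (f x) < e"
    using assms(2) unfolding uniformly_continuous_on_def by meson
  then show ?thesis using that[of "\<delta>/2"] unfolding dist_real_def by (auto intro: less_imp_le)
qed

lemma RS_sum_compare_same:
  fixes f g w :: "real \<Rightarrow> real"
  assumes ctrl: "controls w g a b" and at: "a \<le> b"
    and P: "P tagged_division_of {a..b}" "(\<lambda>x. ball x d) fine P"
    and P': "P' tagged_division_of {a..b}" "(\<lambda>x. ball x d) fine P'"
    and near: "\<And>x y. \<lbrakk>x \<in> {a..b}; y \<in> {a..b}; \<bar>x - y\<bar> < 2 * d\<rbrakk> \<Longrightarrow> \<bar>f x - f y\<bar> \<le> e"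
    and e: "0 \<le> e"
  shows "\<bar>RS_sum f g P - RS_sum f g P'\<bar> \<le> e * (w b - w a)"
proof -
  have "RS_sum f (\<lambda>s. g (min b s)) P' = RS_sum f g P'"
    by (rule RS_sum_cong[OF P'(1)]) auto
  moreover have "\<bar>RS_sum f g P - RS_sum f (\<lambda>s. g (min b s)) P'\<bar> \<le> e * (w b - w a)"
    by (rule RS_sum_compare[OF ctrl at order_refl P P' near e])
  ultimately show ?thesis by simp
qed

lemma controls_subinterval: "controls w g a b \<Longrightarrow> t \<le> b \<Longrightarrow> controls w g a t"
  unfolding controls_def by auto

text \<open>By \<open>RS_sum_compare\<close>, sums over fine divisions form a Cauchy family when the integrand is
  uniformly continuous. Two divisions of different fineness are compared through a third one that is
  fine for both.\<close>

lemma RS_integral_exists: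
  fixes f g w :: "real \<Rightarrow> real"
  assumes ctrl: "controls w g a b" and ab: "a \<le> b" and f: "continuous_on {a..b} f"
  shows "has_RS_integral f g a b (RS_integral f g a b)"
proof -
  define W where "W = w b - w a"
  have W: "W \<ge> 0" using controls_mono[OF ctrl order_refl ab] by (simp add: W_def)
  have "\<exists>d>0. \<forall>x y. x \<in> {a..b} \<longrightarrow> y \<in> {a..b} \<longrightarrow> \<bar>x - y\<bar> < 2 * d \<longrightarrow> \<bar>f x - f y\<bar> \<le> inverse (real (Suc k))" for k
    by (rule uniform_modulus[OF f, of "inverse (real (Suc k))"]) auto
  then obtain d where d: "\<And>k. d k > 0"
    "\<And>k x y. \<lbrakk>x \<in> {a..b}; y \<in> {a..b}; \<bar>x - y\<bar> < 2 * d k\<rbrakk> \<Longrightarrow> \<bar>f x - f y\<bar> \<le> inverse (real (Suc k))"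
    by metis
  have "\<exists>P. P tagged_division_of {a..b} \<and> (\<lambda>x. ball x (d k)) fine P" for k
    using fine_tagged_division_exists[OF d(1)] by metis
  then obtain P where P: "\<And>k. P k tagged_division_of {a..b}" "\<And>k. (\<lambda>x. ball x (d k)) fine P k"
    by metis
  define y where "y k = RS_sum f g (P k)" for k
  have close: "\<bar>RS_sum f g Q - y k\<bar> \<le> inverse (real (Suc k)) * W"
    if "Q tagged_division_of {a..b}" "(\<lambda>x. ball x (d k)) fine Q" for Q k
    unfolding y_def W_def using RS_sum_compare_same[OF ctrl ab that P(1,2) d(2)] by simp
  have dist: "\<bar>y j - y k\<bar> \<le> (inverse (real (Suc j)) + inverse (real (Suc k))) * W" for j k
  proof -
    obtain Q where Q: "Q tagged_division_of {a..b}" "(\<lambda>x. ball x (min (d j) (d k))) fine Q"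
      using fine_tagged_division_exists[of "min (d j) (d k)"] d(1) by (metis min_less_iff_conj)
    have "\<bar>RS_sum f g Q - y j\<bar> \<le> inverse (real (Suc j)) * W" "\<bar>RS_sum f g Q - y k\<bar> \<le> inverse (real (Suc k)) * W"
      by (intro close Q fine_ball_mono[OF Q(2)]; simp)+
    then show ?thesis unfolding distrib_right by linarith
  qed
  have small: "\<exists>N. \<forall>k\<ge>N. inverse (real (Suc k)) * W < e" if "e > 0" for e
  proof -
    have "(\<lambda>k. inverse (real (Suc k)) * W) \<longlonglongrightarrow> 0 * W"
      by (intro tendsto_mult LIMSEQ_inverse_real_of_nat tendsto_const)
    then have "\<forall>\<^sub>F k in sequentially. inverse (real (Suc k)) * W < e"
      using that by (intro order_tendstoD(2)) auto
    then show ?thesis by (simp add: eventually_sequentially)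
  qed
  have "Cauchy y"
  proof (rule CauchyI)
    fix e :: real assume e: "0 < e"
    from small[of "e/2"] e obtain N where N: "\<And>k. k \<ge> N \<Longrightarrow> inverse (real (Suc k)) * W < e/2" by auto
    have "norm (y m - y n) < e" if "m \<ge> N" "n \<ge> N" for m n
      using dist[of m n] N[OF that(1)] N[OF that(2)] unfolding distrib_right real_norm_def by linarith
    then show "\<exists>M. \<forall>m\<ge>M. \<forall>n\<ge>M. norm (y m - y n) < e" by blast
  qed
  then obtain z where z: "y \<longlonglongrightarrow> z" using Cauchy_convergent_iff convergent_def by blast
  have "has_RS_integral f g a b z"
    unfolding has_RS_integral_iff_RS_sum
  proof (intro allI impI)
    fix e :: real assume e: "0 < e"
    from small[of "e/2"] e obtain N where N: "\<And>k. k \<ge> N \<Longrightarrow> inverse (real (Suc k)) * W < e/2" by auto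
    from z obtain N' where N': "\<And>k. k \<ge> N' \<Longrightarrow> \<bar>y k - z\<bar> < e/2"
      using e unfolding LIMSEQ_def dist_real_def by (meson half_gt_zero)
    define k where "k = max N N'"
    show "\<exists>d>0. \<forall>P. P tagged_division_of {a..b} \<and> (\<lambda>x. ball x d) fine P \<longrightarrow> \<bar>RS_sum f g P - z\<bar> < e"
    proof (intro exI[of _ "d k"] conjI d(1) allI impI)
      fix Q assume "Q tagged_division_of {a..b} \<and> (\<lambda>x. ball x (d k)) fine Q"
      then have "\<bar>RS_sum f g Q - y k\<bar> \<le> inverse (real (Suc k)) * W" using close by blast
      then show "\<bar>RS_sum f g Q - z\<bar> < e" using N[of k] N'[of k] unfolding k_def by (smt (verit) field_sum_of_halves max.cobounded1 max.cobounded2)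
    qed
  qed
  then show ?thesis using RS_integral_eqI by metis
qed

lemma RS_integral_compare:
  fixes f f' g w :: "real \<Rightarrow> real"
  assumes ctrl: "controls w g a b" and at: "a \<le> t" "t \<le> b"
    and f: "continuous_on {a..b} f"
    and P': "P' tagged_division_of {a..b}" "(\<lambda>x. ball x d) fine P'" and d: "d > 0"
    and near: "\<And>x y. \<lbrakk>x \<in> {a..b}; y \<in> {a..b}; \<bar>x - y\<bar> < 2 * d\<rbrakk> \<Longrightarrow> \<bar>f x - f' y\<bar> \<le> e"
    and e: "0 \<le> e"
  shows "\<bar>RS_integral f g a t - RS_sum f' (\<lambda>s. g (min t s)) P'\<bar> \<le> e * (w b - w a)"
proof -
  have "has_RS_integral f g a t (RS_integral f g a t)"
    using RS_integral_exists[OF controls_subinterval[OF ctrl at(2)] at(1)]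
      continuous_on_subset[OF f, of "{a..t}"] at by auto
  have "\<bar>RS_integral f g a t - RS_sum f' (\<lambda>s. g (min t s)) P'\<bar> \<le> e * (w t - w a) + r" if "r > 0" for r
  proof -
    obtain d' where d': "d' > 0" "\<And>P. P tagged_division_of {a..t} \<Longrightarrow> (\<lambda>x. ball x d') fine P \<Longrightarrow>
        \<bar>RS_sum f g P - RS_integral f g a t\<bar> < r"
      using \<open>has_RS_integral f g a t _\<close> \<open>r > 0\<close> unfolding has_RS_integral_iff_RS_sum by meson
    obtain P where P: "P tagged_division_of {a..t}" "(\<lambda>x. ball x (min d d')) fine P"
      using fine_tagged_division_exists[of "min d d'"] d d'(1) by (metis min_less_iff_conj)
    have "\<bar>RS_sum f g P - RS_integral f g a t\<bar> < r"
      by (rule d'(2)[OF P(1) fine_ball_mono[OF P(2)]]) simp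
    moreover have "\<bar>RS_sum f g P - RS_sum f' (\<lambda>s. g (min t s)) P'\<bar> \<le> e * (w t - w a)"
      by (rule RS_sum_compare[OF ctrl at P(1) fine_ball_mono[OF P(2)] P' near e]) (use at in auto)
    ultimately show ?thesis by linarith
  qed
  then have "\<bar>RS_integral f g a t - RS_sum f' (\<lambda>s. g (min t s)) P'\<bar> \<le> e * (w t - w a)"
    by (rule field_le_epsilon)
  also have "\<dots> \<le> e * (w b - w a)"
    using controls_mono[OF ctrl at order_refl] e by (simp add: mult_left_mono)
  finally show ?thesis .
qed

text \<open>The integral is a uniform limit of the sums over a fixed division, which depend continuously on the
  end point because \<open>g\<close> does. This is what makes an iterated integral admissible as the next integrand.\<close>

lemma continuous_on_RS_integral:
  fixes f g w :: "real \<Rightarrow> real"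
  assumes ctrl: "controls w g a b" 
    and f: "continuous_on {a..b} f" and g: "continuous_on {a..b} g"
  shows "continuous_on {a..b} (\<lambda>t. RS_integral f g a t)"
proof (cases "a \<le> b")
  case False then show ?thesis by simp
next
  case ab: True
  define W where "W = w b - w a"
  have W: "W \<ge> 0" using controls_mono[OF ctrl order_refl ab] by (simp add: W_def)
  have "\<exists>P. P tagged_division_of {a..b} \<and>
      (\<forall>t\<in>{a..b}. \<bar>RS_integral f g a t - RS_sum f (\<lambda>s. g (min t s)) P\<bar> \<le> inverse (real (Suc k)) * W)" for k
  proof -
    obtain d where d: "d > 0" "\<And>x y. \<lbrakk>x \<in> {a..b}; y \<in> {a..b}; \<bar>x - y\<bar> < 2 * d\<rbrakk> \<Longrightarrow> \<bar>f x - f y\<bar> \<le> inverse (real (Suc k))"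
      using uniform_modulus[OF f, of "inverse (real (Suc k))"] by (metis inverse_positive_iff_positive of_nat_0_less_iff zero_less_Suc)
    obtain P where P: "P tagged_division_of {a..b}" "(\<lambda>x. ball x d) fine P"
      using fine_tagged_division_exists[OF d(1)] by metis
    have "\<bar>RS_integral f g a t - RS_sum f (\<lambda>s. g (min t s)) P\<bar> \<le> inverse (real (Suc k)) * W" if "t \<in> {a..b}" for t
      unfolding W_def by (rule RS_integral_compare[OF ctrl _ _ f P d]) (use that in auto)
    then show ?thesis using P by blast
  qed
  then obtain P where P: "\<And>k. P k tagged_division_of {a..b}"
    "\<And>k t. t \<in> {a..b} \<Longrightarrow> \<bar>RS_integral f g a t - RS_sum f (\<lambda>s. g (min t s)) (P k)\<bar> \<le> inverse (real (Suc k)) * W"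
    by metis
  show ?thesis
  proof (rule uniform_limit_theorem)
    show "\<forall>\<^sub>F k in sequentially. continuous_on {a..b} (\<lambda>t. RS_sum f (\<lambda>s. g (min t s)) (P k))"
    proof (intro always_eventually allI)
      fix k
      have "continuous_on {a..b} (\<lambda>t. g (min t s))" if "a \<le> s" "s \<le> b" for s
        by (rule continuous_on_compose2[OF g]) (use that in \<open>auto intro!: continuous_intros\<close>)
      moreover have "a \<le> Inf I" "Inf I \<le> b" "a \<le> Sup I" "Sup I \<le> b" if "(x, I) \<in> P k" for x I
        using tagged_division_real_interval(2-5)[OF P(1) that] by linarith+
      ultimately show "continuous_on {a..b} (\<lambda>t. RS_sum f (\<lambda>s. g (min t s)) (P k))"
        unfolding RS_sum_def by (intro continuous_on_sum) (auto intro!: continuous_intros)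
    qed
    show "uniform_limit {a..b} (\<lambda>k t. RS_sum f (\<lambda>s. g (min t s)) (P k)) (RS_integral f g a) sequentially"
    proof (rule uniform_limitI)
      fix e :: real assume "e > 0"
      have "(\<lambda>k. inverse (real (Suc k)) * W) \<longlonglongrightarrow> 0 * W"
        by (intro tendsto_mult LIMSEQ_inverse_real_of_nat tendsto_const)
      then have "\<forall>\<^sub>F k in sequentially. inverse (real (Suc k)) * W < e"
        using \<open>e > 0\<close> by (intro order_tendstoD(2)) auto
      then show "\<forall>\<^sub>F k in sequentially. \<forall>t\<in>{a..b}. dist (RS_sum f (\<lambda>s. g (min t s)) (P k)) (RS_integral f g a t) < e"
        
      proof eventually_elim
        case (elim k)
        then show ?case using P(2)[of _ k] unfolding dist_real_def by (smt (verit))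
      qed
    qed
  qed simp
qed

text \<open>Helly's convergence theorem, uniformly in the end point. Integrals against \<open>g i\<close> and against \<open>k\<close> are
  replaced by sums over one fixed division with the integrand \<open>h\<close>, at a cost proportional to
  the bound \<open>C\<close> on the variations; for the fixed division, uniform convergence of the integrators is enough.\<close>

lemma uniform_limit_RS_integral:
  fixes f f' :: "'i \<Rightarrow> real \<Rightarrow> real" and h k w :: "real \<Rightarrow> real"
  assumes f: "uniform_limit {a..b} f h F" and g: "uniform_limit {a..b} g k F"
    and h: "continuous_on {a..b} h" and fc: "\<forall>\<^sub>F i in F. continuous_on {a..b} (f i)"
    and ctrl: "controls w k a b"
    and unif: "\<forall>\<^sub>F i in F. \<exists>v. controls v (g i) a b \<and> v b - v a \<le> C"
  shows "uniform_limit {a..b} (\<lambda>i t. RS_integral (f i) (g i) a t) (\<lambda>t. RS_integral h k a t) F"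
proof (rule uniform_limitI)
  fix e :: real assume e: "e > 0"
  show "\<forall>\<^sub>F i in F. \<forall>t\<in>{a..b}. dist (RS_integral (f i) (g i) a t) (RS_integral h k a t) < e"
  proof (cases "a \<le> b")
    case False then show ?thesis by simp
  next
    case ab: True
    define W where "W = max 0 (max C (w b - w a)) + 1"
    have W: "W > 0" "C \<le> W" "w b - w a \<le> W" unfolding W_def by auto
    define r where "r = e / (4 * W)"
    have r: "r > 0" using e W by (simp add: r_def)
    have rW: "r * W = e / 4" using W by (simp add: r_def)
    obtain d where d: "d > 0" "\<And>x y. \<lbrakk>x \<in> {a..b}; y \<in> {a..b}; \<bar>x - y\<bar> < 2 * d\<rbrakk> \<Longrightarrow> \<bar>h x - h y\<bar> \<le> r"
      using uniform_modulus[OF h r] by metis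
    obtain P where P: "P tagged_division_of {a..b}" "(\<lambda>x. ball x d) fine P"
      using fine_tagged_division_exists[OF d(1)] by metis
    define M where "M = (\<Sum>(x, I)\<in>P. \<bar>h x\<bar>)"
    have M: "M \<ge> 0" unfolding M_def by (intro sum_nonneg) auto
    \<comment> \<open>allowed error of the integrator, so that the sum over the fixed division moves by less than \<open>e / 4\<close>\<close>
    define q where "q = e / (8 * (M + 1))"
    have q: "q > 0" using e M by (simp add: q_def)
    have qM: "M * (2 * q) < e / 4"
    proof -
      have "M * (2 * q) = (e / 4) * (M / (M + 1))" using M by (simp add: q_def field_simps)
      also have "\<dots> < (e / 4) * 1" using e M by (intro mult_strict_left_mono) auto
      finally show ?thesis by simp
    qed
    show ?thesis
      using uniform_limitD[OF f r] uniform_limitD[OF g q] fc unif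
    proof eventually_elim
      case (elim i)
      show ?case
      proof
        fix t assume t: "t \<in> {a..b}"
        from elim(4) obtain v where v: "controls v (g i) a b" "v b - v a \<le> C" by blast
        have "\<bar>RS_integral (f i) (g i) a t - RS_sum h (\<lambda>s. g i (min t s)) P\<bar> \<le> (2 * r) * (v b - v a)"
        proof (rule RS_integral_compare[OF v(1) _ _ elim(3) P d(1)])
          fix x y assume xy: "x \<in> {a..b}" "y \<in> {a..b}" "\<bar>x - y\<bar> < 2 * d"
          show "\<bar>f i x - h y\<bar> \<le> 2 * r"
            using d(2)[OF xy] elim(1) xy(1) unfolding dist_real_def by (smt (verit))
        qed (use t r in auto)
        also have "\<dots> \<le> (2 * r) * W" using v(2) W r by (intro mult_left_mono) auto
        finally have 1: "\<bar>RS_integral (f i) (g i) a t - RS_sum h (\<lambda>s. g i (min t s)) P\<bar> \<le> e / 2"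
          using rW by simp
        have "\<bar>RS_integral h k a t - RS_sum h (\<lambda>s. k (min t s)) P\<bar> \<le> r * (w b - w a)"
          by (rule RS_integral_compare[OF ctrl _ _ h P d(1) d(2)]) (use t r in auto)
        also have "\<dots> \<le> r * W" using W r by (intro mult_left_mono) auto
        finally have 2: "\<bar>RS_integral h k a t - RS_sum h (\<lambda>s. k (min t s)) P\<bar> \<le> e / 4"
          using rW by simp
        have "\<bar>RS_sum h (\<lambda>s. g i (min t s)) P - RS_sum h (\<lambda>s. k (min t s)) P\<bar>
            = \<bar>\<Sum>(x, I)\<in>P. h x * ((g i (min t (Sup I)) - k (min t (Sup I))) - (g i (min t (Inf I)) - k (min t (Inf I))))\<bar>"
          unfolding RS_sum_def sum_subtractf[symmetric] case_prod_unfold by (simp add: algebra_simps)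
        also have "\<dots> \<le> (\<Sum>(x, I)\<in>P. \<bar>h x\<bar> * (2 * q))"
          unfolding case_prod_unfold
        proof (rule order_trans[OF sum_abs], rule sum_mono)
          fix p assume p: "p \<in> P"
          then have "(fst p, snd p) \<in> P" by simp
          note I = tagged_division_real_interval[OF P(1) this]
          have "min t (Sup (snd p)) \<in> {a..b}" "min t (Inf (snd p)) \<in> {a..b}" using I(2-5) t by auto
          then have "\<bar>g i (min t (Sup (snd p))) - k (min t (Sup (snd p)))\<bar> < q"
            "\<bar>g i (min t (Inf (snd p))) - k (min t (Inf (snd p)))\<bar> < q"
            using elim(2) unfolding dist_real_def by blast+
          then show "\<bar>h (fst p) * ((g i (min t (Sup (snd p))) - k (min t (Sup (snd p))))
              - (g i (min t (Inf (snd p))) - k (min t (Inf (snd p)))))\<bar> \<le> \<bar>h (fst p)\<bar> * (2 * q)"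
            unfolding abs_mult by (intro mult_left_mono) linarith+
        qed
        also have "\<dots> = M * (2 * q)" unfolding M_def by (simp add: sum_distrib_right case_prod_unfold)
        finally have 3: "\<bar>RS_sum h (\<lambda>s. g i (min t s)) P - RS_sum h (\<lambda>s. k (min t s)) P\<bar> < e / 4"
          using qM by simp
        show "dist (RS_integral (f i) (g i) a t) (RS_integral h k a t) < e"
          using 1 2 3 unfolding dist_real_def by linarith
      qed
    qed
  qed
qed

lemma tagged_division_scale:
  fixes m :: real
  assumes P: "P tagged_division_of {a..b}" and m: "m > 0"
  shows "(\<lambda>(x, I). (m * x, (*) m ` I)) ` P tagged_division_of {m * a..m * b}"
proof (rule tagged_division_ofI)
  have img: "(*) m ` {u..v} = {m * u..m * v}" for u v using m by (simp add: image_mult_atLeastAtMost)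
  show "finite ((\<lambda>(x, I). (m * x, (*) m ` I)) ` P)" using P by auto
  fix y K assume "(y, K) \<in> (\<lambda>(x, I). (m * x, (*) m ` I)) ` P"
  then obtain x I where xI: "(x, I) \<in> P" "y = m * x" "K = (*) m ` I" by auto
  note D = tagged_division_ofD[OF P]
  show "y \<in> K" using D(2)[OF xI(1)] xI by auto
  show "K \<subseteq> {m * a..m * b}" using D(3)[OF xI(1)] xI m by auto
  show "\<exists>u v. K = cbox u v" using tagged_division_real_interval(1)[OF P xI(1)] img xI(3) by (metis box_real(2))
next
  fix y1 K1 y2 K2
  assume 1: "(y1, K1) \<in> (\<lambda>(x, I). (m * x, (*) m ` I)) ` P" and 2: "(y2, K2) \<in> (\<lambda>(x, I). (m * x, (*) m ` I)) ` P"
    and ne: "(y1, K1) \<noteq> (y2, K2)"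
  from 1 2 obtain x1 I1 x2 I2 where I: "(x1, I1) \<in> P" "y1 = m * x1" "K1 = (*) m ` I1"
     "(x2, I2) \<in> P" "y2 = m * x2" "K2 = (*) m ` I2" by auto
  have int: "interior ((*) m ` I) = (*) m ` interior I" for I
    using interior_injective_linear_image[of "(*) m" I] m
    by (simp add: linear_times inj_on_def)
  from I ne have "(x1, I1) \<noteq> (x2, I2)" by auto
  then have "interior I1 \<inter> interior I2 = {}" using tagged_division_ofD(5)[OF P] I by blast
  then show "interior K1 \<inter> interior K2 = {}" unfolding I int using m by auto
next
  have "\<Union>{K. \<exists>x. (x, K) \<in> (\<lambda>(x, I). (m * x, (*) m ` I)) ` P} = (*) m ` \<Union>{K. \<exists>x. (x, K) \<in> P}" by (auto; force)
  also have "\<dots> = (*) m ` {a..b}" using tagged_division_ofD(6)[OF P] by simp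
  finally show "\<Union>{K. \<exists>x. (x, K) \<in> (\<lambda>(x, I). (m * x, (*) m ` I)) ` P} = {m * a..m * b}"
    using m by (simp add: image_mult_atLeastAtMost)
qed

lemma has_RS_integral_scale:
  fixes f g :: "real \<Rightarrow> real"
  assumes I: "has_RS_integral f g (m * a) (m * b) y" and m: "m > 0"
  shows "has_RS_integral (\<lambda>x. \<alpha> * f (m * x)) (\<lambda>x. \<beta> * g (m * x) + k) a b (\<alpha> * \<beta> * y)"
  unfolding has_RS_integral_iff_RS_sum
proof (intro allI impI)
  fix e :: real assume e: "e > 0"
  define r where "r = e / (\<bar>\<alpha> * \<beta>\<bar> + 1)"
  have r: "r > 0" using e by (simp add: r_def add_nonneg_pos)
  from I r obtain d where d: "d > 0" "\<And>P. P tagged_division_of {m * a..m * b} \<Longrightarrow> (\<lambda>x. ball x d) fine P \<Longrightarrow>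
      \<bar>RS_sum f g P - y\<bar> < r"
    unfolding has_RS_integral_iff_RS_sum by meson
  show "\<exists>d>0. \<forall>P. P tagged_division_of {a..b} \<and> (\<lambda>x. ball x d) fine P \<longrightarrow>
      \<bar>RS_sum (\<lambda>x. \<alpha> * f (m * x)) (\<lambda>x. \<beta> * g (m * x) + k) P - \<alpha> * \<beta> * y\<bar> < e"
  proof (intro exI[of _ "d / m"] conjI allI impI)
    show "d / m > 0" using d m by simp
    fix P assume P: "P tagged_division_of {a..b} \<and> (\<lambda>x. ball x (d / m)) fine P"
    define Q where "Q = (\<lambda>(x, I). (m * x, (*) m ` I)) ` P"
    have Q: "Q tagged_division_of {m * a..m * b}" unfolding Q_def using tagged_division_scale P m by blast
    have "(\<lambda>x. ball x d) fine Q"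
    proof (rule fineI)
      fix y K assume "(y, K) \<in> Q"
      then obtain x I where xI: "(x, I) \<in> P" "y = m * x" "K = (*) m ` I" unfolding Q_def by auto
      have "\<bar>m * x - m * z\<bar> < d" if "z \<in> I" for z
      proof -
        have "\<bar>x - z\<bar> < d / m" using P xI(1) that by (auto dest!: fineD simp: subset_eq dist_real_def)
        then have "m * \<bar>x - z\<bar> < d" using m by (simp add: field_simps)
        then show ?thesis using m by (simp add: abs_mult flip: right_diff_distrib)
      qed
      then show "K \<subseteq> ball y d" using xI by (auto simp: dist_real_def)
    qed
    then have "\<bar>RS_sum f g Q - y\<bar> < r" by (rule d(2)[OF Q])
    moreover have "RS_sum (\<lambda>x. \<alpha> * f (m * x)) (\<lambda>x. \<beta> * g (m * x) + k) P = \<alpha> * \<beta> * RS_sum f g Q"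
    proof -
      have inj: "inj_on (\<lambda>(x, I). (m * x, (*) m ` I)) P"
      proof -
        have "inj ((*) m)" using m by (simp add: inj_def)
        then show ?thesis using m by (auto simp: inj_on_def inj_image_eq_iff)
      qed
      have "RS_sum f g Q = (\<Sum>(x, I)\<in>P. f (m * x) * (g (Sup ((*) m ` I)) - g (Inf ((*) m ` I))))"
        unfolding RS_sum_def Q_def by (subst sum.reindex[OF inj]) (simp add: case_prod_unfold comp_def)
      also have "\<dots> = (\<Sum>(x, I)\<in>P. f (m * x) * (g (m * Sup I) - g (m * Inf I)))"
      proof (intro sum.cong refl, clarify)
        fix x I assume "(x, I) \<in> P"
        then have "I = {Inf I..Sup I}" and le: "Inf I \<le> Sup I"
          using tagged_division_real_interval[of P a b x I] P by auto
        then have "(*) m ` I = {m * Inf I..m * Sup I}" using m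
          by (metis image_mult_atLeastAtMost)
        then have "Sup ((*) m ` I) = m * Sup I" "Inf ((*) m ` I) = m * Inf I"
          using m le by (simp_all add: mult_left_mono)
        then show "f (m * x) * (g (Sup ((*) m ` I)) - g (Inf ((*) m ` I))) = f (m * x) * (g (m * Sup I) - g (m * Inf I))"
          by simp
      qed
      finally show ?thesis unfolding RS_sum_def
        by (simp add: sum_distrib_left case_prod_unfold algebra_simps)
    qed
    ultimately have "\<bar>RS_sum (\<lambda>x. \<alpha> * f (m * x)) (\<lambda>x. \<beta> * g (m * x) + k) P - \<alpha> * \<beta> * y\<bar> \<le> \<bar>\<alpha> * \<beta>\<bar> * r"
      by (simp add: abs_mult mult_left_mono flip: right_diff_distrib)
    also have "\<dots> < e" using e unfolding r_def by (simp add: field_simps add_nonneg_pos)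
    finally show "\<bar>RS_sum (\<lambda>x. \<alpha> * f (m * x)) (\<lambda>x. \<beta> * g (m * x) + k) P - \<alpha> * \<beta> * y\<bar> < e" .
  qed
qed

text \<open>Adding the interval \<open>[s, t]\<close> to a division of \<open>[a, s]\<close> shows that the variation on \<open>[a, t]\<close> exceeds
  the variation on \<open>[a, s]\<close> by at least the increment.\<close>

lemma bounded_variation_controls:
  fixes g :: "real \<Rightarrow> 'a::real_normed_vector"
  assumes "bounded_variation g a b"
  shows "controls (\<lambda>t. enn2real (variation g a t)) g a b"
  unfolding controls_def
proof (intro allI impI, elim conjE)
  have step: "variation g a s + ennreal (norm (g t - g s)) \<le> variation g a t" if st: "a \<le> s" "s \<le> t" for s t
  proof (cases "s = t")
    case True then show ?thesis by simp
  next
    case False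
    then have "s < t" using st by simp
    have ne: "{D. D division_of {a..s}} \<noteq> {}"
      using elementary_interval[of a s] by auto
    have "ennreal (\<Sum>I\<in>D. norm (g (Sup I) - g (Inf I))) + ennreal (norm (g t - g s)) \<le> variation g a t"
      if D: "D division_of {a..s}" for D
    proof -
      have fin: "finite D" using D by auto
      have ni: "{s..t} \<notin> D" using D \<open>s < t\<close> by (auto dest: division_ofD(2))
      have "insert {s..t} D division_of ({s..t} \<union> {a..s})"
      proof (rule division_ofI)
        show "finite (insert {s..t} D)" using fin by simp
        fix K assume K: "K \<in> insert {s..t} D"
        show "K \<subseteq> {s..t} \<union> {a..s}" using K D by (auto dest: division_ofD(2))
        show "K \<noteq> {}" using K D st by (auto dest: division_ofD(3))
        show "\<exists>u v. K = cbox u v" using K division_ofD(4)[OF D] by (metis box_real(2) insertE)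
      next
        have disj: "interior {s..t} \<inter> interior K = {}" if "K \<in> D" for K
        proof -
          have "interior K \<subseteq> interior {a..s}" using division_ofD(2)[OF D that] by (rule interior_mono)
          then show ?thesis by auto
        qed
        fix K1 K2 assume "K1 \<in> insert {s..t} D" "K2 \<in> insert {s..t} D" "K1 \<noteq> K2"
        then show "interior K1 \<inter> interior K2 = {}"
          using disj division_ofD(5)[OF D] by (metis inf_commute insertE)
      next
        show "\<Union>(insert {s..t} D) = {s..t} \<union> {a..s}" using division_ofD(6)[OF D] by simp
      qed
      moreover have "{s..t} \<union> {a..s} = {a..t}" using st by auto
      ultimately have "ennreal (\<Sum>I\<in>insert {s..t} D. norm (g (Sup I) - g (Inf I))) \<le> variation g a t"
        unfolding variation_def by (intro SUP_upper) auto
      then show ?thesis using fin ni st by (simp add: sum_nonneg add.commute flip: ennreal_plus)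
    qed
    then show ?thesis
      unfolding variation_def[of g a s] by (subst ennreal_SUP_add_left[symmetric, OF ne]) (auto intro!: SUP_least)
  qed
  fix s t assume st: "a \<le> s" "s \<le> t" "t \<le> b"
  have mono: "variation g a r \<le> variation g a b" if "a \<le> r" "r \<le> b" for r
    using step[OF that] by (rule order_trans[rotated]) (simp add: add_increasing2)
  have fin: "variation g a t < \<infinity>" "variation g a s < \<infinity>"
    using mono[of t] mono[of s] st assms unfolding bounded_variation_def by (auto intro: le_less_trans)
  have "variation g a s + ennreal (norm (g t - g s)) \<le> variation g a t" by (rule step) (use st in auto)
  then have "enn2real (variation g a s + ennreal (norm (g t - g s))) \<le> enn2real (variation g a t)"
    using fin by (intro enn2real_mono) auto
  moreover have "enn2real (variation g a s + ennreal (norm (g t - g s))) = enn2real (variation g a s) + norm (g t - g s)"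
    using fin by (simp add: enn2real_plus)
  ultimately show "norm (g t - g s) \<le> enn2real (variation g a t) - enn2real (variation g a s)" by simp
qed

section \<open>Absolute continuity\<close>

lemma division_real_interval:
  fixes I :: "real set"
  assumes "D division_of \<Union>D" "\<Union>D \<subseteq> {a..b}" "I \<in> D"
  shows "I = {Inf I..Sup I}" "Inf I \<le> Sup I" "a \<le> Inf I" "Sup I \<le> b"
proof -
  from division_ofD(2-4)[OF assms(1,3)] obtain u v where uv: "I \<noteq> {}" "I = cbox u v" by blast
  then have "u \<le> v" by auto
  with uv have e: "Inf I = u" "Sup I = v" by auto
  with uv show "I = {Inf I..Sup I}" "Inf I \<le> Sup I" by auto
  have "I \<subseteq> {a..b}" using assms by blast
  then show "a \<le> Inf I" "Sup I \<le> b" using uv e \<open>u \<le> v\<close> by auto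
qed

lemma abs_continuous_lipschitz_compose:
  assumes f: "abs_continuous f a b" and F: "L-lipschitz_on (f ` {a..b}) F"
  shows "abs_continuous (F \<circ> f) a b"
  unfolding abs_continuous_def
proof (intro allI impI)
  fix e :: real assume e: "e > 0"
  have L: "L \<ge> 0" using F lipschitz_on_nonneg by blast
  have "e / (L + 1) > 0" using e L by simp
  from f this obtain d where d: "d > 0"
    "\<And>D. D division_of \<Union>D \<Longrightarrow> \<Union>D \<subseteq> {a..b} \<Longrightarrow> (\<Sum>I\<in>D. Sup I - Inf I) < d \<Longrightarrow>
        (\<Sum>I\<in>D. norm (f (Sup I) - f (Inf I))) < e / (L + 1)" unfolding abs_continuous_def by meson
  show "\<exists>d>0. \<forall>D. D division_of \<Union> D \<and> \<Union> D \<subseteq> {a..b} \<and> (\<Sum>I\<in>D. Sup I - Inf I) < d \<longrightarrow>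
      (\<Sum>I\<in>D. norm ((F \<circ> f) (Sup I) - (F \<circ> f) (Inf I))) < e"
  proof (intro exI[of _ d] conjI d(1) allI impI, elim conjE)
    fix D assume D: "D division_of \<Union> D" "\<Union> D \<subseteq> {a..b}" "(\<Sum>I\<in>D. Sup I - Inf I) < d"
    have "(\<Sum>I\<in>D. norm ((F \<circ> f) (Sup I) - (F \<circ> f) (Inf I))) \<le> (\<Sum>I\<in>D. L * norm (f (Sup I) - f (Inf I)))"
    proof (rule sum_mono)
      fix I assume "I \<in> D"
      note I = division_real_interval[OF D(1,2) this]
      have "Sup I \<in> {a..b}" "Inf I \<in> {a..b}" using I by auto
      then show "norm ((F \<circ> f) (Sup I) - (F \<circ> f) (Inf I)) \<le> L * norm (f (Sup I) - f (Inf I))"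
        using lipschitz_onD[OF F] by (simp add: dist_norm)
    qed
    also have "\<dots> = L * (\<Sum>I\<in>D. norm (f (Sup I) - f (Inf I)))" by (simp add: sum_distrib_left)
    also have "\<dots> \<le> L * (e / (L + 1))" using d(2)[OF D] L by (intro mult_left_mono) auto
    also have "\<dots> < e" using e L by (simp add: field_simps)
    finally show "(\<Sum>I\<in>D. norm ((F \<circ> f) (Sup I) - (F \<circ> f) (Inf I))) < e" .
  qed
qed

text \<open>A monotone map carries nonoverlapping intervals to nonoverlapping intervals, and the Lipschitz
  constant bounds their total length. Intervals that become equal under \<open>h\<close> are degenerate, so
  passing to the set of images does not lose any increment.\<close>

lemma abs_continuous_compose_mono_lipschitz:
  fixes h :: "real \<Rightarrow> real"
  assumes f: "abs_continuous f a' b'" and mono: "mono_on {a..b} h" and lip: "L-lipschitz_on {a..b} h"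
    and range: "h ` {a..b} \<subseteq> {a'..b'}"
  shows "abs_continuous (f \<circ> h) a b"
  unfolding abs_continuous_def
proof (intro allI impI)
  fix e :: real assume e: "e > 0"
  have L: "L \<ge> 0" using lip lipschitz_on_nonneg by blast
  from f e obtain d where d: "d > 0"
    "\<And>D. D division_of \<Union>D \<Longrightarrow> \<Union>D \<subseteq> {a'..b'} \<Longrightarrow> (\<Sum>I\<in>D. Sup I - Inf I) < d \<Longrightarrow>
        (\<Sum>I\<in>D. norm (f (Sup I) - f (Inf I))) < e" unfolding abs_continuous_def by meson
  show "\<exists>d>0. \<forall>D. D division_of \<Union> D \<and> \<Union> D \<subseteq> {a..b} \<and> (\<Sum>I\<in>D. Sup I - Inf I) < d \<longrightarrow>
      (\<Sum>I\<in>D. norm ((f \<circ> h) (Sup I) - (f \<circ> h) (Inf I))) < e"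
  proof (intro exI[of _ "d / (L + 1)"] conjI allI impI, goal_cases)
    case 1 show ?case using d(1) L by simp
  next
    case (2 D)
    then have D: "D division_of \<Union> D" "\<Union> D \<subseteq> {a..b}" "(\<Sum>I\<in>D. Sup I - Inf I) < d / (L + 1)" by auto
    have fin: "finite D" using D(1) by auto
    define J where "J I = {h (Inf I)..h (Sup I)}" for I
    have hle: "h (Inf I) \<le> h (Sup I)" if "I \<in> D" for I
      using division_real_interval[OF D(1,2) that] by (intro mono_onD[OF mono]) auto
    then have J: "Inf (J I) = h (Inf I)" "Sup (J I) = h (Sup I)" if "I \<in> D" for I
      using that by (simp_all add: J_def)
    have disj: "interior (J I) \<inter> interior (J K) = {}" if "I \<in> D" "K \<in> D" "I \<noteq> K" for I K
    proof -
      note I = division_real_interval[OF D(1,2) that(1)] and K = division_real_interval[OF D(1,2) that(2)]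
      have "interior {Inf I..Sup I} \<inter> interior {Inf K..Sup K} = {}"
        using division_ofD(5)[OF D(1) that] I(1) K(1) by metis
      then have "{max (Inf I) (Inf K)<..<min (Sup I) (Sup K)} = {}" by simp
      then have "Sup I \<le> Inf K \<or> Sup K \<le> Inf I \<or> Sup I = Inf I \<or> Sup K = Inf K"
        using I(2) K(2) by (auto simp: max_def min_def split: if_splits)
      moreover have "h (Sup I) \<le> h (Inf K)" if "Sup I \<le> Inf K"
        using that I K by (intro mono_onD[OF mono]) auto
      moreover have "h (Sup K) \<le> h (Inf I)" if "Sup K \<le> Inf I"
        using that I K by (intro mono_onD[OF mono]) auto
      ultimately show ?thesis unfolding J_def by auto
    qed
    have degenerate: "h (Inf I) = h (Sup I)" if "I \<in> D" "K \<in> D" "I \<noteq> K" "J I = J K" for I K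
    proof -
      have "interior (J I) = {}" using disj[OF that(1-3)] that(4) by simp
      then show ?thesis using hle[OF that(1)] by (simp add: J_def)
    qed
    have sum_J: "(\<Sum>K\<in>J ` D. F (Inf K) (Sup K)) = (\<Sum>I\<in>D. F (h (Inf I)) (h (Sup I)))"
      if "\<And>x. F x x = 0" for F :: "real \<Rightarrow> real \<Rightarrow> real"
    proof -
      have "(\<Sum>K\<in>J ` D. F (Inf K) (Sup K)) = (\<Sum>I\<in>D. F (Inf (J I)) (Sup (J I)))"
      proof (rule sum.reindex_nontrivial[OF fin, of J "\<lambda>K. F (Inf K) (Sup K)", unfolded comp_def])
        fix I K assume "I \<in> D" "K \<in> D" "I \<noteq> K" "J I = J K"
        then show "F (Inf (J I)) (Sup (J I)) = 0" using degenerate[of I K] J[of I] that by simp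
      qed
      then show ?thesis using J by simp
    qed
    have div: "J ` D division_of \<Union>(J ` D)"
    proof (rule division_ofI)
      show "finite (J ` D)" using fin by simp
      fix K assume "K \<in> J ` D"
      then show "K \<subseteq> \<Union>(J ` D)" "K \<noteq> {}" "\<exists>a b. K = cbox a b" using hle by (auto simp: J_def)
    next
      fix K1 K2 assume "K1 \<in> J ` D" "K2 \<in> J ` D" "K1 \<noteq> K2"
      then show "interior K1 \<inter> interior K2 = {}" using disj by auto
    qed simp
    have "J I \<subseteq> {a'..b'}" if "I \<in> D" for I
    proof -
      have "h (Inf I) \<in> {a'..b'}" "h (Sup I) \<in> {a'..b'}"
        using division_real_interval(2-)[OF D(1,2) that] by (intro subsetD[OF range] imageI; simp)+
      then show ?thesis by (auto simp: J_def)
    qed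
    then have sub: "\<Union>(J ` D) \<subseteq> {a'..b'}" by blast
    have "(\<Sum>K\<in>J ` D. Sup K - Inf K) = (\<Sum>I\<in>D. h (Sup I) - h (Inf I))"
      using sum_J[of "\<lambda>x y. y - x"] by simp
    also have "\<dots> \<le> (\<Sum>I\<in>D. L * (Sup I - Inf I))"
    proof (rule sum_mono)
      fix I assume "I \<in> D"
      note I = division_real_interval[OF D(1,2) this]
      then have "dist (h (Sup I)) (h (Inf I)) \<le> L * dist (Sup I) (Inf I)"
        by (intro lipschitz_onD[OF lip]) auto
      then show "h (Sup I) - h (Inf I) \<le> L * (Sup I - Inf I)" using I(2) by (simp add: dist_real_def)
    qed
    also have "\<dots> = L * (\<Sum>I\<in>D. Sup I - Inf I)" by (simp add: sum_distrib_left)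
    also have "\<dots> \<le> L * (d / (L + 1))" using D(3) L by (intro mult_left_mono) auto
    also have "\<dots> < d" using d(1) L by (simp add: field_simps)
    finally have "(\<Sum>K\<in>J ` D. norm (f (Sup K) - f (Inf K))) < e" by (rule d(2)[OF div sub])
    then show ?case using sum_J[of "\<lambda>x y. norm (f y - f x)"] by simp
  qed
qed

lemma abs_continuous_cong:
  assumes "\<And>t. t \<in> {a..b} \<Longrightarrow> f t = g t"
  shows "abs_continuous f a b \<longleftrightarrow> abs_continuous g a b"
proof -
  have "(\<Sum>I\<in>D. norm (f (Sup I) - f (Inf I))) = (\<Sum>I\<in>D. norm (g (Sup I) - g (Inf I)))"
    if "D division_of \<Union>D" "\<Union>D \<subseteq> {a..b}" for D
  proof (rule sum.cong[OF refl])
    fix I assume "I \<in> D"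
    note division_real_interval[OF that this]
    then show "norm (f (Sup I) - f (Inf I)) = norm (g (Sup I) - g (Inf I))" using assms by auto
  qed
  then show ?thesis unfolding abs_continuous_def by (metis (no_types, lifting))
qed

lemma abs_continuous_add:
  assumes f: "abs_continuous f a b" and g: "abs_continuous g a b"
  shows "abs_continuous (\<lambda>t. f t + g t) a b"
  unfolding abs_continuous_def
proof (intro allI impI)
  fix e :: real assume e: "e > 0"
  then have "e / 2 > 0" by simp
  from f this obtain d1 where d1: "d1 > 0"
    "\<And>D. D division_of \<Union>D \<Longrightarrow> \<Union>D \<subseteq> {a..b} \<Longrightarrow> (\<Sum>I\<in>D. Sup I - Inf I) < d1 \<Longrightarrow>
        (\<Sum>I\<in>D. norm (f (Sup I) - f (Inf I))) < e / 2" unfolding abs_continuous_def by meson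
  from g \<open>e / 2 > 0\<close> obtain d2 where d2: "d2 > 0"
    "\<And>D. D division_of \<Union>D \<Longrightarrow> \<Union>D \<subseteq> {a..b} \<Longrightarrow> (\<Sum>I\<in>D. Sup I - Inf I) < d2 \<Longrightarrow>
        (\<Sum>I\<in>D. norm (g (Sup I) - g (Inf I))) < e / 2" unfolding abs_continuous_def by meson
  show "\<exists>d>0. \<forall>D. D division_of \<Union> D \<and> \<Union> D \<subseteq> {a..b} \<and> (\<Sum>I\<in>D. Sup I - Inf I) < d \<longrightarrow>
      (\<Sum>I\<in>D. norm (f (Sup I) + g (Sup I) - (f (Inf I) + g (Inf I)))) < e"
  proof (intro exI[of _ "min d1 d2"] conjI allI impI, goal_cases)
    case 1 show ?case using d1(1) d2(1) by simp
  next
    case (2 D)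
    have "(\<Sum>I\<in>D. norm (f (Sup I) + g (Sup I) - (f (Inf I) + g (Inf I))))
        \<le> (\<Sum>I\<in>D. norm (f (Sup I) - f (Inf I)) + norm (g (Sup I) - g (Inf I)))"
      by (intro sum_mono) (metis add_diff_add norm_triangle_ineq)
    also have "\<dots> < e" using d1(2)[of D] d2(2)[of D] 2 by (simp add: sum.distrib)
    finally show ?case .
  qed
qed

lemma abs_continuous_const_shift:
  "abs_continuous f a b \<Longrightarrow> abs_continuous (\<lambda>t. f t - k) a b"
  unfolding abs_continuous_def by simp

text \<open>Both functions \<open>t \<mapsto> f (min m t)\<close> and \<open>t \<mapsto> f (max m t)\<close> are absolutely continuous on \<open>[a, b]\<close>, as
  compositions with monotone maps of Lipschitz constant 1, and their sum is \<open>f + f m\<close>.\<close>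

lemma abs_continuous_combine:
  assumes 1: "abs_continuous f a m" and 2: "abs_continuous f m b" and m: "a \<le> m" "m \<le> b"
  shows "abs_continuous f a b"
proof -
  have "1-lipschitz_on {a..b} (min m)" by (rule lipschitz_onI) (auto simp: dist_real_def)
  then have "abs_continuous (f \<circ> min m) a b"
    using m by (intro abs_continuous_compose_mono_lipschitz[OF 1]) (auto intro!: mono_onI)
  moreover have "1-lipschitz_on {a..b} (max m)" by (rule lipschitz_onI) (auto simp: dist_real_def)
  then have "abs_continuous (f \<circ> max m) a b"
    using m by (intro abs_continuous_compose_mono_lipschitz[OF 2]) (auto intro!: mono_onI)
  ultimately have "abs_continuous (\<lambda>t. ((f \<circ> min m) t + (f \<circ> max m) t) - f m) a b"
    by (intro abs_continuous_const_shift abs_continuous_add)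
  moreover have "((f \<circ> min m) t + (f \<circ> max m) t) - f m = f t" for t by (simp add: min_def max_def)
  ultimately show ?thesis by simp
qed

lemma abs_continuous_affine:
  assumes "abs_continuous f (m * a + k) (m * b + k)" and m: "m > 0"
  shows "abs_continuous (\<lambda>t. f (m * t + k)) a b"
proof -
  have "m-lipschitz_on {a..b} (\<lambda>t. m * t + k)"
    using m by (intro lipschitz_onI) (auto simp: dist_real_def abs_mult simp flip: right_diff_distrib)
  then have "abs_continuous (f \<circ> (\<lambda>t. m * t + k)) a b"
    using m by (intro abs_continuous_compose_mono_lipschitz[OF assms(1)]) (auto intro!: mono_onI)
  then show ?thesis by (simp add: comp_def)
qed

lemma abs_continuous_imp_continuous_on:
  assumes "abs_continuous f a b"
  shows "continuous_on {a..b} f"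
proof (rule continuous_onI)
  fix x e :: real assume x: "x \<in> {a..b}" and e: "e > 0"
  from assms e obtain d where d: "d > 0"
    "\<And>D. D division_of \<Union>D \<Longrightarrow> \<Union>D \<subseteq> {a..b} \<Longrightarrow> (\<Sum>I\<in>D. Sup I - Inf I) < d \<Longrightarrow>
        (\<Sum>I\<in>D. norm (f (Sup I) - f (Inf I))) < e" unfolding abs_continuous_def by meson
  have "norm (f v - f u) < e" if "u \<le> v" "a \<le> u" "v \<le> b" "v - u < d" for u v
    using d(2)[of "{{u..v}}"] division_of_self[of u v] that by simp
  then show "\<exists>d>0. \<forall>y\<in>{a..b}. dist y x < d \<longrightarrow> dist (f y) (f x) \<le> e"
    using d(1) x unfolding dist_norm real_norm_def
    by (intro exI[of _ d] conjI ballI impI) (smt (verit) atLeastAtMost_iff norm_minus_commute)+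
qed

section \<open>The group law in exponential coordinates\<close>

text \<open>The difference quotients along \<open>Y / k\<close> do not depend on \<open>k\<close>, so they equal their limit. In this way
  multiplicativity on one-parameter subgroups turns into linearity.\<close>

lemma nat_homogeneous_eq_derivative:
  fixes f :: "'a::real_normed_vector \<Rightarrow> 'b::real_normed_vector"
  assumes der: "(f has_derivative D) (at 0)"
    and hom: "\<And>(k::nat) Y. f (real k *\<^sub>R Y) = real k *\<^sub>R f Y"
  shows "f = D"
proof
  fix Y
  interpret D: bounded_linear D using der by (rule has_derivative_bounded_linear)
  have f0: "f 0 = 0" using hom[of 0 0] by simp
  show "f Y = D Y"
  proof (cases "Y = 0")
    case True then show ?thesis by (simp add: f0 D.zero)
  next
    case False
    define y where "y k = inverse (real (Suc k)) *\<^sub>R Y" for k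
    have "y \<longlonglongrightarrow> 0 *\<^sub>R Y" unfolding y_def
      by (intro tendsto_intros LIMSEQ_inverse_real_of_nat)
    then have "filterlim y (at 0) sequentially"
      using False by (simp add: filterlim_at y_def)
    moreover have "((\<lambda>h. norm (f (0 + h) - f 0 - D h) / norm h) \<longlongrightarrow> 0) (at 0)"
      using der by (simp add: has_derivative_at)
    ultimately have "(\<lambda>k. norm (f (0 + y k) - f 0 - D (y k)) / norm (y k)) \<longlonglongrightarrow> 0"
      by (rule filterlim_compose[rotated])
    moreover have "norm (f (0 + y k) - f 0 - D (y k)) / norm (y k) = norm (f Y - D Y) / norm Y" for k
    proof -
      have "real (Suc k) *\<^sub>R y k = Y" by (simp add: y_def)
      then have "f Y = real (Suc k) *\<^sub>R f (y k)" using hom[of "Suc k" "y k"] by simp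
      then have "f (y k) = inverse (real (Suc k)) *\<^sub>R f Y" by simp
      then have "f (0 + y k) - f 0 - D (y k) = inverse (real (Suc k)) *\<^sub>R (f Y - D Y)"
        by (simp add: f0 y_def D.scaleR scaleR_diff_right)
      then have "norm (f (0 + y k) - f 0 - D (y k)) = inverse (real (Suc k)) * norm (f Y - D Y)"
        "norm (y k) = inverse (real (Suc k)) * norm Y"
        by (simp_all add: y_def)
      then show ?thesis by simp
    qed
    ultimately have "norm (f Y - D Y) / norm Y = 0" by (simp add: LIMSEQ_const_iff)
    then show ?thesis using False by simp
  qed
qed

lemma has_vector_derivative_if_increment:
  fixes f :: "real \<Rightarrow> 'a::real_normed_vector"
  assumes "\<And>h. f (s + h) = f s + h *\<^sub>R w h" and "(w \<longlongrightarrow> w0) (at 0)"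
  shows "(f has_vector_derivative w0) (at s)"
  unfolding has_vector_derivative_def has_derivative_at
proof (intro conjI bounded_linear_scaleR_left)
  have "((\<lambda>h. norm (w h - w0)) \<longlongrightarrow> 0) (at 0)"
    using assms(2) by (simp add: LIM_zero tendsto_norm_zero)
  then show "((\<lambda>h. norm (f (s + h) - f s - h *\<^sub>R w0) / norm h) \<longlongrightarrow> 0) (at 0)"
  proof (rule Lim_transform_eventually)
    show "\<forall>\<^sub>F h in at 0. norm (w h - w0) = norm (f (s + h) - f s - h *\<^sub>R w0) / norm h"
      unfolding eventually_at_filter by (simp add: assms(1) flip: scaleR_diff_right)
  qed
qed

lemma vector_derivative_zero_imp_constant:
  fixes f :: "real \<Rightarrow> 'a::real_normed_vector"
  assumes "\<And>s. (f has_vector_derivative 0) (at s)"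
  shows "f s = f t"
  using has_derivative_zero_unique[of UNIV f s t] assms
  by (simp add: has_vector_derivative_def)

context exponential_lie_group
begin

lemma Exp_carrier [simp]: "Exp X \<in> carrier G"
  using Exp_homeomorphism homeomorphism_image1 by blast

lemma Log_Exp [simp]: "Log Exp (Exp X) = X"
  using Exp_homeomorphism by (simp add: homeomorphism_def)

lemma Exp_Log [simp]: "x \<in> carrier G \<Longrightarrow> Exp (Log Exp x) = x"
  using Exp_homeomorphism by (simp add: homeomorphism_def)

lemma Exp_eq_iff [simp]: "Exp X = Exp Y \<longleftrightarrow> X = Y"
  by (metis Log_Exp)

lemma Exp_zero [simp]: "Exp 0 = \<one>"
  using Exp_one_parameter[of 0 0 0] by (metis Exp_carrier add.right_neutral l_cancel_one' scaleR_zero_left)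

lemma Exp_minus: "Exp (- X) = inv (Exp X)"
proof -
  have "Exp (- X) \<otimes> Exp X = \<one>" using Exp_one_parameter[of "-1" 1 X] by simp
  then show ?thesis by (simp add: inv_equality)
qed

text \<open>The group multiplication read in the chart \<open>Log\<close>, the map that the Baker--Campbell--Hausdorff series
  expresses by brackets.\<close>

definition gmul :: "'g \<Rightarrow> 'g \<Rightarrow> 'g" (infixl \<open>\<odot>\<close> 70) where
  "X \<odot> Y = Log Exp (Exp X \<otimes> Exp Y)"

lemma Exp_gmul [simp]: "Exp (X \<odot> Y) = Exp X \<otimes> Exp Y"
  by (simp add: gmul_def)

lemma gmul_assoc: "X \<odot> Y \<odot> Z = X \<odot> (Y \<odot> Z)"
  unfolding Exp_eq_iff[symmetric] by (simp add: m_assoc)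

lemma gmul_zero [simp]: "X \<odot> 0 = X" "0 \<odot> X = X"
  unfolding Exp_eq_iff[symmetric] by simp_all

lemma gmul_minus [simp]: "X \<odot> - X = 0" "- X \<odot> X = 0"
  unfolding Exp_eq_iff[symmetric] by (simp_all add: Exp_minus)

lemma gmul_scaleR: "s *\<^sub>R X \<odot> t *\<^sub>R X = (s + t) *\<^sub>R X"
  unfolding Exp_eq_iff[symmetric] by (simp add: Exp_one_parameter)

lemma gmul_cancel [simp]: "X \<odot> - Y \<odot> Y = X" "X \<odot> Y \<odot> - Y = X" "Y \<odot> (- Y \<odot> X) = X" "- Y \<odot> (Y \<odot> X) = X"
  by (simp_all add: gmul_assoc flip: gmul_assoc[of Y] gmul_assoc[of "- Y"])

lemma gmul_eq_zero: "X \<odot> Y = 0 \<Longrightarrow> - X = Y"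
  by (metis gmul_cancel(4) gmul_zero(1))

lemma minus_gmul: "- (X \<odot> Y) = - Y \<odot> - X"
  by (rule gmul_eq_zero) (simp add: gmul_assoc flip: gmul_assoc[of Y])

definition dgmul :: "'g \<times> 'g \<Rightarrow> 'g \<times> 'g \<Rightarrow> 'g" where
  "dgmul p = frechet_derivative (\<lambda>(X, Y). X \<odot> Y) (at p)"

lemma gmul_C1:
  shows gmul_has_derivative_pair: "((\<lambda>(X, Y). X \<odot> Y) has_derivative dgmul p) (at p)"
    and continuous_dgmul: "continuous_on UNIV (\<lambda>p. dgmul p v)"
proof -
  have "Ck_on (Suc 0) UNIV (\<lambda>(X, Y). X \<odot> Y)"
    using mult_smooth unfolding smooth_on_def gmul_def by blast
  then show "((\<lambda>(X, Y). X \<odot> Y) has_derivative dgmul p) (at p)"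
    and "continuous_on UNIV (\<lambda>p. dgmul p v)"
    unfolding dgmul_def Ck_on.simps by (blast intro: frechet_derivative_works[THEN iffD1])+
qed

sublocale dgmul: bounded_linear "dgmul p" for p
  using gmul_has_derivative_pair has_derivative_bounded_linear by blast

lemma has_derivative_gmul:
  assumes "(f has_derivative f') (at x)" "(g has_derivative g') (at x)"
  shows "((\<lambda>x. f x \<odot> g x) has_derivative (\<lambda>h. dgmul (f x, g x) (f' h, g' h))) (at x)"
  using has_derivative_compose[OF has_derivative_Pair[OF assms] gmul_has_derivative_pair] by simp

lemma has_vector_derivative_gmul:
  assumes "(f has_vector_derivative f') (at t)" "(g has_vector_derivative g') (at t)"
  shows "((\<lambda>s. f s \<odot> g s) has_vector_derivative dgmul (f t, g t) (f', g')) (at t)"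
proof -
  have "dgmul (f t, g t) (h *\<^sub>R f', h *\<^sub>R g') = h *\<^sub>R dgmul (f t, g t) (f', g')" for h
    using dgmul.scaleR[of _ h "(f', g')"] by simp
  then show ?thesis
    using has_derivative_gmul[OF assms[unfolded has_vector_derivative_def]]
    by (simp add: has_vector_derivative_def)
qed

lemma continuous_gmul: "isCont (\<lambda>(X, Y). X \<odot> Y) p"
  using gmul_has_derivative_pair has_derivative_continuous by blast

text \<open>Restricted to each factor, multiplication is the identity map.\<close>

lemma dgmul_zero: "dgmul (0, 0) (V, W) = V + W"
proof -
  have line: "((\<lambda>s. s *\<^sub>R X) has_vector_derivative X) (at 0)" for X :: 'g
    by (auto intro!: derivative_eq_intros)
  have zero: "((\<lambda>s::real. 0) has_vector_derivative (0::'g)) (at 0)" by simp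
  have "dgmul (0, 0) (V, 0) = V"
    using vector_derivative_unique_at[OF has_vector_derivative_gmul[OF line[of V] zero], of V] line[of V] by simp
  moreover have "dgmul (0, 0) (0, W) = W"
    using vector_derivative_unique_at[OF has_vector_derivative_gmul[OF zero line[of W]], of W] line[of W] by simp
  moreover have "dgmul (0, 0) (V, W) = dgmul (0, 0) (V, 0) + dgmul (0, 0) (0, W)"
    by (simp flip: dgmul.add)
  ultimately show ?thesis by simp
qed

definition conjugate :: "'g \<Rightarrow> 'g \<Rightarrow> 'g" where
  "conjugate X Y = X \<odot> Y \<odot> - X"

lemma Exp_conjugate: "Exp (conjugate X Y) = Exp X \<otimes> Exp Y \<otimes> inv (Exp X)"
  by (simp add: conjugate_def Exp_minus)

lemma conjugate_gmul: "conjugate (X \<odot> X') Y = conjugate X (conjugate X' Y)"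
  by (simp add: conjugate_def minus_gmul gmul_assoc)

lemma conjugate_hom: "conjugate X (Y \<odot> Z) = conjugate X Y \<odot> conjugate X Z"
  by (simp add: conjugate_def gmul_assoc)

lemma conjugate_zero_left [simp]: "conjugate 0 Y = Y"
  by (simp add: conjugate_def)

text \<open>Conjugation is a homomorphism, so it commutes with multiplication by natural numbers, the powers in
  exponential coordinates; being differentiable at 0, it is then equal to its derivative.\<close>

lemma conjugate_linear: "bounded_linear (conjugate X)"
proof -
  have "((\<lambda>Y. X \<odot> Y) has_derivative (\<lambda>h. dgmul (X, 0) (0, h))) (at 0)"
    by (rule has_derivative_gmul[of "\<lambda>Y. X" _ 0 "\<lambda>Y. Y", simplified]) auto
  from has_derivative_gmul[OF this has_derivative_const]
  obtain D where D: "(conjugate X has_derivative D) (at 0)" unfolding conjugate_def by blast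
  have "conjugate X (real k *\<^sub>R Y) = real k *\<^sub>R conjugate X Y" for k Y
  proof (induction k)
    case 0 show ?case by (simp add: conjugate_def)
  next
    case (Suc k)
    have "conjugate X (real (Suc k) *\<^sub>R Y) = conjugate X (real k *\<^sub>R Y \<odot> 1 *\<^sub>R Y)"
      by (simp only: gmul_scaleR of_nat_Suc add.commute)
    also have "\<dots> = real k *\<^sub>R conjugate X Y \<odot> 1 *\<^sub>R conjugate X Y" by (simp add: conjugate_hom Suc)
    also have "\<dots> = real (Suc k) *\<^sub>R conjugate X Y" by (simp only: gmul_scaleR of_nat_Suc add.commute)
    finally show ?case .
  qed
  then have "conjugate X = D" by (rule nat_homogeneous_eq_derivative[OF D])
  then show ?thesis using D has_derivative_bounded_linear by blast
qed

lemma Ad_Exp: "Ad G Exp (Exp X) Y = conjugate X Y"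
proof -
  interpret C: bounded_linear "conjugate X" by (rule conjugate_linear)
  have "Log Exp (Exp X \<otimes> Exp (t *\<^sub>R Y) \<otimes> inv (Exp X)) = t *\<^sub>R conjugate X Y" for t
  proof -
    have "Exp (t *\<^sub>R conjugate X Y) = Exp X \<otimes> Exp (t *\<^sub>R Y) \<otimes> inv (Exp X)"
      using Exp_conjugate[of X "t *\<^sub>R Y"] by (simp only: C.scaleR)
    then show ?thesis by (metis Log_Exp)
  qed
  moreover have "((\<lambda>t. t *\<^sub>R conjugate X Y) has_vector_derivative conjugate X Y) (at 0)"
    by (auto intro!: derivative_eq_intros)
  ultimately show ?thesis unfolding Ad_def by (simp add: vector_derivative_at)
qed

text \<open>The hypothesis on \<open>Ad\<close> gives the derivative at \<open>s = 0\<close>. Since conjugation by a product is a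
  composition of conjugations, the same equation holds at every \<open>s\<close>.\<close>

lemma conjugate_flow: "((\<lambda>s. conjugate (s *\<^sub>R X) Y) has_vector_derivative bracket X (conjugate (s *\<^sub>R X) Y)) (at s)"
proof -
  have "((\<lambda>r. r - s) has_vector_derivative 1) (at s)" by (auto intro!: derivative_eq_intros)
  moreover have "((\<lambda>r. conjugate (r *\<^sub>R X) (conjugate (s *\<^sub>R X) Y)) has_vector_derivative bracket X (conjugate (s *\<^sub>R X) Y)) (at (s - s))"
    using bracket_is_ad[of X "conjugate (s *\<^sub>R X) Y"] by (simp add: Ad_Exp)
  ultimately have "((\<lambda>r. conjugate (r *\<^sub>R X) (conjugate (s *\<^sub>R X) Y)) \<circ> (\<lambda>r. r - s) has_vector_derivative
      1 *\<^sub>R bracket X (conjugate (s *\<^sub>R X) Y)) (at s)"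
    by (rule vector_diff_chain_at)
  moreover have "conjugate ((r - s) *\<^sub>R X) (conjugate (s *\<^sub>R X) Y) = conjugate (r *\<^sub>R X) Y" for r
    by (simp add: gmul_scaleR flip: conjugate_gmul)
  ultimately show ?thesis by (simp add: comp_def)
qed

text \<open>Variation of constants: undoing the flow, \<open>s \<mapsto> conjugate (- s X) (Z s)\<close> has derivative zero. Only the
  derivative at a single time has to be computed, because the flow property moves time \<open>s\<close> to \<open>0\<close>.\<close>

lemma conjugate_flow_unique:
  assumes Z: "\<And>s. (Z has_vector_derivative bracket X (Z s)) (at s)"
  shows "Z s = conjugate (s *\<^sub>R X) (Z 0)"
proof -
  define q where "q s = conjugate (- s *\<^sub>R X) (Z s)" for s
  have "(q has_vector_derivative 0) (at s)" for s
  proof -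
    interpret C: bounded_linear "conjugate (- s *\<^sub>R X)" by (rule conjugate_linear)
    have line: "((\<lambda>h. h *\<^sub>R Y) has_vector_derivative Y) (at 0)" for Y :: 'g
      by (auto intro!: derivative_eq_intros)
    have line': "((\<lambda>h. - h *\<^sub>R Y) has_vector_derivative - Y) (at 0)" for Y :: 'g
      by (auto intro!: derivative_eq_intros)
    \<comment> \<open>derivative of conjugation in the group variable and in its argument jointly, at \<open>(0, Z s)\<close>\<close>
    define E where "E V W = dgmul (Z s, 0) (dgmul (0, Z s) (V, W), - V)" for V W
    have dconj: "((\<lambda>h. conjugate (- h *\<^sub>R X') (Y h)) has_vector_derivative E (- X') W) (at 0)"
      if "(Y has_vector_derivative W) (at 0)" "Y 0 = Z s" for Y W X'
      unfolding conjugate_def E_def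
      using has_vector_derivative_gmul[OF has_vector_derivative_gmul[OF line'[of X'] that(1)] line[of X']] that(2) by simp
    have "((\<lambda>h. conjugate (- h *\<^sub>R X) (Z s)) has_vector_derivative - bracket X (Z s)) (at 0)"
    proof -
      have "((\<lambda>h::real. - h) has_vector_derivative - 1) (at 0)" by (auto intro!: derivative_eq_intros)
      moreover have "((\<lambda>r. conjugate (r *\<^sub>R X) (Z s)) has_vector_derivative bracket X (Z s)) (at (- 0))"
        using conjugate_flow[of X "Z s" 0] by simp
      ultimately show ?thesis using vector_diff_chain_at[of uminus "-1" 0 "\<lambda>r. conjugate (r *\<^sub>R X) (Z s)"] by (simp add: comp_def)
    qed
    then have E1: "E (- X) 0 = - bracket X (Z s)"
      using dconj[of "\<lambda>_. Z s" 0 X] vector_derivative_unique_at by fastforce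
    have shift: "((\<lambda>h. Z (s + h)) has_vector_derivative bracket X (Z s)) (at 0)"
    proof -
      have "((\<lambda>h. s + h) has_vector_derivative 1) (at 0)" by (auto intro!: derivative_eq_intros)
      then show ?thesis using vector_diff_chain_at[of "\<lambda>h. s + h" 1 0 Z "bracket X (Z s)"] Z[of s] by (simp add: comp_def)
    qed
    \<comment> \<open>the partial derivative in the argument: conjugation by \<open>0\<close> is the identity\<close>
    have "((\<lambda>h. conjugate (- h *\<^sub>R 0) (Z (s + h))) has_vector_derivative E (- 0) (bracket X (Z s))) (at 0)"
      using dconj[OF shift, of 0] by simp
    then have E2: "E 0 (bracket X (Z s)) = bracket X (Z s)"
      using shift vector_derivative_unique_at by fastforce
    have "E (- X) (bracket X (Z s)) = E (- X) 0 + E 0 (bracket X (Z s))"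
      unfolding E_def by (simp flip: dgmul.add)
    then have "E (- X) (bracket X (Z s)) = 0" using E1 E2 by simp
    then have "((\<lambda>h. conjugate (- h *\<^sub>R X) (Z (s + h))) has_vector_derivative 0) (at 0)"
      using dconj[OF shift, of X] by simp
    from C.has_vector_derivative[OF this]
    have "((\<lambda>h. conjugate (- s *\<^sub>R X) (conjugate (- h *\<^sub>R X) (Z (s + h)))) has_vector_derivative 0) (at 0)"
      using C.zero by simp
    moreover have "conjugate (- s *\<^sub>R X) (conjugate (- h *\<^sub>R X) Y) = conjugate (- (s + h) *\<^sub>R X) Y" for h Y
      using gmul_scaleR[of "-s" X "-h"] by (simp flip: conjugate_gmul)
    ultimately have "((\<lambda>h. q (s + h)) has_vector_derivative 0) (at (s - s))"
      by (simp add: q_def)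
    moreover have "((\<lambda>r. r - s) has_vector_derivative 1) (at s)" by (auto intro!: derivative_eq_intros)
    ultimately show "(q has_vector_derivative 0) (at s)"
      using vector_diff_chain_at[of "\<lambda>r. r - s" 1 s "\<lambda>h. q (s + h)" 0] by (simp add: comp_def)
  qed
  then have "q s = q 0" by (rule vector_derivative_zero_imp_constant)
  then have "conjugate (s *\<^sub>R X) (conjugate (- s *\<^sub>R X) (Z s)) = conjugate (s *\<^sub>R X) (Z 0)" by (simp add: q_def)
  moreover have "conjugate (s *\<^sub>R X) (conjugate (- s *\<^sub>R X) Y) = Y" for Y
    using gmul_scaleR[of s X "-s"] by (simp flip: conjugate_gmul)
  ultimately show ?thesis by simp
qed

text \<open>The vector \<open>dgmul (s Z, - s Z) (s W, 0)\<close> is the right velocity, in the parameter \<open>h\<close> at \<open>h = 0\<close>, of the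
  curve \<open>h \<mapsto> s (Z + h W)\<close>. Splitting the exponential of \<open>(s + t) (Z + h W)\<close> into
  two factors gives the cocycle identity \<open>v (s + t) = v s + conjugate (s Z) (v t)\<close>, and \<open>v t / t \<longrightarrow> W\<close> as
  \<open>t \<longrightarrow> 0\<close>. Integrated over \<open>[0, 1]\<close>, this is the formula for the differential of the exponential map.\<close>

lemma right_velocity_flow:
  "((\<lambda>s. dgmul (s *\<^sub>R Z, - (s *\<^sub>R Z)) (s *\<^sub>R W, 0)) has_vector_derivative conjugate (s *\<^sub>R Z) W) (at s)"
proof (rule has_vector_derivative_if_increment)
  interpret C: bounded_linear "conjugate (s *\<^sub>R Z)" by (rule conjugate_linear)
  let ?v = "\<lambda>s. dgmul (s *\<^sub>R Z, - (s *\<^sub>R Z)) (s *\<^sub>R W, 0)"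
  let ?u = "\<lambda>h. dgmul (h *\<^sub>R Z, - (h *\<^sub>R Z)) (W, 0)"
  have "continuous_on UNIV ?u"
    by (rule continuous_on_compose2[OF continuous_dgmul]) (auto intro!: continuous_intros)
  then have "(?u \<longlongrightarrow> ?u 0) (at 0)" unfolding continuous_on_def by blast
  then have "(?u \<longlongrightarrow> W) (at 0)" by (simp add: dgmul_zero)
  then show "((\<lambda>h. conjugate (s *\<^sub>R Z) (?u h)) \<longlongrightarrow> conjugate (s *\<^sub>R Z) W) (at 0)" by (rule C.tendsto)
  fix t
  define m where "m t h = t *\<^sub>R (Z + h *\<^sub>R W) \<odot> - (t *\<^sub>R Z)" for t h
  have dm: "(m t has_vector_derivative ?v t) (at 0)" for t
  proof -
    have "((\<lambda>h. t *\<^sub>R (Z + h *\<^sub>R W)) has_vector_derivative t *\<^sub>R W) (at 0)"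
      by (auto intro!: derivative_eq_intros)
    from has_vector_derivative_gmul[OF this has_vector_derivative_const]
    show ?thesis unfolding m_def by simp
  qed
  have m0: "m t 0 = 0" for t by (simp add: m_def)
  have "((\<lambda>h. m s h \<odot> conjugate (s *\<^sub>R Z) (m t h)) has_vector_derivative ?v s + conjugate (s *\<^sub>R Z) (?v t)) (at 0)"
    using has_vector_derivative_gmul[OF dm[of s] C.has_vector_derivative[OF dm[of t]]]
    by (simp add: m0 C.zero dgmul_zero)
  moreover have "m s h \<odot> conjugate (s *\<^sub>R Z) (m t h) = m (s + t) h" for h
  proof -
    have "m s h \<odot> conjugate (s *\<^sub>R Z) (m t h) = s *\<^sub>R (Z + h *\<^sub>R W) \<odot> t *\<^sub>R (Z + h *\<^sub>R W) \<odot> (- (t *\<^sub>R Z) \<odot> - (s *\<^sub>R Z))"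
      by (simp add: m_def conjugate_def gmul_assoc)
    also have "- (t *\<^sub>R Z) \<odot> - (s *\<^sub>R Z) = - ((s + t) *\<^sub>R Z)"
      using gmul_scaleR[of "- t" Z "- s"] by (simp add: algebra_simps)
    finally show ?thesis by (simp add: m_def gmul_scaleR)
  qed
  ultimately have "(m (s + t) has_vector_derivative ?v s + conjugate (s *\<^sub>R Z) (?v t)) (at 0)" by simp
  then have "?v (s + t) = ?v s + conjugate (s *\<^sub>R Z) (?v t)"
    using dm vector_derivative_unique_at by blast
  moreover have "?v t = t *\<^sub>R ?u t" by (simp flip: dgmul.scaleR)
  ultimately show "?v (s + t) = ?v s + t *\<^sub>R conjugate (s *\<^sub>R Z) (?u t)" by (simp only: C.scaleR)
qed

text \<open>Since \<open>\<phi>\<close> respects the equation \<open>Z' = [X, Z]\<close>, it commutes with conjugation, hence with the differential of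
  the exponential map, hence with right velocities of curves. The curve \<open>t \<mapsto> t X \<odot> Y\<close> has
  constant right velocity \<open>X\<close>, so its image under \<open>\<phi>\<close> has constant right velocity \<open>\<phi> X\<close>, and
  therefore coincides with \<open>t \<mapsto> t (\<phi> X) \<odot> \<phi> Y\<close>.\<close>

theorem lie_endomorphism_integrates:
  assumes \<phi>: "bounded_linear \<phi>" and hom: "\<And>X Y. \<phi> (bracket X Y) = bracket (\<phi> X) (\<phi> Y)"
  shows "\<phi> (X \<odot> Y) = \<phi> X \<odot> \<phi> Y"
proof -
  interpret \<phi>: bounded_linear \<phi> by fact
  have conjugate: "\<phi> (conjugate (s *\<^sub>R Z) W) = conjugate (s *\<^sub>R \<phi> Z) (\<phi> W)" for s Z W
    using conjugate_flow_unique[of "\<lambda>s. \<phi> (conjugate (s *\<^sub>R Z) W)" "\<phi> Z" s] \<phi>.has_vector_derivative[OF conjugate_flow]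
    by (simp add: hom)
  have vel: "\<phi> (dgmul (Z, - Z) (W, 0)) = dgmul (\<phi> Z, - \<phi> Z) (\<phi> W, 0)" for Z W
  proof -
    let ?v = "\<lambda>Z W s. dgmul (s *\<^sub>R Z, - (s *\<^sub>R Z)) (s *\<^sub>R W, 0)"
    let ?d = "\<lambda>s. \<phi> (?v Z W s) - ?v (\<phi> Z) (\<phi> W) s"
    have "(?d has_vector_derivative 0) (at s)" for s
      using has_vector_derivative_diff[OF \<phi>.has_vector_derivative[OF right_velocity_flow[of Z W s]]
          right_velocity_flow[of "\<phi> Z" "\<phi> W" s]] by (simp add: conjugate)
    then have "?d 1 = ?d 0" by (rule vector_derivative_zero_imp_constant)
    moreover have "?d 0 = 0" using dgmul.zero by (simp add: \<phi>.zero zero_prod_def)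
    ultimately show ?thesis by simp
  qed
  define P where "P t = \<phi> (t *\<^sub>R X \<odot> Y)" for t
  \<comment> \<open>constant exactly when \<open>P\<close> is the curve \<open>t \<mapsto> t (\<phi> X) \<odot> \<phi> Y\<close>\<close>
  define q where "q t = - (t *\<^sub>R \<phi> X) \<odot> P t" for t
  have "(q has_vector_derivative 0) (at t)" for t
  proof -
    let ?Z = "\<lambda>t. t *\<^sub>R X \<odot> Y"
    define W where "W = dgmul (t *\<^sub>R X, Y) (X, 0)"
    have line: "((\<lambda>s. s *\<^sub>R X) has_vector_derivative X) (at t)"
      by (auto intro!: derivative_eq_intros)
    have Z': "(?Z has_vector_derivative W) (at t)"
      unfolding W_def using has_vector_derivative_gmul[OF line has_vector_derivative_const] by simp
    have "((\<lambda>s. ?Z s \<odot> - ?Z t) has_vector_derivative dgmul (?Z t, - ?Z t) (W, 0)) (at t)"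
      using has_vector_derivative_gmul[OF Z' has_vector_derivative_const] by simp
    moreover have "?Z s \<odot> - ?Z t = (s - t) *\<^sub>R X" for s
      using gmul_scaleR[of s X "- t"] by (simp add: minus_gmul gmul_assoc)
    moreover have "((\<lambda>s. (s - t) *\<^sub>R X) has_vector_derivative X) (at t)"
      by (auto intro!: derivative_eq_intros)
    ultimately have "dgmul (?Z t, - ?Z t) (W, 0) = X"
      using vector_derivative_unique_at by fastforce
    then have W: "dgmul (P t, - P t) (\<phi> W, 0) = \<phi> X"
      unfolding P_def using vel by metis
    have "(P has_vector_derivative \<phi> W) (at t)"
      unfolding P_def by (rule \<phi>.has_vector_derivative[OF Z'])
    then have p': "((\<lambda>s. P s \<odot> - P t) has_vector_derivative \<phi> X) (at t)"
      using has_vector_derivative_gmul[OF _ has_vector_derivative_const, of P "\<phi> W" t "- P t"] W by simp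
    have "((\<lambda>s. (t - s) *\<^sub>R \<phi> X) has_vector_derivative - \<phi> X) (at t)"
      by (auto intro!: derivative_eq_intros)
    from has_vector_derivative_gmul[OF this p']
    have "((\<lambda>s. (t - s) *\<^sub>R \<phi> X \<odot> (P s \<odot> - P t)) has_vector_derivative 0) (at t)"
      by (simp add: dgmul_zero)
    from has_vector_derivative_gmul[OF has_vector_derivative_gmul[OF has_vector_derivative_const this] has_vector_derivative_const]
    have "((\<lambda>s. - (t *\<^sub>R \<phi> X) \<odot> ((t - s) *\<^sub>R \<phi> X \<odot> (P s \<odot> - P t)) \<odot> P t) has_vector_derivative 0) (at t)"
      using dgmul.zero by (simp add: zero_prod_def)
    moreover have "- (t *\<^sub>R \<phi> X) \<odot> ((t - s) *\<^sub>R \<phi> X \<odot> (P s \<odot> - P t)) \<odot> P t = q s" for s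
    proof -
      have "- (t *\<^sub>R \<phi> X) \<odot> (t - s) *\<^sub>R \<phi> X = - (s *\<^sub>R \<phi> X)"
        using gmul_scaleR[of "- t" "\<phi> X" "t - s"] by simp
      then show ?thesis unfolding q_def by (simp add: gmul_assoc flip: gmul_assoc[of "- (t *\<^sub>R \<phi> X)"])
    qed
    ultimately show ?thesis by simp
  qed
  then have "q 1 = q 0" by (rule vector_derivative_zero_imp_constant)
  then have "\<phi> X \<odot> (- \<phi> X \<odot> \<phi> (X \<odot> Y)) = \<phi> X \<odot> \<phi> Y" by (simp add: q_def P_def)
  then show ?thesis by simp
qed

end

section \<open>Lie integrals along concatenated paths\<close>

lemma ac_pathD:
  assumes "ac_path atlas c a b" "(U, \<phi>) \<in> atlas" "a \<le> s" "s \<le> t" "t \<le> b" "c ` {s..t} \<subseteq> U"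
  shows "abs_continuous (\<phi> \<circ> c) s t"
  using assms unfolding ac_path_def by fast

lemma ac_path_cong:
  assumes "\<And>t. t \<in> {a..b} \<Longrightarrow> c t = c' t"
  shows "ac_path atlas c a b \<longleftrightarrow> ac_path atlas c' a b"
proof -
  have "abs_continuous (\<phi> \<circ> c) s t \<longleftrightarrow> abs_continuous (\<phi> \<circ> c') s t" "c ` {s..t} = c' ` {s..t}"
    if "a \<le> s" "t \<le> b" for s t and \<phi> :: "'a \<Rightarrow> 'b"
    using that assms by (auto intro!: abs_continuous_cong image_cong)
  moreover have "continuous_on {a..b} c \<longleftrightarrow> continuous_on {a..b} c'"
    using assms by (intro continuous_on_cong) auto
  ultimately show ?thesis unfolding ac_path_def by (auto split: prod.splits)
qed

lemma ac_path_affine: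
  assumes c: "ac_path atlas c (m * a + k) (m * b + k)" and m: "m > 0"
  shows "ac_path atlas (\<lambda>t. c (m * t + k)) a b"
  unfolding ac_path_def
proof (intro conjI ballI, goal_cases)
  case 1
  have "continuous_on {m * a + k..m * b + k} c" using c by (simp add: ac_path_def)
  then show ?case
    by (rule continuous_on_compose2) (use m in \<open>auto intro!: continuous_intros\<close>)
next
  case (2 ch)
  obtain U \<phi> where ch: "ch = (U, \<phi>)" by fastforce
  have "abs_continuous (\<phi> \<circ> (\<lambda>t. c (m * t + k))) s t"
    if st: "a \<le> s" "s \<le> t" "t \<le> b" "(\<lambda>t. c (m * t + k)) ` {s..t} \<subseteq> U" for s t
  proof -
    have "c ` {m * s + k..m * t + k} \<subseteq> U"
    proof
      fix y assume "y \<in> c ` {m * s + k..m * t + k}"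
      then obtain x where x: "m * s + k \<le> x" "x \<le> m * t + k" "y = c x" by auto
      have mem: "(x - k) / m \<in> {s..t}" and eq: "m * ((x - k) / m) + k = x"
        using x m by (auto simp: field_simps)
      have "c (m * ((x - k) / m) + k) \<in> U" using st(4) mem by (simp only: image_subset_iff)
      then show "y \<in> U" using eq x(3) by simp
    qed
    then have "abs_continuous (\<phi> \<circ> c) (m * s + k) (m * t + k)"
      by (intro ac_pathD[OF c]) (use 2 ch st m in auto)
    then show ?thesis using abs_continuous_affine[OF _ m, of "\<phi> \<circ> c" s k t] by (simp add: comp_def)
  qed
  then show ?case using ch by auto
qed

lemma ac_path_combine:
  assumes c1: "ac_path atlas c a m" and c2: "ac_path atlas c m b" and m: "a \<le> m" "m \<le> b"
  shows "ac_path atlas c a b"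
  unfolding ac_path_def
proof (intro conjI ballI, goal_cases)
  case 1
  have "continuous_on ({a..m} \<union> {m..b}) c" using assms by (intro continuous_on_closed_Un) (auto simp: ac_path_def)
  then show ?case using m by (simp add: ivl_disj_un)
next
  case (2 ch)
  obtain U \<phi> where ch: "ch = (U, \<phi>)" by fastforce
  have "abs_continuous (\<phi> \<circ> c) s t" if st: "a \<le> s" "s \<le> t" "t \<le> b" "c ` {s..t} \<subseteq> U" for s t
  proof -
    have left: "abs_continuous (\<phi> \<circ> c) s' t'" if "s \<le> s'" "s' \<le> t'" "t' \<le> m" "t' \<le> t" for s' t'
    proof -
      have "c ` {s'..t'} \<subseteq> U" using st(4) that by fastforce
      then show ?thesis using 2 ch st(1) that by (intro ac_pathD[OF c1]) auto
    qed
    have right: "abs_continuous (\<phi> \<circ> c) s' t'" if "m \<le> s'" "s \<le> s'" "s' \<le> t'" "t' \<le> t" for s' t'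
    proof -
      have "c ` {s'..t'} \<subseteq> U" using st(4) that by fastforce
      then show ?thesis using 2 ch st(3) that by (intro ac_pathD[OF c2]) auto
    qed
    consider "t \<le> m" | "m \<le> s" | "s \<le> m" "m \<le> t" using st by linarith
    then show ?thesis
    proof cases
      case 3
      show ?thesis by (rule abs_continuous_combine[OF left right]) (use 3 st in auto)
    qed (use left[of s t] right[of s t] st in auto)
  qed
  then show ?case using ch by auto
qed

lemma form_on_velocity_affine:
  assumes form: "one_form atlas A" and vel: "form_on_velocity atlas A c (m * t + k) K"
    and S: "open S" "t \<in> S" "\<And>s. s \<in> S \<Longrightarrow> p s = c (m * s + k)"
  shows "form_on_velocity atlas A p t (m *\<^sub>R K)"
proof -
  from vel obtain U \<phi> v where ch: "(U, \<phi>) \<in> atlas" "c (m * t + k) \<in> U"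
    and v: "((\<phi> \<circ> c) has_vector_derivative v) (at (m * t + k))"
    and K: "K = A (U, \<phi>) (\<phi> (c (m * t + k))) v"
    unfolding form_on_velocity_def by blast
  have "((\<lambda>s. m * s + k) has_vector_derivative m) (at t)"
    by (auto intro!: derivative_eq_intros)
  then have "((\<phi> \<circ> c) \<circ> (\<lambda>s. m * s + k) has_vector_derivative m *\<^sub>R v) (at t)"
    by (rule vector_diff_chain_at) (use v in simp)
  then have "((\<phi> \<circ> p) has_vector_derivative m *\<^sub>R v) (at t)"
    by (rule has_vector_derivative_transform_within_open[OF _ S(1,2)]) (simp add: S(3))
  moreover have "linear (A (U, \<phi>) (\<phi> (c (m * t + k))))"
    using form ch unfolding one_form_def by fastforce
  then have "m *\<^sub>R K = A (U, \<phi>) (\<phi> (p t)) (m *\<^sub>R v)"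
    using K S by (simp add: linear_scale)
  ultimately show ?thesis
    unfolding form_on_velocity_def using ch S(2,3) by (intro bexI[of _ "(U, \<phi>)"]) auto
qed

text \<open>Right velocities do not change under right translation by \<open>g\<close>. This is why a solution started at the
  end of another one is continued by multiplying it from the right.\<close>

lemma has_right_velocity_affine:
  assumes "group G" and g: "g \<in> carrier G" and U: "\<And>s. s \<in> S \<Longrightarrow> U (m * s + k) \<in> carrier G"
    and vel: "has_right_velocity G Exp U (m * t + k) K"
    and S: "open S" "t \<in> S" "\<And>s. s \<in> S \<Longrightarrow> W s = U (m * s + k) \<otimes>\<^bsub>G\<^esub> g"
  shows "has_right_velocity G Exp W t (m *\<^sub>R K)"
proof -
  interpret group G by fact
  have "((\<lambda>s. m * s + k) has_vector_derivative m) (at t)"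
    by (auto intro!: derivative_eq_intros)
  then have "((\<lambda>s. Log Exp (U s \<otimes>\<^bsub>G\<^esub> inv\<^bsub>G\<^esub> (U (m * t + k)))) \<circ> (\<lambda>s. m * s + k) has_vector_derivative m *\<^sub>R K) (at t)"
    by (rule vector_diff_chain_at) (use vel in \<open>simp add: has_right_velocity_def\<close>)
  then show ?thesis unfolding has_right_velocity_def
  proof (rule has_vector_derivative_transform_within_open[OF _ S(1,2)])
    fix s assume s: "s \<in> S"
    have "x \<otimes>\<^bsub>G\<^esub> g \<otimes>\<^bsub>G\<^esub> inv\<^bsub>G\<^esub> (y \<otimes>\<^bsub>G\<^esub> g) = x \<otimes>\<^bsub>G\<^esub> inv\<^bsub>G\<^esub> y"
      if "x \<in> carrier G" "y \<in> carrier G" for x y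
    proof -
      have "g \<otimes>\<^bsub>G\<^esub> (inv\<^bsub>G\<^esub> g \<otimes>\<^bsub>G\<^esub> inv\<^bsub>G\<^esub> y) = inv\<^bsub>G\<^esub> y"
        using that g by (simp add: m_assoc[symmetric])
      then show ?thesis using that g by (simp add: inv_mult_group m_assoc)
    qed
    then show "((\<lambda>s. Log Exp (U s \<otimes>\<^bsub>G\<^esub> inv\<^bsub>G\<^esub> (U (m * t + k)))) \<circ> (\<lambda>s. m * s + k)) s
        = Log Exp (W s \<otimes>\<^bsub>G\<^esub> inv\<^bsub>G\<^esub> (W t))"
      using U s S by simp
  qed
qed

lemma negligible_affine_preimage:
  fixes N :: "real set"
  assumes N: "negligible N" and m: "m \<noteq> 0"
  shows "negligible {t. m * t + k \<in> N}"
proof -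
  have "{t. m * t + k \<in> N} = (\<lambda>x. (x - k) / m) ` N"
  proof (rule Set.set_eqI, rule iffI)
    fix t assume "t \<in> {t. m * t + k \<in> N}"
    then show "t \<in> (\<lambda>x. (x - k) / m) ` N"
      using m by (intro image_eqI[of _ _ "m * t + k"]) auto
  qed (use m in auto)
  moreover have "negligible ((\<lambda>x. (x - k) / m) ` N)"
    using m by (intro negligible_differentiable_image_negligible N)
      (auto simp: differentiable_on_def intro!: derivative_intros)
  ultimately show ?thesis by simp
qed

context exponential_lie_group
begin

text \<open>Needed to keep the translated solution absolutely continuous in the chart \<open>Log\<close>.\<close>

lemma right_translation_lipschitz:
  assumes "finite_dimensional TYPE('g)" "compact S"
  obtains L where "L-lipschitz_on S (\<lambda>X. X \<odot> Y)"
proof (rule continuous_derivative_imp_lipschitz_on_compact[OF assms(1) _ _ assms(2), of "\<lambda>X. X \<odot> Y" "\<lambda>X h. dgmul (X, Y) (h, 0)"])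
  show "((\<lambda>X. X \<odot> Y) has_derivative (\<lambda>h. dgmul (X, Y) (h, 0))) (at X)" for X
    using has_derivative_gmul[of "\<lambda>X. X" "\<lambda>X. X" X "\<lambda>_. Y" "\<lambda>_. 0"] by simp
  show "continuous_on UNIV (\<lambda>X. dgmul (X, Y) (v, 0))" for v
    by (rule continuous_on_compose2[OF continuous_dgmul]) (auto intro!: continuous_intros)
qed (use that in blast)

lemma has_lie_integral_affine:
  assumes form: "one_form atlas A" and m: "m > 0"
    and int: "has_lie_integral G Exp atlas A c (m * a + k) (m * b + k) X"
    and p: "\<And>t. t \<in> {a<..<b} \<Longrightarrow> p t = c (m * t + k)"
  shows "has_lie_integral G Exp atlas A p a b X"
proof -
  from int obtain U N where U: "\<And>t. t \<in> {m * a + k..m * b + k} \<Longrightarrow> U t \<in> carrier G"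
    and ac: "abs_continuous (Log Exp \<circ> U) (m * a + k) (m * b + k)" and U0: "U (m * a + k) = \<one>"
    and N: "negligible N"
    and vel: "\<And>t. t \<in> {m * a + k<..<m * b + k} - N \<Longrightarrow>
       \<exists>K. form_on_velocity atlas A c t K \<and> has_right_velocity G Exp U t K"
    and X: "X = Log Exp (U (m * b + k))"
    unfolding has_lie_integral_def by blast
  have inside: "m * t + k \<in> {m * a + k..m * b + k}" if "t \<in> {a..b}" for t using m that by auto
  define W where "W t = U (m * t + k)" for t
  have "\<exists>K. form_on_velocity atlas A p t K \<and> has_right_velocity G Exp W t K"
    if t: "t \<in> {a<..<b}" "m * t + k \<notin> N" for t
  proof -
    have "m * t + k \<in> {m * a + k<..<m * b + k} - N" using t m by auto
    from vel[OF this] obtain K where K: "form_on_velocity atlas A c (m * t + k) K"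
       "has_right_velocity G Exp U (m * t + k) K" by blast
    have "form_on_velocity atlas A p t (m *\<^sub>R K)"
      by (rule form_on_velocity_affine[OF form K(1) open_greaterThanLessThan t(1) p])
    moreover have "has_right_velocity G Exp W t (m *\<^sub>R K)"
    proof (rule has_right_velocity_affine[OF group_axioms one_closed _ K(2) open_greaterThanLessThan t(1)])
      fix s assume "s \<in> {a<..<b}"
      then show carr: "U (m * s + k) \<in> carrier G" by (intro U inside) auto
      then show "W s = U (m * s + k) \<otimes> \<one>" by (simp add: W_def)
    qed
    ultimately show ?thesis by blast
  qed
  moreover have "abs_continuous (Log Exp \<circ> W) a b"
    using abs_continuous_affine[OF ac m] by (simp add: W_def comp_def)
  moreover have "negligible {t. m * t + k \<in> N}" using negligible_affine_preimage[OF N] m by simp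
  ultimately show ?thesis
    unfolding has_lie_integral_def using U inside U0 X
    by (intro exI[of _ W] conjI exI[of _ "{t. m * t + k \<in> N}"]) (auto simp: W_def)
qed

text \<open>The solution on \<open>[a, m]\<close>, with end value \<open>g\<close>, is continued by the second solution times \<open>g\<close>. The
  later piece of the path stands on the left, as always for equations \<open>U' = K U\<close>.\<close>

lemma has_lie_integral_combine:
  assumes fd: "finite_dimensional TYPE('g)" and form: "one_form atlas A" and m: "a \<le> m" "m \<le> b"
    and 1: "has_lie_integral G Exp atlas A c a m X" and 2: "has_lie_integral G Exp atlas A c m b Y"
  shows "has_lie_integral G Exp atlas A c a b (Y \<odot> X)"
proof -
  from 1 obtain U1 N1 where U1: "\<And>t. t \<in> {a..m} \<Longrightarrow> U1 t \<in> carrier G"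
    and ac1: "abs_continuous (Log Exp \<circ> U1) a m" and U1a: "U1 a = \<one>"
    and N1: "negligible N1"
    and vel1: "\<And>t. t \<in> {a<..<m} - N1 \<Longrightarrow> \<exists>K. form_on_velocity atlas A c t K \<and> has_right_velocity G Exp U1 t K"
    and X: "X = Log Exp (U1 m)"
    unfolding has_lie_integral_def by blast
  from 2 obtain U2 N2 where U2: "\<And>t. t \<in> {m..b} \<Longrightarrow> U2 t \<in> carrier G"
    and ac2: "abs_continuous (Log Exp \<circ> U2) m b" and U2m: "U2 m = \<one>"
    and N2: "negligible N2"
    and vel2: "\<And>t. t \<in> {m<..<b} - N2 \<Longrightarrow> \<exists>K. form_on_velocity atlas A c t K \<and> has_right_velocity G Exp U2 t K"
    and Y: "Y = Log Exp (U2 b)"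
    unfolding has_lie_integral_def by blast
  define g where "g = U1 m"
  have g: "g \<in> carrier G" using U1 m by (simp add: g_def)
  define W where "W t = (if t \<le> m then U1 t else U2 t \<otimes> g)" for t
  have W2: "W t = U2 t \<otimes> g" if "t \<in> {m..b}" for t
    using that g U2m by (auto simp: W_def g_def)
  have carr: "W t \<in> carrier G" if "t \<in> {a..b}" for t
    using that g U1 U2 by (auto simp: W_def)
  have "abs_continuous (Log Exp \<circ> W) a m"
    using ac1 by (subst abs_continuous_cong[of _ _ _ "Log Exp \<circ> U1"]) (auto simp: W_def)
  moreover have "abs_continuous (Log Exp \<circ> W) m b"
  proof -
    have "compact ((Log Exp \<circ> U2) ` {m..b})"
      using abs_continuous_imp_continuous_on[OF ac2] by (intro compact_continuous_image) auto
    from right_translation_lipschitz[OF fd this]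
    obtain L where "L-lipschitz_on ((Log Exp \<circ> U2) ` {m..b}) (\<lambda>Z. Z \<odot> Log Exp g)" by blast
    from abs_continuous_lipschitz_compose[OF ac2 this]
    show ?thesis
      using U2 g W2 by (subst abs_continuous_cong[of _ _ _ "(\<lambda>Z. Z \<odot> Log Exp g) \<circ> (Log Exp \<circ> U2)"])
         (auto simp: gmul_def)
  qed
  ultimately have ac: "abs_continuous (Log Exp \<circ> W) a b"
    using abs_continuous_combine m by blast
  have vel: "\<exists>K. form_on_velocity atlas A c t K \<and> has_right_velocity G Exp W t K"
    if t: "t \<in> {a<..<b} - (N1 \<union> N2 \<union> {m})" for t
  proof (cases "t < m")
    case True
    with t have t': "t \<in> {a<..<m}" by auto
    from vel1[of t] t t' obtain K where K: "form_on_velocity atlas A c t K" "has_right_velocity G Exp U1 (1 * t + 0) K"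
      by auto
    have "has_right_velocity G Exp W t (1 *\<^sub>R K)"
      by (rule has_right_velocity_affine[OF group_axioms one_closed _ K(2) open_greaterThanLessThan t'])
        (use U1 in \<open>auto simp: W_def\<close>)
    then show ?thesis using K(1) by auto
  next
    case False
    with t have t': "t \<in> {m<..<b}" by auto
    from vel2[of t] t t' obtain K where K: "form_on_velocity atlas A c t K" "has_right_velocity G Exp U2 (1 * t + 0) K"
      by auto
    have "has_right_velocity G Exp W t (1 *\<^sub>R K)"
      by (rule has_right_velocity_affine[OF group_axioms g _ K(2) open_greaterThanLessThan t'])
        (use U2 in \<open>auto simp: W_def\<close>)
    then show ?thesis using K(1) by auto
  qed
  have "Y \<odot> X = Log Exp (W b)"
    using W2[of b] U2[of b] U1[of m] m by (simp add: gmul_def X Y g_def)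
  moreover have "W a = \<one>" using U1a m by (simp add: W_def)
  moreover have "negligible (N1 \<union> N2 \<union> {m})" using N1 N2 by auto
  ultimately show ?thesis
    unfolding has_lie_integral_def using carr ac vel
    by (intro exI[of _ W] conjI exI[of _ "N1 \<union> N2 \<union> {m}"]) auto
qed

theorem holonomy_of_closed_path:
  assumes fd: "finite_dimensional TYPE('g)" and form: "one_form atlas A"
    and hol: "holonomy_rep G Exp atlas A x0 \<rho>"
    and c0: "c 0 = x0" and T: "T > 0" and c: "ac_path atlas c 0 T"
    and X: "has_lie_integral G Exp atlas A c 0 T X"
    and clo: "closing_family G Exp atlas A x0 c b Q"
  shows "\<rho> (loop_class (closed_up c b T)) = Exp (Q T \<odot> X)"
proof -
  have b: "ac_path atlas (b T) 0 1" "b T 0 = c T" "b T 1 = x0" "has_lie_integral G Exp atlas A (b T) 0 1 (Q T)"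
    using clo T unfolding closing_family_def pathstart_def pathfinish_def by auto
  define p where "p = closed_up c b T"
  have p1: "p t = c ((2 * T) * t + 0)" if "t \<in> {0..1/2}" for t
    using that by (simp add: p_def closed_up_def joinpaths_def mult_ac)
  \<comment> \<open>at \<open>t = 1/2\<close> both descriptions apply, since \<open>b T\<close> starts at \<open>c T\<close>\<close>
  have p2: "p t = b T (2 * t + (- 1))" if "t \<in> {1/2..1}" for t
  proof (cases "t = 1/2")
    case True
    show ?thesis unfolding True using b(2) by (simp add: p_def closed_up_def joinpaths_def)
  next
    case False then show ?thesis using that by (simp add: p_def closed_up_def joinpaths_def)
  qed
  have "ac_path atlas (\<lambda>t. c ((2 * T) * t + 0)) 0 (1/2)" using c T by (intro ac_path_affine) auto
  then have ac1: "ac_path atlas p 0 (1/2)" using ac_path_cong[of 0 "1/2" p _ atlas, OF p1] by simp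
  have "ac_path atlas (\<lambda>t. b T (2 * t + (- 1))) (1/2) 1" using b(1) by (intro ac_path_affine) auto
  then have ac2: "ac_path atlas p (1/2) 1" using ac_path_cong[of "1/2" 1 p _ atlas, OF p2] by simp
  have ac: "ac_path atlas p 0 1" by (rule ac_path_combine[OF ac1 ac2]) auto
  have "has_lie_integral G Exp atlas A p 0 (1/2) X"
    by (rule has_lie_integral_affine[OF form, of "2 * T" c _ 0]) (use T X p1 in auto)
  moreover have "has_lie_integral G Exp atlas A p (1/2) 1 (Q T)"
    by (rule has_lie_integral_affine[OF form, of 2 "b T" _ "- 1"]) (use b p2 in auto)
  ultimately have "has_lie_integral G Exp atlas A p 0 1 (Q T \<odot> X)"
    by (intro has_lie_integral_combine[OF fd form]) auto
  moreover have "based_loop x0 p"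
    using ac p1[of 0] p2[of 1] c0 b unfolding based_loop_def path_def ac_path_def pathstart_def pathfinish_def by simp
  ultimately show ?thesis using hol ac unfolding holonomy_rep_def p_def by blast
qed

text \<open>The topology of the type of \<open>G\<close> need not be Hausdorff outside of the carrier; convergence to an element
  of the carrier is the same as convergence in the chart.\<close>

lemma tendsto_Exp_iff:
  assumes x: "x \<in> carrier G"
  shows "((\<lambda>i. Exp (y i)) \<longlongrightarrow> x) F \<longleftrightarrow> (y \<longlongrightarrow> Log Exp x) F"
proof
  assume "((\<lambda>i. Exp (y i)) \<longlongrightarrow> x) F"
  moreover have "continuous_on (carrier G) (Log Exp)"
    using Exp_homeomorphism by (simp add: homeomorphism_def)
  ultimately have "((\<lambda>i. Log Exp (Exp (y i))) \<longlongrightarrow> Log Exp x) F"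
    using x by (intro continuous_on_tendsto_compose[of "carrier G" "Log Exp"]) auto
  then show "(y \<longlongrightarrow> Log Exp x) F" by simp
next
  assume "(y \<longlongrightarrow> Log Exp x) F"
  moreover have "continuous_on UNIV Exp"
    using Exp_homeomorphism by (simp add: homeomorphism_def)
  ultimately have "((\<lambda>i. Exp (y i)) \<longlongrightarrow> Exp (Log Exp x)) F"
    by (intro continuous_on_tendsto_compose[of UNIV Exp]) auto
  then show "((\<lambda>i. Exp (y i)) \<longlongrightarrow> x) F" using x by simp
qed

lemma tendsto_gmul:
  assumes "(f \<longlongrightarrow> X) F" "(g \<longlongrightarrow> Y) F"
  shows "((\<lambda>i. f i \<odot> g i) \<longlongrightarrow> X \<odot> Y) F"
  using isCont_tendsto_compose[OF continuous_gmul tendsto_Pair[OF assms]] by simp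

end

section \<open>Dilations and the Chacon--Fomenko integral\<close>

context graded_lie_algebra
begin

lemma decomposition_exists: "(\<forall>k\<in>{1..n}. layer_part V n x k \<in> V k) \<and> (\<Sum>k=1..n. layer_part V n x k) = x"
  unfolding layer_part_def by (rule someI_ex[OF layers_span])

lemma layer_part_eqI:
  assumes v: "\<And>k. k \<in> {1..n} \<Longrightarrow> v k \<in> V k" and "(\<Sum>k=1..n. v k) = x" and k: "k \<in> {1..n}"
  shows "layer_part V n x k = v k"
proof -
  have "\<forall>k\<in>{1..n}. layer_part V n x k - v k = 0"
  proof (rule layers_independent)
    show "\<forall>k\<in>{1..n}. layer_part V n x k - v k \<in> V k"
      using decomposition_exists[of x] v by (auto intro!: subspace_diff layer_subspace)
    show "(\<Sum>k=1..n. layer_part V n x k - v k) = 0"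
      using decomposition_exists[of x] assms(2) by (simp add: sum_subtractf)
  qed
  then show ?thesis using k by simp
qed

lemma layer_part_linear:
  assumes k: "k \<in> {1..n}"
  shows "linear (\<lambda>x. layer_part V n x k)"
proof (rule linearI)
  show "layer_part V n (x + y) k = layer_part V n x k + layer_part V n y k" for x y
    using decomposition_exists[of x] decomposition_exists[of y]
    by (intro layer_part_eqI k) (auto intro!: subspace_add layer_subspace simp: sum.distrib)
  show "layer_part V n (r *\<^sub>R x) k = r *\<^sub>R layer_part V n x k" for r x
    using decomposition_exists[of x]
    by (intro layer_part_eqI k) (auto intro!: subspace_scale layer_subspace simp flip: scaleR_sum_right)
qed

lemma dilation_linear: "linear (dilation V n r)"
  unfolding dilation_def
  by (intro linear_compose_sum ballI linear_compose_scale_right layer_part_linear)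

lemma dilation_layer:
  assumes k: "1 \<le> k" and x: "x \<in> V k"
  shows "dilation V n r x = r ^ k *\<^sub>R x"
proof (cases "k \<le> n")
  case True
  have "layer_part V n x j = (if j = k then x else 0)" if "j \<in> {1..n}" for j
    using x True k that subspace_0[OF layer_subspace] by (intro layer_part_eqI) auto
  then have "dilation V n r x = (\<Sum>j=1..n. if j = k then r ^ k *\<^sub>R x else 0)"
    unfolding dilation_def by (intro sum.cong) auto
  also have "\<dots> = r ^ k *\<^sub>R x" using True k by simp
  finally show ?thesis .
next
  case False
  then have "x = 0" using x layer_trivial by auto
  then show ?thesis by (simp add: linear_0[OF dilation_linear])
qed

text \<open>Holds on pairs of layer elements by \<open>bracket_layers\<close>, and extends by bilinearity. When \<open>i + j\<close> exceeds
  \<open>n\<close>, the bracket lies in a zero layer.\<close>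

lemma dilation_bracket: "dilation V n r (bracket x y) = bracket (dilation V n r x) (dilation V n r y)"
proof -
  let ?x = "layer_part V n x" and ?y = "layer_part V n y"
  have "bracket x y = bracket (\<Sum>i=1..n. ?x i) (\<Sum>j=1..n. ?y j)"
    using decomposition_exists by simp
  also have "\<dots> = (\<Sum>(i, j)\<in>{1..n} \<times> {1..n}. bracket (?x i) (?y j))"
    by (rule bilinear_sum[OF bracket_bilinear])
  finally have "dilation V n r (bracket x y) = (\<Sum>(i, j)\<in>{1..n} \<times> {1..n}. dilation V n r (bracket (?x i) (?y j)))"
    by (simp add: linear_sum[OF dilation_linear] case_prod_unfold)
  also have "\<dots> = (\<Sum>(i, j)\<in>{1..n} \<times> {1..n}. bracket (r ^ i *\<^sub>R ?x i) (r ^ j *\<^sub>R ?y j))"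
  proof (intro sum.cong refl, clarify)
    fix i j assume ij: "i \<in> {1..n}" "j \<in> {1..n}"
    then have "bracket (?x i) (?y j) \<in> V (i + j)"
      using decomposition_exists by (intro bracket_layers) auto
    then have "dilation V n r (bracket (?x i) (?y j)) = r ^ (i + j) *\<^sub>R bracket (?x i) (?y j)"
      using ij by (intro dilation_layer) auto
    then show "dilation V n r (bracket (?x i) (?y j)) = bracket (r ^ i *\<^sub>R ?x i) (r ^ j *\<^sub>R ?y j)"
      by (simp add: bilinear_lmul[OF bracket_bilinear] bilinear_rmul[OF bracket_bilinear] power_add mult.commute)
  qed
  also have "\<dots> = bracket (dilation V n r x) (dilation V n r y)"
    unfolding dilation_def by (rule bilinear_sum[OF bracket_bilinear, symmetric])
  finally show ?thesis .
qed

lemma dilation_bounded_linear: "bounded_linear (dilation V n r)"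
  by (rule finite_dimensional_linear_bounded[OF finite_dim dilation_linear])

lemma dilation_bounded_tendsto_zero:
  assumes r: "(r \<longlongrightarrow> 0) F" and x: "\<forall>\<^sub>F i in F. norm (x i) \<le> B"
  shows "((\<lambda>i. dilation V n (r i) (x i)) \<longlongrightarrow> 0) F"
  unfolding dilation_def
proof (rule tendsto_null_sum)
  fix k assume k: "k \<in> {1..n}"
  interpret P: bounded_linear "\<lambda>x. layer_part V n x k"
    by (rule finite_dimensional_linear_bounded[OF finite_dim layer_part_linear[OF k]])
  obtain K where K: "K > 0" "\<And>x. norm (layer_part V n x k) \<le> norm x * K" using P.pos_bounded by blast
  have "((\<lambda>i. \<bar>r i\<bar> ^ k * (B * K)) \<longlongrightarrow> \<bar>0\<bar> ^ k * (B * K)) F"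
    by (intro tendsto_intros r)
  then have "((\<lambda>i. \<bar>r i\<bar> ^ k * (B * K)) \<longlongrightarrow> 0) F" using k by (simp add: power_0_left)
  then show "((\<lambda>i. r i ^ k *\<^sub>R layer_part V n (x i) k) \<longlongrightarrow> 0) F"
  proof (rule Lim_null_comparison[rotated])
    show "\<forall>\<^sub>F i in F. norm (r i ^ k *\<^sub>R layer_part V n (x i) k) \<le> \<bar>r i\<bar> ^ k * (B * K)"
      using x
    proof eventually_elim
      case (elim i)
      have "norm (layer_part V n (x i) k) \<le> B * K"
        using K(2)[of "x i"] mult_right_mono[OF elim, of K] K(1) by linarith
      then show ?case by (simp add: power_abs mult_left_mono)
    qed
  qed
qed

end

text \<open>The recursion uses nothing but linear combinations and brackets.\<close>

lemma lie_component_hom: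
  assumes lin: "linear \<phi>" and hom: "\<And>X Y. \<phi> (bracket X Y) = bracket (\<phi> X) (\<phi> Y)"
  shows "lie_component bracket (\<lambda>j. \<phi> (T j)) k = \<phi> (lie_component bracket T k)"
proof (induction k rule: less_induct)
  case (less k)
  show ?case
  proof (cases k)
    case 0 then show ?thesis by (simp add: linear_0[OF lin])
  next
    case (Suc k')
    have IH: "lie_component bracket (\<lambda>j. \<phi> (T j)) m = \<phi> (lie_component bracket T m)" if "m \<le> k'" for m
      using less that Suc by simp
    have fold: "foldr (\<lambda>m Y. bracket (lie_component bracket (\<lambda>j. \<phi> (T j)) m) Y) ms (\<phi> Y)
        = \<phi> (foldr (\<lambda>m Y. bracket (lie_component bracket T m) Y) ms Y)" if "\<forall>m\<in>set ms. m \<le> k'" for ms Y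
      using that by (induction ms) (simp_all add: IH hom)
    show ?thesis
      unfolding Suc lie_component.simps(2) linear_scale[OF lin] linear_add[OF lin] linear_sum[OF lin] hom
      by (intro arg_cong2[of _ _ _ _ scaleR] arg_cong2[of _ _ _ _ "(+)"] refl sum.cong
          arg_cong2[of _ _ _ _ bracket] IH fold)
        (auto dest: member_le_sum_list)
  qed
qed

lemma tendsto_lie_component:
  assumes bb: "bounded_bilinear bracket" and T: "\<And>j. ((\<lambda>i. T i j) \<longlongrightarrow> T' j) F"
  shows "((\<lambda>i. lie_component bracket (T i) k) \<longlongrightarrow> lie_component bracket T' k) F"
proof (induction k rule: less_induct)
  case (less k)
  show ?case
  proof (cases k)
    case 0 then show ?thesis by simp
  next
    case (Suc k')
    have IH: "((\<lambda>i. lie_component bracket (T i) m) \<longlongrightarrow> lie_component bracket T' m) F" if "m \<le> k'" for m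
      using less that Suc by simp
    have fold: "((\<lambda>i. foldr (\<lambda>m Y. bracket (lie_component bracket (T i) m) Y) ms (T i j))
        \<longlongrightarrow> foldr (\<lambda>m Y. bracket (lie_component bracket T' m) Y) ms (T' j)) F" if "\<forall>m\<in>set ms. m \<le> k'" for ms j
      using that by (induction ms) (auto intro!: T bounded_bilinear.tendsto[OF bb] IH)
    show ?thesis
      unfolding Suc lie_component.simps(2)
      by (intro tendsto_scaleR tendsto_const tendsto_add tendsto_sum bounded_bilinear.tendsto[OF bb] IH fold T)
        (auto dest: member_le_sum_list)
  qed
qed

lemma continuous_on_iterated_integral:
  assumes "\<And>e. continuous_on {a..b} (\<lambda>u. representation E (\<gamma> u) e)"
    and "\<And>e. controls (w e) (\<lambda>u. representation E (\<gamma> u) e) a b"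
  shows "continuous_on {a..b} (iterated_integral E \<gamma> a q)"
proof (induction q)
  case Nil then show ?case by simp
next
  case (Cons e q)
  then show ?case using continuous_on_RS_integral[OF assms(2) Cons assms(1)[of e]] by simp
qed

text \<open>Induction on the word: the integrand of the next integral is the previous iterated integral as a
  function of its end point, so the induction needs uniform convergence in the end point.\<close>

lemma uniform_limit_iterated_integral:
  assumes lim: "\<And>e. uniform_limit {a..b} (\<lambda>i u. representation E (\<gamma> i u) e) (\<lambda>u. representation E (\<gamma>' u) e) F"
    and cont: "\<And>e. continuous_on {a..b} (\<lambda>u. representation E (\<gamma>' u) e)"
    and ctrl: "\<And>e. controls (w e) (\<lambda>u. representation E (\<gamma>' u) e) a b"
    and unif: "\<forall>\<^sub>F i in F. \<forall>e. continuous_on {a..b} (\<lambda>u. representation E (\<gamma> i u) e) \<and>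
      (\<exists>v. controls v (\<lambda>u. representation E (\<gamma> i u) e) a b \<and> v b - v a \<le> C)"
  shows "uniform_limit {a..b} (\<lambda>i. iterated_integral E (\<gamma> i) a q) (iterated_integral E \<gamma>' a q) F"
proof (induction q)
  case Nil then show ?case by (simp add: uniform_limit_const)
next
  case (Cons e q)
  have "uniform_limit {a..b} (\<lambda>i t. RS_integral (iterated_integral E (\<gamma> i) a q) (\<lambda>u. representation E (\<gamma> i u) e) a t)
      (\<lambda>t. RS_integral (iterated_integral E \<gamma>' a q) (\<lambda>u. representation E (\<gamma>' u) e) a t) F"
  proof (rule uniform_limit_RS_integral[OF Cons lim _ _ ctrl])
    show "continuous_on {a..b} (iterated_integral E \<gamma>' a q)"
      by (rule continuous_on_iterated_integral[OF cont ctrl])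
    show "\<forall>\<^sub>F i in F. continuous_on {a..b} (iterated_integral E (\<gamma> i) a q)"
      using unif
    proof eventually_elim
      case (elim i)
      then obtain v where "\<And>e. controls (v e) (\<lambda>u. representation E (\<gamma> i u) e) a b" by metis
      then show ?case using elim by (intro continuous_on_iterated_integral) auto
    qed
    show "\<forall>\<^sub>F i in F. \<exists>v. controls v (\<lambda>u. representation E (\<gamma> i u) e) a b \<and> v b - v a \<le> C"
      using unif by eventually_elim blast
  qed
  then show ?case by simp
qed

text \<open>Each letter contributes one integration against an integrator divided by \<open>T\<close>. The initial value \<open>l 0\<close>
  and the change of time have no effect on Riemann--Stieltjes integrals.\<close>

lemma iterated_integral_rescaled:
  assumes T: "T > 0" and l: "l ` {0..T} \<subseteq> span E" and E: "independent E"
    and cont: "\<And>e. continuous_on {0..T} (\<lambda>u. representation E (l u) e)"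
    and ctrl: "\<And>e. controls (w e) (\<lambda>u. representation E (l u) e) 0 T"
    and u: "u \<in> {0..1}"
  shows "iterated_integral E (rescaled l T) 0 q u = (1 / T) ^ length q * iterated_integral E l 0 q (T * u)"
  using u
proof (induction q arbitrary: u)
  case Nil then show ?case by simp
next
  case (Cons e q)
  define y where "y = iterated_integral E l 0 (e # q) (T * u)"
  have Tu: "0 \<le> T * u" "T * u \<le> T" using Cons.prems T by (auto simp: mult_left_le)
  have "has_RS_integral (iterated_integral E l 0 q) (\<lambda>u. representation E (l u) e) 0 (T * u) y"
    unfolding y_def iterated_integral.simps
    using continuous_on_subset[OF continuous_on_iterated_integral[OF cont ctrl], of "{0..T * u}"] Tu
    by (intro RS_integral_exists[OF controls_subinterval[OF ctrl]]) auto
  then have "has_RS_integral (\<lambda>x. (1 / T) ^ length q * iterated_integral E l 0 q (T * x))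
      (\<lambda>x. 1 / T * representation E (l (T * x)) e + - (1 / T * representation E (l 0) e)) 0 u ((1 / T) ^ length q * (1 / T) * y)"
    using has_RS_integral_scale[of "iterated_integral E l 0 q" "\<lambda>u. representation E (l u) e" T 0 u y
        "(1 / T) ^ length q" "1 / T" "- (1 / T * representation E (l 0) e)", OF _ T] by simp
  also have "?this \<longleftrightarrow> has_RS_integral (iterated_integral E (rescaled l T) 0 q)
      (\<lambda>x. representation E (rescaled l T x) e) 0 u ((1 / T) ^ length q * (1 / T) * y)"
  proof (rule has_RS_integral_cong)
    fix x assume x: "x \<in> {0..u}"
    show "(1 / T) ^ length q * iterated_integral E l 0 q (T * x) = iterated_integral E (rescaled l T) 0 q x"
      using Cons.IH[of x] x Cons.prems by simp
    have "T * x \<in> {0..T}" using x Cons.prems T by (auto simp: mult_left_le)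
    then have "l (T * x) \<in> span E" "l 0 \<in> span E" using l T by auto
    then show "1 / T * representation E (l (T * x)) e + - (1 / T * representation E (l 0) e) = representation E (rescaled l T x) e"
      using E by (simp add: rescaled_def representation_scale representation_diff span_diff right_diff_distrib)
  qed
  finally show ?case by (simp add: RS_integral_eqI y_def)
qed

context graded_lie_algebra
begin

lemma first_layer_basis:
  "finite (first_layer_basis V)" "independent (first_layer_basis V)" "span (first_layer_basis V) = V 1"
proof -
  have "\<exists>E. independent E \<and> span E = V 1"
  proof -
    obtain E where "E \<subseteq> V 1" "independent E" "V 1 \<subseteq> span E" using basis_exists[of "V 1"] by metis
    then show ?thesis using span_minimal[OF _ layer_subspace[of 1]] by (metis order_refl subset_antisym)
  qed
  from someI_ex[OF this] show E: "independent (first_layer_basis V)" "span (first_layer_basis V) = V 1"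
    unfolding first_layer_basis_def by auto
  obtain B :: "'g set" where "finite B" "span B = UNIV" using finite_dim by blast
  then show "finite (first_layer_basis V)" using independent_span_bound[of B] E(1) by auto
qed

text \<open>One constant serves all coordinates, so that the variation bounds below do not depend on the letter.\<close>

lemma first_layer_coordinate_bound:
  "\<exists>C>0. \<forall>x\<in>V 1. \<forall>y\<in>V 1. \<forall>e.
      \<bar>representation (first_layer_basis V) x e - representation (first_layer_basis V) y e\<bar> \<le> C * norm (x - y)"
proof -
  let ?E = "first_layer_basis V"
  obtain C where "C > 0" "\<And>x e. x \<in> span ?E \<Longrightarrow> \<bar>representation ?E x e\<bar> \<le> C * norm x"
    using bounded_coordinates[OF first_layer_basis(1,2)] by blast
  then show ?thesis
    by (intro exI[of _ C]) (metis first_layer_basis(2,3) representation_diff span_diff)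
qed

lemma coordinate_continuous:
  assumes "continuous_on S \<gamma>" "\<gamma> ` S \<subseteq> V 1"
  shows "continuous_on S (\<lambda>u. representation (first_layer_basis V) (\<gamma> u) e)"
proof -
  obtain C where C: "C > 0" "\<And>x y e. \<lbrakk>x \<in> V 1; y \<in> V 1\<rbrakk> \<Longrightarrow>
      \<bar>representation (first_layer_basis V) x e - representation (first_layer_basis V) y e\<bar> \<le> C * norm (x - y)"
    using first_layer_coordinate_bound by meson
  have "C-lipschitz_on (V 1) (\<lambda>x. representation (first_layer_basis V) x e)"
    using C by (intro lipschitz_onI) (auto simp: dist_norm)
  from continuous_on_compose2[OF lipschitz_on_continuous_on[OF this] assms]
  show ?thesis .
qed

lemma coordinate_controls:
  "\<exists>C>0. \<forall>W \<gamma> a b e. controls W \<gamma> a b \<and> \<gamma> ` {a..b} \<subseteq> V 1 \<longrightarrow>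
      controls (\<lambda>t. C * W t) (\<lambda>u. representation (first_layer_basis V) (\<gamma> u) e) a b"
proof -
  obtain C where C: "C > 0" "\<And>x y e. \<lbrakk>x \<in> V 1; y \<in> V 1\<rbrakk> \<Longrightarrow>
      \<bar>representation (first_layer_basis V) x e - representation (first_layer_basis V) y e\<bar> \<le> C * norm (x - y)"
    using first_layer_coordinate_bound by meson
  have "controls (\<lambda>t. C * W t) (\<lambda>u. representation (first_layer_basis V) (\<gamma> u) e) a b"
    if W: "controls W \<gamma> a b" and \<gamma>: "\<gamma> ` {a..b} \<subseteq> V 1" for W \<gamma> a b e
    unfolding controls_def
  proof (intro allI impI, elim conjE)
    fix s t assume st: "a \<le> s" "s \<le> t" "t \<le> b"
    then have "\<gamma> s \<in> V 1" "\<gamma> t \<in> V 1" using \<gamma> by auto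
    then have "\<bar>representation (first_layer_basis V) (\<gamma> t) e - representation (first_layer_basis V) (\<gamma> s) e\<bar> \<le> C * norm (\<gamma> t - \<gamma> s)"
      by (intro C(2))
    also have "\<dots> \<le> C * (W t - W s)" using W st C(1) unfolding controls_def by (intro mult_left_mono) auto
    finally show "norm (representation (first_layer_basis V) (\<gamma> t) e - representation (first_layer_basis V) (\<gamma> s) e) \<le> C * W t - C * W s"
      by (simp add: right_diff_distrib)
  qed
  then show ?thesis using C(1) by (intro exI[of _ C]) simp
qed

lemma left_bracket_in_layer:
  assumes "set w \<subseteq> V 1" "w \<noteq> []"
  shows "left_bracket bracket w \<in> V (length w)"
proof -
  have fold: "foldl bracket x vs \<in> V (i + length vs)" if "1 \<le> i" "x \<in> V i" "set vs \<subseteq> V 1" for x i vs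
    using that
  proof (induction vs arbitrary: x i)
    case (Cons v vs)
    then have "bracket x v \<in> V (i + 1)" by (intro bracket_layers) auto
    from Cons.IH[OF _ this] Cons.prems show ?case by simp
  qed simp
  obtain v vs where "w = v # vs" using assms(2) by (cases w) auto
  then show ?thesis using fold[of 1 v vs] assms(1) by simp
qed

text \<open>The moment of index \<open>j\<close> lies in the layer \<open>V (j + 1)\<close> and is a sum over words of length \<open>j + 1\<close>; hence
  the scaling of the iterated integrals is the action of the dilation, which then passes through the recursion.\<close>

lemma chacon_fomenko_rescaled:
  assumes T: "T > 0" and l: "l ` {0..T} \<subseteq> V 1" and cont: "continuous_on {0..T} l" and bv: "bounded_variation l 0 T"
  shows "chacon_fomenko bracket V n (rescaled l T) 0 1 = dilation V n (1 / T) (chacon_fomenko bracket V n l 0 T)"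
proof -
  let ?E = "first_layer_basis V" and ?\<delta> = "dilation V n (1 / T)"
  obtain C where C: "C > 0"
    "\<And>W \<gamma> a b e. \<lbrakk>controls W \<gamma> a b; \<gamma> ` {a..b} \<subseteq> V 1\<rbrakk> \<Longrightarrow>
      controls (\<lambda>t. C * W t) (\<lambda>u. representation ?E (\<gamma> u) e) a b" using coordinate_controls by meson
  note ctrl = C(2)[OF bounded_variation_controls[OF bv] l]
  have moment: "lie_moment bracket V (rescaled l T) 0 1 j = ?\<delta> (lie_moment bracket V l 0 T j)" for j
  proof -
    have "iterated_integral ?E (rescaled l T) 0 w 1 *\<^sub>R left_bracket bracket w
        = ?\<delta> (iterated_integral ?E l 0 w T *\<^sub>R left_bracket bracket w)"
      if w: "w \<in> {w. set w \<subseteq> ?E \<and> length w = Suc j}" for w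
    proof -
      have "?E \<subseteq> V 1" using span_superset[of ?E] first_layer_basis(3) by simp
      then have "left_bracket bracket w \<in> V (length w)" using w by (intro left_bracket_in_layer) auto
      then have "?\<delta> (left_bracket bracket w) = (1 / T) ^ length w *\<^sub>R left_bracket bracket w"
        using w by (intro dilation_layer) auto
      moreover have "iterated_integral ?E (rescaled l T) 0 w 1 = (1 / T) ^ length w * iterated_integral ?E l 0 w (T * 1)"
        using l first_layer_basis by (intro iterated_integral_rescaled[OF T _ _ coordinate_continuous[OF cont l] ctrl]) auto
      ultimately show ?thesis by (simp add: linear_scale[OF dilation_linear])
    qed
    then show ?thesis unfolding lie_moment_def tensor_bracket_def linear_sum[OF dilation_linear]
      by (intro sum.cong refl)
  qed
  have moments: "lie_moment bracket V (rescaled l T) 0 1 = (\<lambda>j. ?\<delta> (lie_moment bracket V l 0 T j))"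
    by (rule ext) (rule moment)
  show ?thesis
    unfolding chacon_fomenko_def linear_sum[OF dilation_linear] moments
    by (intro sum.cong refl lie_component_hom dilation_linear dilation_bracket)
qed

lemma tendsto_chacon_fomenko:
  assumes \<gamma>: "\<forall>\<^sub>F i in F. continuous_on {a..b} (\<gamma> i) \<and> \<gamma> i ` {a..b} \<subseteq> V 1 \<and> variation (\<gamma> i) a b \<le> ennreal K"
    and \<gamma>': "continuous_on {a..b} \<gamma>'" "\<gamma>' ` {a..b} \<subseteq> V 1" "bounded_variation \<gamma>' a b"
    and lim: "uniform_limit {a..b} \<gamma> \<gamma>' F" and ab: "a \<le> b"
  shows "((\<lambda>i. chacon_fomenko bracket V n (\<gamma> i) a b) \<longlongrightarrow> chacon_fomenko bracket V n \<gamma>' a b) F"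
proof -
  let ?E = "first_layer_basis V"
  obtain C where C: "C > 0" "\<And>x y e. \<lbrakk>x \<in> V 1; y \<in> V 1\<rbrakk> \<Longrightarrow>
      \<bar>representation ?E x e - representation ?E y e\<bar> \<le> C * norm (x - y)"
    using first_layer_coordinate_bound by meson
  obtain C' where C': "C' > 0"
    "\<And>W \<gamma> a b e. \<lbrakk>controls W \<gamma> a b; \<gamma> ` {a..b} \<subseteq> V 1\<rbrakk> \<Longrightarrow>
      controls (\<lambda>t. C' * W t) (\<lambda>u. representation ?E (\<gamma> u) e) a b" using coordinate_controls by meson
  have iter: "uniform_limit {a..b} (\<lambda>i. iterated_integral ?E (\<gamma> i) a q) (iterated_integral ?E \<gamma>' a q) F" for q
  proof (rule uniform_limit_iterated_integral)
    fix e
    show "continuous_on {a..b} (\<lambda>u. representation ?E (\<gamma>' u) e)" by (rule coordinate_continuous[OF \<gamma>'(1,2)])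
    show "controls (\<lambda>t. C' * enn2real (variation \<gamma>' a t)) (\<lambda>u. representation ?E (\<gamma>' u) e) a b"
      by (rule C'(2)[OF bounded_variation_controls[OF \<gamma>'(3)] \<gamma>'(2)])
    show "uniform_limit {a..b} (\<lambda>i u. representation ?E (\<gamma> i u) e) (\<lambda>u. representation ?E (\<gamma>' u) e) F"
    proof (rule uniform_limitI)
      fix r :: real assume "r > 0"
      then have "r / C > 0" using C(1) by simp
      from uniform_limitD[OF lim this] \<gamma>
      show "\<forall>\<^sub>F i in F. \<forall>u\<in>{a..b}. dist (representation ?E (\<gamma> i u) e) (representation ?E (\<gamma>' u) e) < r"
      proof eventually_elim
        case (elim i)
        show ?case
        proof
          fix u assume u: "u \<in> {a..b}"
          have "\<bar>representation ?E (\<gamma> i u) e - representation ?E (\<gamma>' u) e\<bar> \<le> C * norm (\<gamma> i u - \<gamma>' u)"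
            using elim(2) \<gamma>'(2) u by (intro C(2)) auto
          also have "\<dots> < r" using elim(1) u C(1) by (simp add: dist_norm field_simps)
          finally show "dist (representation ?E (\<gamma> i u) e) (representation ?E (\<gamma>' u) e) < r"
            by (simp add: dist_real_def)
        qed
      qed
    qed
  next
    show "\<forall>\<^sub>F i in F. \<forall>e. continuous_on {a..b} (\<lambda>u. representation ?E (\<gamma> i u) e) \<and>
        (\<exists>v. controls v (\<lambda>u. representation ?E (\<gamma> i u) e) a b \<and> v b - v a \<le> C' * max 0 K)"
      using \<gamma>
    proof eventually_elim
      case (elim i)
      let ?W = "\<lambda>t. enn2real (variation (\<gamma> i) a t)"
      have bv: "bounded_variation (\<gamma> i) a b"
        using elim unfolding bounded_variation_def by (metis ennreal_less_top infinity_ennreal_def order_le_less_trans)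
      have "?W b \<le> enn2real (ennreal K)" using elim by (intro enn2real_mono) auto
      then have "?W b - ?W a \<le> max 0 K" by (smt (verit) enn2real_nonneg enn2real_ennreal ennreal_neg enn2real_0)
      then have "C' * ?W b - C' * ?W a \<le> C' * max 0 K"
        using C'(1) by (metis less_imp_le mult_left_mono right_diff_distrib)
      moreover have "controls (\<lambda>t. C' * ?W t) (\<lambda>u. representation ?E (\<gamma> i u) e) a b" for e
        using elim by (intro C'(2) bounded_variation_controls bv) auto
      moreover have "continuous_on {a..b} (\<lambda>u. representation ?E (\<gamma> i u) e)" for e
        using elim by (intro coordinate_continuous) auto
      ultimately show ?case by blast
    qed
  qed
  have "((\<lambda>i. iterated_integral ?E (\<gamma> i) a q b) \<longlongrightarrow> iterated_integral ?E \<gamma>' a q b) F" for q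
    using tendsto_uniform_limitI[OF iter] ab by auto
  then have "((\<lambda>i. lie_moment bracket V (\<gamma> i) a b j) \<longlongrightarrow> lie_moment bracket V \<gamma>' a b j) F" for j
    unfolding lie_moment_def tensor_bracket_def by (intro tendsto_sum tendsto_scaleR tendsto_const)
  then show ?thesis unfolding chacon_fomenko_def
    by (intro tendsto_sum tendsto_lie_component finite_dimensional_bilinear_bounded[OF finite_dim bracket_bilinear])
qed

lemma tendsto_dilated_chacon_fomenko:
  assumes l: "continuous_on {0..} l" "l ` {0..} \<subseteq> V 1" "\<And>T. T > 0 \<Longrightarrow> bounded_variation l 0 T"
    and \<tau>: "\<forall>\<^sub>F i in F. \<tau> i > 0"
    and l': "continuous_on {0..1} l'" "l' ` {0..1} \<subseteq> V 1" "bounded_variation l' 0 1"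
    and lim: "uniform_limit {0..1} (\<lambda>i. rescaled l (\<tau> i)) l' F"
    and var: "\<forall>\<^sub>F i in F. variation (rescaled l (\<tau> i)) 0 1 \<le> ennreal K"
  shows "((\<lambda>i. dilation V n (1 / \<tau> i) (chacon_fomenko bracket V n l 0 (\<tau> i))) \<longlongrightarrow> chacon_fomenko bracket V n l' 0 1) F"
proof (rule Lim_transform_eventually)
  show "((\<lambda>i. chacon_fomenko bracket V n (rescaled l (\<tau> i)) 0 1) \<longlongrightarrow> chacon_fomenko bracket V n l' 0 1) F"
  proof (rule tendsto_chacon_fomenko[OF _ l' lim])
    show "\<forall>\<^sub>F i in F. continuous_on {0..1} (rescaled l (\<tau> i)) \<and> rescaled l (\<tau> i) ` {0..1} \<subseteq> V 1 \<and>
       variation (rescaled l (\<tau> i)) 0 1 \<le> ennreal K"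
      using \<tau> var
    proof eventually_elim
      case (elim i)
      have "continuous_on {0..1} (\<lambda>u. l (\<tau> i * u))"
        by (rule continuous_on_compose2[OF l(1)]) (use elim in \<open>auto intro!: continuous_intros\<close>)
      then have "continuous_on {0..1} (rescaled l (\<tau> i))"
        unfolding rescaled_def by (intro continuous_intros)
      moreover have "rescaled l (\<tau> i) u \<in> V 1" if "u \<in> {0..1}" for u
        using l(2) that elim unfolding rescaled_def
        by (intro subspace_scale subspace_diff layer_subspace) auto
      ultimately show ?case using elim by auto
    qed
  qed simp
  show "\<forall>\<^sub>F i in F. chacon_fomenko bracket V n (rescaled l (\<tau> i)) 0 1 =
      dilation V n (1 / \<tau> i) (chacon_fomenko bracket V n l 0 (\<tau> i))"
    using \<tau>
  proof eventually_elim
    case (elim i)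
    then show ?case using l continuous_on_subset[OF l(1), of "{0..\<tau> i}"]
      by (intro chacon_fomenko_rescaled) (auto intro: subset_trans[OF image_mono])
  qed
qed

end

section \<open>Asymptotics of the holonomy\<close>

locale graded_lie_group =
  graded_lie_algebra bracket V n + exponential_lie_group bracket G Exp
  for bracket :: "'g::real_normed_vector \<Rightarrow> 'g \<Rightarrow> 'g" and V :: "nat \<Rightarrow> 'g set" and n :: nat
    and G :: "('h::topological_space, 'b) monoid_scheme" and Exp :: "'g \<Rightarrow> 'h"
begin

lemma dilation_gmul: "dilation V n r (X \<odot> Y) = dilation V n r X \<odot> dilation V n r Y"
  by (rule lie_endomorphism_integrates[OF dilation_bounded_linear dilation_bracket])

text \<open>The filter \<open>F\<close> is \<open>sequentially\<close> for the statements along \<open>T\<^sub>j\<close> and \<open>at_top\<close>, with \<open>\<tau>\<close> the identity, for the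
  full limit. The limit does not involve \<open>b\<close>, which gives the independence of the closing paths.\<close>

theorem dilated_holonomy_limit:
  assumes form: "one_form atlas A" and hol: "holonomy_rep G Exp atlas A x0 \<rho>"
    and c: "c 0 = x0" "\<forall>T>0. ac_path atlas c 0 T"
    and l: "continuous_on {0..} l" "l ` {0..} \<subseteq> V 1" "\<forall>T>0. bounded_variation l 0 T"
    and H: "\<forall>T>0. has_lie_integral G Exp atlas A c 0 T (chacon_fomenko bracket V n l 0 T)"
    and clo: "closing_family G Exp atlas A x0 c b Q"
    and \<tau>: "filterlim \<tau> at_top F"
    and l': "continuous_on {0..1} l'" "l' ` {0..1} \<subseteq> V 1" "bounded_variation l' 0 1"
    and lim: "uniform_limit {0..1} (\<lambda>i. rescaled l (\<tau> i)) l' F"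
    and var: "\<forall>\<^sub>F i in F. variation (rescaled l (\<tau> i)) 0 1 \<le> ennreal K"
  shows "((\<lambda>i. dilation V n (1 / \<tau> i) (Log Exp (\<rho> (loop_class (closed_up c b (\<tau> i))))))
      \<longlongrightarrow> chacon_fomenko bracket V n l' 0 1) F"
proof (rule Lim_transform_eventually)
  let ?H = "chacon_fomenko bracket V n l 0"
  have pos: "\<forall>\<^sub>F i in F. \<tau> i > 0" using \<tau> by (simp add: filterlim_at_top_dense)
  obtain B where B: "\<And>T. T > 0 \<Longrightarrow> norm (Q T) \<le> B"
    using clo unfolding closing_family_def bounded_iff by auto
  have "((\<lambda>i. 1 / \<tau> i) \<longlongrightarrow> 0) F"
    using tendsto_inverse_0_at_top[OF \<tau>] by (simp add: divide_inverse)
  moreover have "\<forall>\<^sub>F i in F. norm (Q (\<tau> i)) \<le> B" using pos by eventually_elim (rule B)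
  ultimately have "((\<lambda>i. dilation V n (1 / \<tau> i) (Q (\<tau> i))) \<longlongrightarrow> 0) F"
    by (rule dilation_bounded_tendsto_zero)
  from tendsto_gmul[OF this tendsto_dilated_chacon_fomenko[OF l(1,2) l(3)[rule_format] pos l' lim var]]
  show "((\<lambda>i. dilation V n (1 / \<tau> i) (Q (\<tau> i)) \<odot> dilation V n (1 / \<tau> i) (?H (\<tau> i)))
      \<longlongrightarrow> chacon_fomenko bracket V n l' 0 1) F"
    by simp
  show "\<forall>\<^sub>F i in F. dilation V n (1 / \<tau> i) (Q (\<tau> i)) \<odot> dilation V n (1 / \<tau> i) (?H (\<tau> i))
      = dilation V n (1 / \<tau> i) (Log Exp (\<rho> (loop_class (closed_up c b (\<tau> i)))))"
    using pos
  proof eventually_elim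
    case (elim i)
    then show ?case
      using holonomy_of_closed_path[OF finite_dim form hol c(1) elim c(2)[rule_format, OF elim] H[rule_format, OF elim] clo]
      by (simp only: Log_Exp dilation_gmul)
  qed
qed

end

lemma tendsto_iff_of_common_limit:
  fixes L :: "'a::t2_space"
  assumes "F \<noteq> bot" "(f \<longlongrightarrow> L) F" "(g \<longlongrightarrow> L) F"
  shows "(f \<longlongrightarrow> X) F \<longleftrightarrow> (g \<longlongrightarrow> X) F"
  using assms tendsto_unique by blast

theorem theorem5p5:
  fixes atlas :: "('m::{t2_space, second_countable_topology}, 'e::real_normed_vector) chart set"
    and x0 :: 'm
    and bracket :: "'g::real_normed_vector \<Rightarrow> 'g \<Rightarrow> 'g"
    and V :: "nat \<Rightarrow> 'g set" and n :: nat
    and G :: "('h::topological_space, 'z) monoid_scheme" and Exp :: "'g \<Rightarrow> 'h"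
    and \<rho> :: "(real \<Rightarrow> 'm) set \<Rightarrow> 'h"
    and A :: "('m, 'e, 'g) form"
    and c :: "real \<Rightarrow> 'm" and l :: "real \<Rightarrow> 'g"
    and b :: "real \<Rightarrow> real \<Rightarrow> 'm" and Q :: "real \<Rightarrow> 'g"
  defines "H \<equiv> chacon_fomenko bracket V n"
    and "hol \<equiv> (\<lambda>b T. \<rho> (loop_class (closed_up c b T)))"
    and "\<delta> \<equiv> dilation V n"
    and "\<delta>G \<equiv> group_dilation Exp V n"
  assumes "smooth_manifold atlas" and "connected (UNIV :: 'm set)"
    and "graded_lie_algebra bracket V n"
    and "exponential_lie_group bracket G Exp"
    and "\<rho> \<in> hom (fundamental_group x0) G"
    and "one_form atlas A" and "flat_form bracket atlas A"
    and "holonomy_rep G Exp atlas A x0 \<rho>"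
    and "c 0 = x0" and "\<And>T. T > 0 \<Longrightarrow> ac_path atlas c 0 T"
    and "continuous_on {0..} l" and "l ` {0..} \<subseteq> V 1"
    and "\<And>T. T > 0 \<Longrightarrow> bounded_variation l 0 T"
    and "\<And>T. T > 0 \<Longrightarrow> has_lie_integral G Exp atlas A c 0 T (H l 0 T)"
    and "closing_family G Exp atlas A x0 c b Q"
  shows
    "(\<forall>(\<tau> :: nat \<Rightarrow> real) (l' :: real \<Rightarrow> 'g).
        (\<forall>j. \<tau> j > 0) \<and> filterlim \<tau> at_top sequentially \<and>
        continuous_on {0..1} l' \<and> l' ` {0..1} \<subseteq> V 1 \<and> bounded_variation l' 0 1 \<and>
        uniform_limit {0..1} (\<lambda>j. rescaled l (\<tau> j)) l' sequentially \<and>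
        (SUP j. variation (rescaled l (\<tau> j)) 0 1) < \<infinity> \<longrightarrow>
        (\<lambda>j. \<delta> (1 / \<tau> j) (Log Exp (hol b (\<tau> j)))) \<longlonglongrightarrow> H l' 0 1 \<and>
        (\<lambda>j. \<delta>G (1 / \<tau> j) (hol b (\<tau> j))) \<longlonglongrightarrow> Exp (H l' 0 1) \<and>
        (\<forall>b' Q'. closing_family G Exp atlas A x0 c b' Q' \<longrightarrow>
          (\<forall>X. (\<lambda>j. \<delta> (1 / \<tau> j) (Log Exp (hol b' (\<tau> j)))) \<longlonglongrightarrow> X \<longleftrightarrow>
               (\<lambda>j. \<delta> (1 / \<tau> j) (Log Exp (hol b (\<tau> j)))) \<longlonglongrightarrow> X) \<and>
          (\<forall>x\<in>carrier G. (\<lambda>j. \<delta>G (1 / \<tau> j) (hol b' (\<tau> j))) \<longlonglongrightarrow> x \<longleftrightarrow>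
               (\<lambda>j. \<delta>G (1 / \<tau> j) (hol b (\<tau> j))) \<longlonglongrightarrow> x))) \<and>
     (\<forall>(l' :: real \<Rightarrow> 'g) (C :: real).
        continuous_on {0..1} l' \<and> l' ` {0..1} \<subseteq> V 1 \<and> bounded_variation l' 0 1 \<and>
        uniform_limit {0..1} (rescaled l) l' at_top \<and>
        (\<forall>\<^sub>F T in at_top. variation (rescaled l T) 0 1 \<le> ennreal C) \<longrightarrow>
        ((\<lambda>T. \<delta> (1 / T) (Log Exp (hol b T))) \<longlongrightarrow> H l' 0 1) at_top \<and>
        ((\<lambda>T. \<delta>G (1 / T) (hol b T)) \<longlongrightarrow> Exp (H l' 0 1)) at_top \<and>
        (\<forall>b' Q'. closing_family G Exp atlas A x0 c b' Q' \<longrightarrow>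
          (\<forall>X. ((\<lambda>T. \<delta> (1 / T) (Log Exp (hol b' T))) \<longlongrightarrow> X) at_top \<longleftrightarrow>
               ((\<lambda>T. \<delta> (1 / T) (Log Exp (hol b T))) \<longlongrightarrow> X) at_top) \<and>
          (\<forall>x\<in>carrier G. ((\<lambda>T. \<delta>G (1 / T) (hol b' T)) \<longlongrightarrow> x) at_top \<longleftrightarrow>
               ((\<lambda>T. \<delta>G (1 / T) (hol b T)) \<longlongrightarrow> x) at_top)))"
proof -
  from assms have alg: "graded_lie_algebra bracket V n" and grp: "exponential_lie_group bracket G Exp" by blast+
  interpret graded_lie_group bracket V n G Exp
    using alg grp by (rule graded_lie_group.intro)
  have \<delta>G: "\<delta>G r x = Exp (\<delta> r (Log Exp x))" for r x
    by (simp add: \<delta>G_def \<delta>_def group_dilation_def)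
  have paths: "\<forall>T>0. ac_path atlas c 0 T" "\<forall>T>0. bounded_variation l 0 T"
      "\<forall>T>0. has_lie_integral G Exp atlas A c 0 T (chacon_fomenko bracket V n l 0 T)"
    using assms(14,17,18) unfolding H_def by blast+
  note limit = dilated_holonomy_limit[OF \<open>one_form atlas A\<close> \<open>holonomy_rep G Exp atlas A x0 \<rho>\<close> \<open>c 0 = x0\<close>
      paths(1) \<open>continuous_on {0..} l\<close> \<open>l ` {0..} \<subseteq> V 1\<close> paths(2,3),
      folded H_def \<delta>_def]
  have seq: "(\<lambda>j. \<delta> (1 / \<tau> j) (Log Exp (hol b' (\<tau> j)))) \<longlonglongrightarrow> H l' 0 1"
    if clo: "closing_family G Exp atlas A x0 c b' Q'"
      and \<tau>: "filterlim \<tau> at_top sequentially"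
      and l': "continuous_on {0..1} l'" "l' ` {0..1} \<subseteq> V 1" "bounded_variation l' 0 1"
      and lim: "uniform_limit {0..1} (\<lambda>j. rescaled l (\<tau> j)) l' sequentially"
      and var: "(SUP j. variation (rescaled l (\<tau> j)) 0 1) < \<infinity>"
    for \<tau> :: "nat \<Rightarrow> real" and l' b' Q'
  proof -
    have "variation (rescaled l (\<tau> j)) 0 1 \<le> ennreal (enn2real (SUP j. variation (rescaled l (\<tau> j)) 0 1))" for j
      using var SUP_upper[of j UNIV "\<lambda>j. variation (rescaled l (\<tau> j)) 0 1"] by simp
    then show ?thesis
      unfolding hol_def by (intro limit[OF clo \<tau> l' lim] always_eventually allI)
  qed
  have full: "((\<lambda>T. \<delta> (1 / T) (Log Exp (hol b' T))) \<longlongrightarrow> H l' 0 1) at_top"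
    if clo: "closing_family G Exp atlas A x0 c b' Q'"
      and l': "continuous_on {0..1} l'" "l' ` {0..1} \<subseteq> V 1" "bounded_variation l' 0 1"
      and lim: "uniform_limit {0..1} (rescaled l) l' at_top"
      and var: "\<forall>\<^sub>F T in at_top. variation (rescaled l T) 0 1 \<le> ennreal C"
    for l' C b' Q'
    unfolding hol_def by (rule limit[OF clo filterlim_ident l' lim var])
  note same = tendsto_iff_of_common_limit[OF trivial_limit_sequentially]
    and same_at_top = tendsto_iff_of_common_limit[OF trivial_limit_at_top_linorder]
  show ?thesis
    unfolding \<delta>G
  proof ((intro conjI allI impI ballI; elim conjE), goal_cases)
    case (1 \<tau> l')
    then show ?case using seq[OF assms(19)] by blast
  next
    case (2 \<tau> l')
    then have "(\<lambda>j. \<delta> (1 / \<tau> j) (Log Exp (hol b (\<tau> j)))) \<longlonglongrightarrow> H l' 0 1"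
      using seq[OF assms(19)] by blast
    then show ?case by (simp add: tendsto_Exp_iff)
  next
    case (3 \<tau> l' b' Q' X)
    then show ?case by (intro same[OF seq seq[OF assms(19)]])
  next
    case (4 \<tau> l' b' Q' x)
    then show ?case unfolding tendsto_Exp_iff[OF 4(2)] by (intro same[OF seq seq[OF assms(19)]])
  next
    case (5 l' C)
    then show ?case using full[OF assms(19)] by blast
  next
    case (6 l' C)
    then have "((\<lambda>T. \<delta> (1 / T) (Log Exp (hol b T))) \<longlongrightarrow> H l' 0 1) at_top"
      using full[OF assms(19)] by blast
    then show ?case by (simp add: tendsto_Exp_iff)
  next
    case (7 l' C b' Q' X)
    then show ?case by (intro same_at_top[OF full full[OF assms(19)]])
  next
    case (8 l' C b' Q' x)
    then show ?case unfolding tendsto_Exp_iff[OF 8(2)] by (intro same_at_top[OF full full[OF assms(19)]])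
  qed
qed

end
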